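(* Let $m\ge 3$ be an integer and let $U_1,U_2,\ldots$ be independent points uniformly distributed on the unit circumference $\mathbb{S}$. For $n\ge m$ let $\mathrm{peri}_n^m$ be the minimal perimeter among all circumscribed $m$-polygons determined by $m$-element subsets $\{U_{i_1},\ldots,U_{i_m}\}$, $1\le i_1<\ldots<i_m\le n$, where the circumscribed $m$-polygon determined by such a subset is the one bounded by the tangents to $\mathbb{S}$ at these points. Then for each $t>0$ $$\lim_{n\to\infty}P\left\{n^{\frac{2m}{m-1}}\left(\mathrm{peri}_n^m-2m\tan\frac{\pi}{m}\right)\le t\right\}=1-\exp\left\{-\frac{t^{\frac{m-1}{2}}}{K_{3m}}\right\},$$ where $$K_{3m}=m^{\frac32}\left(2\pi\left(1+\tan^2\frac{\pi}{m}\right)\tan\frac{\pi}{m}\right)^{\frac{m-1}{2}}\Gamma\left(\frac{m+1}{2}\right).$$ The rate of convergence is $O\left(n^{-\frac{1}{m-1}}\right)$; that is, for each fixed $t>0$ the absolute difference between the probability on the left and its limit is $O\left(n^{-\frac{1}{m-1}}\right)$ as $n\to\infty$.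
   Context: The unit circumference $\mathbb{S}$ is the circle of radius $1$ in the plane. Given $m$ distinct points of $\mathbb{S}$, listed in cyclic order along the circle as $u_1,\ldots,u_m$ (with $u_{m+1}=u_1$), draw the tangent lines to $\mathbb{S}$ at these points and let $v_k$ be the intersection point of the tangents at $u_k$ and $u_{k+1}$, $k=1,\ldots,m$. The points determine a convex circumscribed $m$-polygon, with vertices $v_1,\ldots,v_m$, exactly when they are not all contained in a closed semicircle (equivalently, every arc between cyclically consecutive points has length less than $\pi$); only such $m$-subsets are taken into account in the minimum, and the minimum over the empty collection is $+\infty$. $\Gamma$ is Euler's gamma function. Here $m$ is fixed as $n\to\infty$. *)

theory Defs
  imports "HOL-Probability.Probability" "HOL-Library.Landau_Symbols"
begin

text \<open>The plane is identified with the type \<^typ>\<open>complex\<close>, and the unit circumference is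
  \<^term>\<open>sphere 0 1 :: complex set\<close>.\<close>

text \<open>Normalized arc length: the law of the point with uniformly distributed polar angle.\<close>

definition uniform_circle :: "complex measure" where
  "uniform_circle = distr (uniform_measure lborel {0..<2 * pi}) borel cis"

definition tangent_line :: "complex \<Rightarrow> complex set" where
  "tangent_line u = {z. (z - u) \<bullet> u = 0}"

definition tangent_intersection :: "complex \<Rightarrow> complex \<Rightarrow> complex" where
  "tangent_intersection u w = (THE v. v \<in> tangent_line u \<inter> tangent_line w)"

definition closed_semicircle :: "complex \<Rightarrow> complex set" where
  "closed_semicircle w = {z \<in> sphere 0 1. 0 \<le> z \<bullet> w}"

definition determines_polygon :: "complex set \<Rightarrow> bool" where
  "determines_polygon A \<longleftrightarrow> finite A \<and> A \<subseteq> sphere 0 1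
     \<and> \<not> (\<exists>w \<in> sphere 0 1. A \<subseteq> closed_semicircle w)"

text \<open>The points are listed counterclockwise, by polar angle in \<open>[0, 2\<pi>)\<close>; on the unit
  circumference the polar angle is injective, so this lists every point exactly once.\<close>

definition cyclic_list :: "complex set \<Rightarrow> complex list" where
  "cyclic_list A = sorted_key_list_of_set Arg2pi A"

definition polygon_vertices :: "complex set \<Rightarrow> complex list" where
  "polygon_vertices A = (let us = cyclic_list A; m = length us in
     map (\<lambda>k. tangent_intersection (us ! k) (us ! (Suc k mod m))) [0..<m])"

definition perimeter :: "complex list \<Rightarrow> real" where
  "perimeter vs = (\<Sum>k<length vs. dist (vs ! k) (vs ! (Suc k mod length vs)))"

text \<open>The infimum is over a finite collection, hence a minimum, and it is \<open>\<infinity>\<close> if that collection is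
  empty. The condition \<open>card A = m\<close> on the image excludes coinciding points.\<close>

definition min_perimeter :: "nat \<Rightarrow> nat \<Rightarrow> (nat \<Rightarrow> complex) \<Rightarrow> ereal" where
  "min_perimeter m n u =
     (INF A \<in> {A. \<exists>I \<subseteq> {1..n}. card I = m \<and> A = u ` I \<and> card A = m \<and> determines_polygon A}.
        ereal (perimeter (polygon_vertices A)))"

definition K3 :: "nat \<Rightarrow> real" where
  "K3 m = real m powr (3 / 2)
     * (2 * pi * (1 + (tan (pi / real m))\<^sup>2) * tan (pi / real m)) powr ((real m - 1) / 2)
     * Gamma ((real m + 1) / 2)"

end

theory Submission
  imports Defs
begin

text \<open>With \<open>\<theta>\<^sub>i\<close> the polar angle of \<open>U\<^sub>i\<close>, the polygon has perimeter \<open>2 \<Sum> tan (g\<^sub>k / 2)\<close>, where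
  \<open>g\<^sub>1, \<dots>, g\<^sub>m\<close> are the gaps between cyclically consecutive angles. Since \<open>\<Sum> g\<^sub>k = 2 \<pi>\<close>, a
  second-order Taylor expansion at \<open>g\<^sub>k = 2 \<pi> / m\<close> shows that the excess perimeter is, up to a
  factor \<open>1 + O (\<surd>s)\<close>, a multiple of \<open>\<Sum> (g\<^sub>k - 2 \<pi> / m)\<^sup>2\<close>. So the probability that \<open>m\<close>
  given points have excess at most \<open>s\<close> is an ellipsoid volume, which is computed by completing
  the square. The number of \<open>m\<close>-tuples with excess at most \<open>s = t n\<^bsup>-2m/(m-1)\<^esup>\<close> is a sum of
  indicators, two of which are independent unless the tuples share an index, so it is nearly Poisson.
  Two tuples with \<open>k\<close> indices altogether, at least one of them shared, are simultaneously
  near-regular with probability \<open>O (s\<^bsup>(k-1)/2\<^esup>)\<close>, because each further angle is determined by the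
  shared one up to \<open>O (\<surd>s)\<close> and a multiple of \<open>2 \<pi> / m\<close>; the case \<open>k = m + 1\<close> dictates the
  rate.\<close>

section \<open>Poisson approximation under local dependence\<close>

text \<open>The scale is forced: about n^m tuples are each near-regular with probability of order
  s^((m-1)/2), and n^m s^((m-1)/2) stays away from 0 and infinity exactly for s of order
  n^(-2m/(m-1)). Put x = n^(-1/(m-1)), so that n x^(m-1) = 1 and sqrt s is of order x^m. There are
  O(n^k) overlapping pairs with k indices altogether, so they contribute O(n^k x^(m(k-1))) =
  O(x^(k-m)). For k = m this would not vanish; such pairs are harmless only because two distinct
  orderings of one index set are never near-regular together. Then k = m + 1 gives x, the claimed
  rate. The other errors are no larger: 1/n = x^(m-1) from the number of tuples and from products of
  probabilities, and sqrt s from the Taylor expansion. The Taylor expansion is local but the event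
  is not. Convexity of the tangent bridges this: every gap has nonnegative excess, so a small total
  makes each single excess small and no gap can stray far from 2 pi / m. Only the probability that
  no event occurs is needed, so a differential inequality for a generating function on [0, 1]
  suffices.\<close>

lemma abs_power_diff_le:
  fixes y :: real
  assumes "0 \<le> y" "y \<le> 1" "k \<le> l"
  shows "\<bar>y ^ l - y ^ k\<bar> \<le> real (l - k)"
proof -
  have nonneg: "0 \<le> 1 - y ^ (l - k)" using assms by (simp add: power_le_one)
  have "1 - y ^ (l - k) \<le> real (l - k)"
  proof (cases "l = k")
    case False
    then have "1 \<le> real (l - k)" using assms by simp
    then show ?thesis using assms(1) by (meson diff_le_eq dual_order.trans le_add_same_cancel1 zero_le_power)
  qed auto
  moreover have "\<bar>y ^ l - y ^ k\<bar> = y ^ k * (1 - y ^ (l - k))"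
  proof -
    have "y ^ k - y ^ l = y ^ k * (1 - y ^ (l - k))"
      using assms by (simp add: algebra_simps flip: power_add)
    moreover have "0 \<le> y ^ k * (1 - y ^ (l - k))"
      using nonneg assms by (intro mult_nonneg_nonneg) auto
    ultimately show ?thesis by argo
  qed
  moreover have "y ^ k * (1 - y ^ (l - k)) \<le> 1 * (1 - y ^ (l - k))"
    using nonneg assms by (intro mult_right_mono) (auto simp: power_le_one)
  ultimately show ?thesis by argo
qed

text \<open>The generating function \<open>F y = E y\<^sup>W\<close> almost satisfies \<open>F' = \<lambda> F\<close>,
  and \<open>F 1 = 1\<close>, \<open>F 0 = P (W = 0)\<close>.\<close>

lemma (in prob_space) local_dependence_poisson:
  fixes E :: "'i \<Rightarrow> 'a set" and B :: "'i \<Rightarrow> 'i set"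
  assumes fin: "finite A" and ev: "\<And>i. i \<in> A \<Longrightarrow> E i \<in> events"
    and refl: "\<And>i. i \<in> A \<Longrightarrow> i \<in> B i"
    and ind: "\<And>i y. i \<in> A \<Longrightarrow> 0 \<le> y \<Longrightarrow> y \<le> 1 \<Longrightarrow>
      expectation (\<lambda>\<omega>. indicator (E i) \<omega> * y ^ card {j \<in> A - B i. \<omega> \<in> E j})
        = prob (E i) * expectation (\<lambda>\<omega>. y ^ card {j \<in> A - B i. \<omega> \<in> E j})"
  shows "\<bar>prob (space M - (\<Union>i\<in>A. E i)) - exp (- (\<Sum>i\<in>A. prob (E i)))\<bar>
    \<le> (\<Sum>i\<in>A. \<Sum>j\<in>A \<inter> B i. prob (E i) * prob (E j))
      + (\<Sum>i\<in>A. \<Sum>j\<in>A \<inter> B i - {i}. prob (E i \<inter> E j))"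
    (is "_ \<le> ?\<epsilon>")
proof -
  define W where "W = (\<lambda>\<omega>. card {j \<in> A. \<omega> \<in> E j})"
  define V where "V = (\<lambda>i \<omega>. card {j \<in> A - B i. \<omega> \<in> E j})"
  define Z where "Z = (\<lambda>i \<omega>. card {j \<in> A \<inter> B i - {i}. \<omega> \<in> E j})"
  define \<Lambda> where "\<Lambda> = (\<Sum>i\<in>A. prob (E i))"
  note [measurable] = ev
  have [simp]: "real (indicator S x) = indicator S x" for S and x :: 'a by (simp add: indicator_def)
  have card_sum: "card {j \<in> S. \<omega> \<in> E j} = (\<Sum>j\<in>S. indicator (E j) \<omega>)" if "finite S" for S \<omega>
    using that by (simp add: indicator_def sum.If_cases) (simp add: Int_def)
  have meas: "(\<lambda>\<omega>. card {j \<in> S. \<omega> \<in> E j}) \<in> measurable M (count_space UNIV)" if "S \<subseteq> A" for S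
  proof -
    have "finite S" using that fin finite_subset by auto
    moreover have "(indicator (E j) :: _ \<Rightarrow> nat) \<in> measurable M (count_space UNIV)" if "j \<in> S" for j
    proof -
      have "E j \<in> events" using that \<open>S \<subseteq> A\<close> ev by auto
      then show ?thesis unfolding indicator_def of_bool_def by measurable
    qed
    ultimately show ?thesis by (auto simp: card_sum intro!: measurable_sum_nat)
  qed
  have meas2: "(\<lambda>\<omega>. f (card {j \<in> S. \<omega> \<in> E j})) \<in> borel_measurable M" if "S \<subseteq> A" for S and f :: "nat \<Rightarrow> real"
    using measurable_compose[OF meas[OF that], of f borel] by simp
  have cb: "card {j \<in> S. \<omega> \<in> E j} \<le> card A" if "S \<subseteq> A" for S \<omega>
    using that fin by (intro card_mono) auto
  define F where "F = (\<lambda>y::real. expectation (\<lambda>\<omega>. y ^ W \<omega>))"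
  \<comment> \<open>This is the derivative of \<open>F\<close>, because the indicators sum to
    \<open>W\<close>. The truncated \<open>W \<omega> - 1\<close> is harmless: where
    \<open>W\<close> is 0, all indicators vanish.\<close>
  define F' where "F' = (\<lambda>y::real. \<Sum>i\<in>A. expectation (\<lambda>\<omega>. indicator (E i) \<omega> * y ^ (W \<omega> - 1)))"
  have F_sum: "F y = (\<Sum>k\<le>card A. prob {\<omega> \<in> space M. W \<omega> = k} * y ^ k)" for y
  proof -
    have "F y = expectation (\<lambda>\<omega>. \<Sum>k\<le>card A. y ^ k * indicator {\<omega> \<in> space M. W \<omega> = k} \<omega>)"
      unfolding F_def using cb[of A]
      by (intro Bochner_Integration.integral_cong) (auto simp: indicator_def W_def if_distrib sum.delta cong: if_cong)
    also have "\<dots> = (\<Sum>k\<le>card A. y ^ k * prob {\<omega> \<in> space M. W \<omega> = k})"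
      using meas[of A] by (subst Bochner_Integration.integral_sum)
        (auto simp: W_def less_top[symmetric] intro!: integrable_mult_right integrable_real_indicator)
    finally show ?thesis by (simp add: mult.commute)
  qed
  have F1: "F 1 = 1" by (simp add: F_def prob_space)
  \<comment> \<open>Relies on 0 ^ 0 = 1, which makes y ^ W at y = 0 the indicator of W = 0.\<close>
  have F0: "F 0 = prob (space M - (\<Union>i\<in>A. E i))"
  proof -
    have "F 0 = expectation (indicator (space M - (\<Union>i\<in>A. E i)))"
      unfolding F_def by (intro Bochner_Integration.integral_cong)
        (auto simp: W_def power_0_left indicator_def fin)
    moreover have "(space M - (\<Union>i\<in>A. E i)) \<inter> space M = space M - (\<Union>i\<in>A. E i)" by blast
    ultimately show ?thesis using ev fin by simp
  qed
  have int: "integrable M (\<lambda>\<omega>. g \<omega> * f (card {j \<in> S. \<omega> \<in> E j}))"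
    if "S \<subseteq> A" "g \<in> borel_measurable M" "\<And>\<omega>. \<bar>g \<omega>\<bar> \<le> 1" for S g and f :: "nat \<Rightarrow> real"
  proof (rule integrable_const_bound[where B = "\<Sum>k\<le>card A. \<bar>f k\<bar>"])
    show "AE \<omega> in M. norm (g \<omega> * f (card {j \<in> S. \<omega> \<in> E j})) \<le> (\<Sum>k\<le>card A. \<bar>f k\<bar>)"
    proof (intro AE_I2)
      fix \<omega>
      have "\<bar>f (card {j \<in> S. \<omega> \<in> E j})\<bar> \<le> (\<Sum>k\<le>card A. \<bar>f k\<bar>)"
        by (rule member_le_sum) (use cb[OF that(1)] in auto)
      then show "norm (g \<omega> * f (card {j \<in> S. \<omega> \<in> E j})) \<le> (\<Sum>k\<le>card A. \<bar>f k\<bar>)"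
        using mult_mono[OF that(3)[of \<omega>], of "\<bar>f (card {j \<in> S. \<omega> \<in> E j})\<bar>" "\<Sum>k\<le>card A. \<bar>f k\<bar>"]
        by (simp add: abs_mult)
    qed
  qed (use meas2[OF that(1), of f] that(2) in auto)
  have int1: "integrable M (\<lambda>\<omega>. f (card {j \<in> S. \<omega> \<in> E j}))" if "S \<subseteq> A" for S and f :: "nat \<Rightarrow> real"
    using int[OF that, of "\<lambda>_. 1" f] by simp
  have intE: "integrable M (\<lambda>\<omega>. indicator (E i) \<omega> * f (card {j \<in> S. \<omega> \<in> E j}))"
    if "S \<subseteq> A" "i \<in> A" for S i and f :: "nat \<Rightarrow> real"
    using int[OF that(1), of "indicator (E i)" f] ev[OF that(2)] by (auto simp: indicator_def)
  have F'_sum: "F' y = (\<Sum>k\<le>card A. prob {\<omega> \<in> space M. W \<omega> = k} * (real k * y ^ (k - 1)))" for y :: real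
  proof -
    have "F' y = expectation (\<lambda>\<omega>. \<Sum>i\<in>A. indicator (E i) \<omega> * y ^ (W \<omega> - 1))"
      unfolding F'_def using intE[of A _ "\<lambda>k. y ^ (k - 1)"]
      by (subst Bochner_Integration.integral_sum) (auto simp: W_def)
    also have "\<dots> = expectation (\<lambda>\<omega>. real (W \<omega>) * y ^ (W \<omega> - 1))"
      by (simp add: W_def card_sum fin flip: sum_distrib_right)
    also have "\<dots> = expectation (\<lambda>\<omega>. \<Sum>k\<le>card A. (real k * y ^ (k - 1)) * indicator {\<omega> \<in> space M. W \<omega> = k} \<omega>)"
      using cb[of A]
      by (intro Bochner_Integration.integral_cong) (auto simp: indicator_def W_def if_distrib sum.delta cong: if_cong)
    also have "\<dots> = (\<Sum>k\<le>card A. (real k * y ^ (k - 1)) * prob {\<omega> \<in> space M. W \<omega> = k})"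
      using meas[of A] by (subst Bochner_Integration.integral_sum)
        (auto simp: W_def less_top[symmetric] intro!: integrable_mult_right integrable_real_indicator)
    finally show ?thesis by (simp add: mult.commute)
  qed
  have deriv: "(F has_real_derivative F' y) (at y)" for y
    unfolding F_sum F'_sum by (auto intro!: derivative_eq_intros sum.cong simp: mult_ac)
  \<comment> \<open>On \<open>E i\<close> the exponent W - 1 is replaced by the count
    \<open>V i\<close> outside the neighbourhood, at the cost of the expected number of neighbouring
    events on \<open>E i\<close>. Independence then splits off \<open>prob (E i)\<close>. Returning
    from \<open>V i\<close> to \<open>W\<close> costs the expected number of events in the whole
    neighbourhood, \<open>i\<close> included.\<close>
  have key: "\<bar>F' y - \<Lambda> * F y\<bar> \<le> ?\<epsilon>" if y: "0 \<le> y" "y \<le> 1" for y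
  proof -
    have 1: "\<bar>expectation (\<lambda>\<omega>. indicator (E i) \<omega> * y ^ (W \<omega> - 1)) - expectation (\<lambda>\<omega>. indicator (E i) \<omega> * y ^ V i \<omega>)\<bar>
        \<le> (\<Sum>j\<in>A \<inter> B i - {i}. prob (E i \<inter> E j))" if i: "i \<in> A" for i
    proof -
      have W: "W \<omega> = Suc (V i \<omega> + Z i \<omega>)" if "\<omega> \<in> E i" for \<omega>
      proof -
        have eq: "{j \<in> A. \<omega> \<in> E j} = insert i ({j \<in> A - B i. \<omega> \<in> E j} \<union> {j \<in> A \<inter> B i - {i}. \<omega> \<in> E j})"
          using that i refl[OF i] by auto
        moreover have "card ({j \<in> A - B i. \<omega> \<in> E j} \<union> {j \<in> A \<inter> B i - {i}. \<omega> \<in> E j}) = V i \<omega> + Z i \<omega>"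
          unfolding V_def Z_def using fin by (intro card_Un_disjoint) auto
        ultimately show ?thesis unfolding W_def eq using fin refl[OF i] by (subst card_insert_disjoint) auto
      qed
      have "\<bar>expectation (\<lambda>\<omega>. indicator (E i) \<omega> * y ^ (W \<omega> - 1)) - expectation (\<lambda>\<omega>. indicator (E i) \<omega> * y ^ V i \<omega>)\<bar>
        = \<bar>expectation (\<lambda>\<omega>. indicator (E i) \<omega> * y ^ (W \<omega> - 1) - indicator (E i) \<omega> * y ^ V i \<omega>)\<bar>"
        using intE[of A i "\<lambda>k. y ^ (k - 1)"] intE[of "A - B i" i "\<lambda>k. y ^ k"] i
        by (subst Bochner_Integration.integral_diff) (auto simp: W_def V_def)
      also have "\<dots> \<le> expectation (\<lambda>\<omega>. \<bar>indicator (E i) \<omega> * y ^ (W \<omega> - 1) - indicator (E i) \<omega> * y ^ V i \<omega>\<bar>)"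
        by (rule integral_abs_bound)
      also have "\<dots> \<le> expectation (\<lambda>\<omega>. indicator (E i) \<omega> * real (Z i \<omega>))"
      proof (rule integral_mono)
        show "\<bar>indicator (E i) \<omega> * y ^ (W \<omega> - 1) - indicator (E i) \<omega> * y ^ V i \<omega>\<bar> \<le> indicator (E i) \<omega> * real (Z i \<omega>)" for \<omega>
          using W[of \<omega>] abs_power_diff_le[OF y, of "V i \<omega>" "V i \<omega> + Z i \<omega>"] by (auto simp: indicator_def)
      qed (use intE[of A i "\<lambda>k. y ^ (k - 1)"] intE[of "A - B i" i "\<lambda>k. y ^ k"] i
          intE[of "A \<inter> B i - {i}" i real] in \<open>auto simp: W_def V_def Z_def intro!: integrable_abs Bochner_Integration.integrable_diff\<close>)
      also have "\<dots> = expectation (\<lambda>\<omega>. \<Sum>j\<in>A \<inter> B i - {i}. indicator (E i \<inter> E j) \<omega>)"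
        using fin by (simp only: Z_def card_sum[OF finite_Diff[OF finite_Int[OF disjI1]]] indicator_inter_arith sum_distrib_left of_nat_sum \<open>\<And>S x. real (indicator S x) = indicator S x\<close>)
      also have "\<dots> = (\<Sum>j\<in>A \<inter> B i - {i}. prob (E i \<inter> E j))"
        using ev i by (subst Bochner_Integration.integral_sum) (auto simp: less_top[symmetric] intro!: integrable_real_indicator)
      finally show ?thesis .
    qed
    have 2: "\<bar>prob (E i) * F y - prob (E i) * expectation (\<lambda>\<omega>. y ^ V i \<omega>)\<bar>
        \<le> (\<Sum>j\<in>A \<inter> B i. prob (E i) * prob (E j))" if i: "i \<in> A" for i
    proof -
      have W: "W \<omega> = V i \<omega> + card {j \<in> A \<inter> B i. \<omega> \<in> E j}" for \<omega>
      proof -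
        have "{j \<in> A. \<omega> \<in> E j} = {j \<in> A - B i. \<omega> \<in> E j} \<union> {j \<in> A \<inter> B i. \<omega> \<in> E j}"
          by auto
        then show ?thesis
          unfolding V_def W_def using fin by (simp, intro card_Un_disjoint) auto
      qed
      have "\<bar>F y - expectation (\<lambda>\<omega>. y ^ V i \<omega>)\<bar> = \<bar>expectation (\<lambda>\<omega>. y ^ W \<omega> - y ^ V i \<omega>)\<bar>"
        unfolding F_def
        using int1[of A "\<lambda>k. y ^ k"] int1[of "A - B i" "\<lambda>k. y ^ k"]
        by (subst Bochner_Integration.integral_diff) (auto simp: W_def V_def)
      also have "\<dots> \<le> expectation (\<lambda>\<omega>. \<bar>y ^ W \<omega> - y ^ V i \<omega>\<bar>)"
        by (rule integral_abs_bound)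
      also have "\<dots> \<le> expectation (\<lambda>\<omega>. real (card {j \<in> A \<inter> B i. \<omega> \<in> E j}))"
      proof (rule integral_mono)
        show "\<bar>y ^ W \<omega> - y ^ V i \<omega>\<bar> \<le> real (card {j \<in> A \<inter> B i. \<omega> \<in> E j})" for \<omega>
          using W[of \<omega>] abs_power_diff_le[OF y, of "V i \<omega>" "W \<omega>"] by auto
      qed (use int1[of A "\<lambda>k. y ^ k"] int1[of "A - B i" "\<lambda>k. y ^ k"]
          int1[of "A \<inter> B i" real] in \<open>auto simp: W_def V_def intro!: integrable_abs Bochner_Integration.integrable_diff\<close>)
      also have "\<dots> = expectation (\<lambda>\<omega>. \<Sum>j\<in>A \<inter> B i. indicator (E j) \<omega>)"
        using fin by (simp only: card_sum[OF finite_Int[OF disjI1]] of_nat_sum \<open>\<And>S x. real (indicator S x) = indicator S x\<close>)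
      also have "\<dots> = (\<Sum>j\<in>A \<inter> B i. prob (E j))"
        using ev by (subst Bochner_Integration.integral_sum) (auto simp: less_top[symmetric] intro!: integrable_real_indicator)
      finally have "prob (E i) * \<bar>F y - expectation (\<lambda>\<omega>. y ^ V i \<omega>)\<bar> \<le> prob (E i) * (\<Sum>j\<in>A \<inter> B i. prob (E j))"
        by (intro mult_left_mono) auto
      then show ?thesis
        by (simp add: sum_distrib_left abs_mult flip: right_diff_distrib)
    qed
    have 3: "expectation (\<lambda>\<omega>. indicator (E i) \<omega> * y ^ V i \<omega>) = prob (E i) * expectation (\<lambda>\<omega>. y ^ V i \<omega>)" if "i \<in> A" for i
      using ind[OF that y] by (simp add: V_def)
    have "F' y - \<Lambda> * F y = (\<Sum>i\<in>A. (expectation (\<lambda>\<omega>. indicator (E i) \<omega> * y ^ (W \<omega> - 1)) - prob (E i) * F y))"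
      by (simp add: F'_def \<Lambda>_def sum_subtractf sum_distrib_right)
    also have "\<bar>\<dots>\<bar> \<le> (\<Sum>i\<in>A. \<bar>expectation (\<lambda>\<omega>. indicator (E i) \<omega> * y ^ (W \<omega> - 1)) - prob (E i) * F y\<bar>)"
      by (rule sum_abs)
    also have "\<dots> \<le> (\<Sum>i\<in>A. (\<Sum>j\<in>A \<inter> B i. prob (E i) * prob (E j)) + (\<Sum>j\<in>A \<inter> B i - {i}. prob (E i \<inter> E j)))"
    proof (rule sum_mono)
      fix i assume "i \<in> A"
      from 1[OF this] 2[OF this] 3[OF this]
      show "\<bar>expectation (\<lambda>\<omega>. indicator (E i) \<omega> * y ^ (W \<omega> - 1)) - prob (E i) * F y\<bar>
        \<le> (\<Sum>j\<in>A \<inter> B i. prob (E i) * prob (E j)) + (\<Sum>j\<in>A \<inter> B i - {i}. prob (E i \<inter> E j))" by linarith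
    qed
    finally show ?thesis by (simp add: sum.distrib)
  qed
  \<comment> \<open>Integrating factor for F' = \<Lambda> F. The mean value theorem on [0, 1] bounds
    h 1 - h 0, which is exp (- \<Lambda>) minus the probability that no event occurs.\<close>
  define h where "h = (\<lambda>y::real. exp (- (\<Lambda> * y)) * F y)"
  have dh: "(h has_real_derivative exp (- (\<Lambda> * y)) * (F' y - \<Lambda> * F y)) (at y)" for y
    unfolding h_def by (auto intro!: derivative_eq_intros deriv simp: algebra_simps)
  obtain z where z: "0 < z" "z < 1" "h 1 - h 0 = exp (- (\<Lambda> * z)) * (F' z - \<Lambda> * F z)"
    using MVT2[of 0 1 h, OF _ dh] by auto
  have \<Lambda>: "0 \<le> \<Lambda>" by (auto simp: \<Lambda>_def intro: sum_nonneg)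
  have "\<bar>h 1 - h 0\<bar> = exp (- (\<Lambda> * z)) * \<bar>F' z - \<Lambda> * F z\<bar>"
    by (simp add: z abs_mult)
  also have "\<dots> \<le> 1 * ?\<epsilon>"
    using z \<Lambda> by (intro mult_mono key) auto
  finally have "\<bar>exp (- \<Lambda>) - prob (space M - (\<Union>i\<in>A. E i))\<bar> \<le> ?\<epsilon>"
    by (simp add: h_def F1 F0)
  then show ?thesis by (simp add: \<Lambda>_def abs_minus_commute)
qed

section \<open>Triangular substitutions and ellipsoid volumes\<close>

text \<open>Integrate over coordinate \<open>k\<close> innermost. The last hypothesis says that
  \<open>c\<close> ignores this coordinate, so with the others fixed the map is affine in one
  variable, with Jacobian \<open>d\<close>.\<close>

lemma nn_integral_PiM_lborel_update:
  fixes f :: "('i \<Rightarrow> real) \<Rightarrow> ennreal"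
  assumes I: "finite I" "k \<in> I" and d: "0 < d"
    and [measurable]: "c \<in> borel_measurable (PiM I (\<lambda>_. lborel))" "f \<in> borel_measurable (PiM I (\<lambda>_. lborel))"
    and c: "\<And>x v. c (x(k := v)) = c x"
  shows "(\<integral>\<^sup>+x. f (x(k := d * (x k + c x))) \<partial>PiM I (\<lambda>_. lborel)) = ennreal (1 / d) * (\<integral>\<^sup>+x. f x \<partial>PiM I (\<lambda>_. lborel))"
proof -
  interpret product_sigma_finite "\<lambda>_. lborel :: real measure" by standard
  define J where "J = I - {k}"
  have J: "finite J" "k \<notin> J" "I = insert k J" using I by (auto simp: J_def)
  have [measurable]: "(\<lambda>x. x k) \<in> borel_measurable (PiM I (\<lambda>_. lborel :: real measure))"
    using measurable_component_singleton[OF I(2), of "\<lambda>_. lborel :: real measure"] by simp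
  have upd: "(\<lambda>x. x(k := g x)) \<in> measurable (PiM I (\<lambda>_. lborel)) (PiM I (\<lambda>_. lborel))"
    if "g \<in> borel_measurable (PiM I (\<lambda>_. lborel))" for g :: "('i \<Rightarrow> real) \<Rightarrow> real"
  proof -
    have "(\<lambda>x. x(k := g x)) \<in> measurable (PiM I (\<lambda>_. lborel)) (PiM (insert k I) (\<lambda>_. lborel))"
      using that by (intro measurable_fun_upd[where J = I]) auto
    then show ?thesis using I by (simp add: insert_absorb)
  qed
  have m1 [measurable]: "(\<lambda>x. f (x(k := d * (x k + c x)))) \<in> borel_measurable (PiM I (\<lambda>_. lborel))"
    by (intro measurable_compose[OF upd assms(5)]) measurable
  have "(\<integral>\<^sup>+x. f (x(k := d * (x k + c x))) \<partial>PiM I (\<lambda>_. lborel))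
      = (\<integral>\<^sup>+x. \<integral>\<^sup>+y. f (x(k := d * (y + c x))) \<partial>lborel \<partial>PiM J (\<lambda>_. lborel))"
    using product_nn_integral_insert[OF J(1,2), unfolded J(3)[symmetric], OF m1] by (simp add: c)
  also have "\<dots> = (\<integral>\<^sup>+x. ennreal (1 / d) * \<integral>\<^sup>+y. f (x(k := y)) \<partial>lborel \<partial>PiM J (\<lambda>_. lborel))"
  proof (rule nn_integral_cong)
    fix x assume x: "x \<in> space (PiM J (\<lambda>_. lborel :: real measure))"
    have [measurable]: "(\<lambda>y. f (x(k := y))) \<in> borel_measurable lborel"
      using x J by (intro measurable_compose[OF measurable_fun_upd[where J = J] assms(5)]) auto
    have "(\<integral>\<^sup>+y. f (x(k := y)) \<partial>lborel) = ennreal d * (\<integral>\<^sup>+y. f (x(k := d * (y + c x))) \<partial>lborel)"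
      using d nn_integral_real_affine[of "\<lambda>y. f (x(k := y))" d "d * c x"] by (simp add: algebra_simps)
    then show "(\<integral>\<^sup>+y. f (x(k := d * (y + c x))) \<partial>lborel) = ennreal (1 / d) * (\<integral>\<^sup>+y. f (x(k := y)) \<partial>lborel)"
      using d by (simp add: mult.assoc[symmetric] ennreal_mult[symmetric])
  qed
  also have "\<dots> = ennreal (1 / d) * (\<integral>\<^sup>+x. f x \<partial>PiM I (\<lambda>_. lborel))"
  proof -
    have [measurable]: "(\<lambda>x. \<integral>\<^sup>+y. f (x(k := y)) \<partial>lborel) \<in> borel_measurable (PiM J (\<lambda>_. lborel))"
    proof -
      have "(\<lambda>z. (fst z)(k := snd z)) \<in> measurable (PiM J (\<lambda>_. lborel) \<Otimes>\<^sub>M lborel) (PiM I (\<lambda>_. lborel :: real measure))"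
        unfolding J(3) by (intro measurable_fun_upd[where J = J]) auto
      from measurable_compose[OF this assms(5)] show ?thesis
        by (intro lborel.borel_measurable_nn_integral) (simp add: case_prod_beta')
    qed
    show ?thesis
      using product_nn_integral_insert[OF J(1,2), unfolded J(3)[symmetric], OF assms(5)] by (simp add: nn_integral_cmult)
  qed
  finally show ?thesis .
qed

text \<open>Performing the updates k = 1, ..., N in this order reproduces the simultaneous map: the
  shift \<open>c k\<close> reads only coordinate 0 and coordinates above \<open>k\<close>, none of
  which an earlier update has touched.\<close>

lemma nn_integral_PiM_lborel_triangular:
  fixes f :: "(nat \<Rightarrow> real) \<Rightarrow> ennreal" and d :: "nat \<Rightarrow> real" and c :: "nat \<Rightarrow> (nat \<Rightarrow> real) \<Rightarrow> real"
  assumes I: "finite I" "{1..N} \<subseteq> I" and d: "\<And>k. k \<in> {1..N} \<Longrightarrow> 0 < d k"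
    and c: "\<And>k. k \<in> {1..N} \<Longrightarrow> c k \<in> borel_measurable (PiM I (\<lambda>_. lborel))"
    and dep: "\<And>k x y. k \<in> {1..N} \<Longrightarrow> (\<And>i. i = 0 \<or> k < i \<Longrightarrow> x i = y i) \<Longrightarrow> c k x = c k y"
    and f: "f \<in> borel_measurable (PiM I (\<lambda>_. lborel))"
  shows "(\<integral>\<^sup>+x. f (\<lambda>i. if i \<in> {1..N} then d i * (x i + c i x) else x i) \<partial>PiM I (\<lambda>_. lborel))
    = ennreal (\<Prod>k\<in>{1..N}. 1 / d k) * (\<integral>\<^sup>+x. f x \<partial>PiM I (\<lambda>_. lborel))"
  using I d c dep f
proof (induction N arbitrary: f)
  case 0
  show ?case by simp
next
  case (Suc N)
  define T where "T = (\<lambda>x i. if i \<in> {1..N} then d i * (x i + c i x) else x i)"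
  define S where "S = (\<lambda>x. x(Suc N := d (Suc N) * (x (Suc N) + c (Suc N) x)))"
  have "f (\<lambda>i. if i \<in> {1..Suc N} then d i * (x i + c i x) else x i) = f (S (T x))" (is "?L x = _") for x
  proof -
    have "c (Suc N) (T x) = c (Suc N) x" by (rule Suc.prems(5)) (auto simp: T_def)
    then have "(\<lambda>i. if i \<in> {1..Suc N} then d i * (x i + c i x) else x i) = S (T x)"
      by (intro ext) (simp add: S_def T_def le_Suc_eq)
    then show ?thesis by (simp only:)
  qed
  then have "(\<integral>\<^sup>+x. f (\<lambda>i. if i \<in> {1..Suc N} then d i * (x i + c i x) else x i) \<partial>PiM I (\<lambda>_. lborel))
      = (\<integral>\<^sup>+x. f (S (T x)) \<partial>PiM I (\<lambda>_. lborel))" by (simp only:)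
  also have "\<dots> = ennreal (\<Prod>k\<in>{1..N}. 1 / d k) * (\<integral>\<^sup>+x. f (S x) \<partial>PiM I (\<lambda>_. lborel))"
    unfolding T_def
  proof (rule Suc.IH)
    have k: "Suc N \<in> I" using Suc.prems(2) by auto
    have [measurable]: "c (Suc N) \<in> borel_measurable (PiM I (\<lambda>_. lborel))" using Suc.prems(4) by auto
    have [measurable]: "(\<lambda>x. x (Suc N)) \<in> borel_measurable (PiM I (\<lambda>_. lborel :: real measure))"
      using measurable_component_singleton[OF k, of "\<lambda>_. lborel :: real measure"] by simp
    have "S \<in> measurable (PiM I (\<lambda>_. lborel)) (PiM (insert (Suc N) I) (\<lambda>_. lborel))"
      unfolding S_def by (intro measurable_fun_upd[where J = I]) auto
    then have "S \<in> measurable (PiM I (\<lambda>_. lborel)) (PiM I (\<lambda>_. lborel))" using k by (simp add: insert_absorb)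
    from measurable_compose[OF this Suc.prems(6)]
    show "(\<lambda>x. f (S x)) \<in> borel_measurable (PiM I (\<lambda>_. lborel))" .
    show "finite I" "{1..N} \<subseteq> I" using Suc.prems(1,2) by auto
    show "0 < d k" if "k \<in> {1..N}" for k using that by (intro Suc.prems(3)) auto
    show "c k \<in> borel_measurable (PiM I (\<lambda>_. lborel))" if "k \<in> {1..N}" for k
      using that by (intro Suc.prems(4)) auto
    show "c k x = c k y" if "k \<in> {1..N}" "\<And>i. i = 0 \<or> k < i \<Longrightarrow> x i = y i" for k x y
      using that(1) by (intro Suc.prems(5) that(2)) auto
  qed
  also have "(\<integral>\<^sup>+x. f (S x) \<partial>PiM I (\<lambda>_. lborel)) = ennreal (1 / d (Suc N)) * (\<integral>\<^sup>+x. f x \<partial>PiM I (\<lambda>_. lborel))"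
    unfolding S_def using Suc.prems(1,2)
    by (intro nn_integral_PiM_lborel_update Suc.prems(3,4,6) Suc.prems(5)) auto
  also have "ennreal (\<Prod>k\<in>{1..N}. 1 / d k) * (ennreal (1 / d (Suc N)) * (\<integral>\<^sup>+x. f x \<partial>PiM I (\<lambda>_. lborel)))
      = ennreal (\<Prod>k\<in>{1..Suc N}. 1 / d k) * (\<integral>\<^sup>+x. f x \<partial>PiM I (\<lambda>_. lborel))"
  proof -
    have "0 \<le> (\<Prod>k\<in>{1..N}. 1 / d k)" "0 \<le> 1 / d (Suc N)"
      using Suc.prems(3) by (auto intro!: prod_nonneg less_imp_le[OF Suc.prems(3)])
    then show ?thesis
      by (simp add: mult.assoc[symmetric] ennreal_mult[symmetric] prod.nat_ivl_Suc')
  qed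
  finally show ?case .
qed

text \<open>Gaussian elimination on a tridiagonal form: when x_k^2 / k is left over, adding (x_{k+1}
  - x_k)^2 and completing the square in x_k leaves x_{k+1}^2 / (k + 1). Each square involves only
  x_k and x_{k+1}, which makes the substitution triangular, and the pivots (k + 1) / k telescope to
  N + 1.\<close>

lemma sum_squared_differences_complete_square:
  fixes x :: "nat \<Rightarrow> real"
  assumes "x 0 = 0"
  shows "(\<Sum>k<Suc N. (x (Suc k) - x k)\<^sup>2)
    = (\<Sum>k\<in>{1..N}. (real k + 1) / real k * (x k - real k / (real k + 1) * x (Suc k))\<^sup>2) + (x (Suc N))\<^sup>2 / (real N + 1)"
proof (induction N)
  case 0
  then show ?case using assms by simp
next
  case (Suc N)
  define b where "b = real N + 1"
  have b: "b > 0" by (simp add: b_def)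
  have b2: "b + 1 \<noteq> 0" using b by linarith
  have "u\<^sup>2 / b + (v - u)\<^sup>2 = (b + 1) / b * (u - b / (b + 1) * v)\<^sup>2 + v\<^sup>2 / (b + 1)" for u v :: real
  proof -
    have "u - b / (b + 1) * v = ((b + 1) * u - b * v) / (b + 1)"
      using b b2 by (simp add: field_simps)
    then have "(b + 1) / b * (u - b / (b + 1) * v)\<^sup>2 = ((b + 1) * u - b * v)\<^sup>2 / (b * (b + 1))"
      using b b2 by (simp add: power2_eq_square)
    moreover have "((b + 1) * u - b * v)\<^sup>2 / (b * (b + 1)) + v\<^sup>2 / (b + 1) = u\<^sup>2 / b + (v - u)\<^sup>2"
      using b b2 by (simp add: divide_simps) (simp add: power2_eq_square algebra_simps)
    ultimately show ?thesis by simp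
  qed
  note step = this[of "x (Suc N)" "x (Suc (Suc N))"]
  have b': "b = real (Suc N)" "b + 1 = real (Suc N) + 1" by (simp_all add: b_def)
  have arith: "L = A + q \<Longrightarrow> A = S + p \<Longrightarrow> R = S + T \<Longrightarrow> p + q = T + w \<Longrightarrow> L = R + w" for L A q S p T w R :: real
    by linarith
  have 1: "(\<Sum>k<Suc (Suc N). (x (Suc k) - x k)\<^sup>2) = (\<Sum>k<Suc N. (x (Suc k) - x k)\<^sup>2) + (x (Suc (Suc N)) - x (Suc N))\<^sup>2"
    by (rule sum.lessThan_Suc)
  have 2: "(\<Sum>k\<in>{1..Suc N}. (real k + 1) / real k * (x k - real k / (real k + 1) * x (Suc k))\<^sup>2)
    = (\<Sum>k\<in>{1..N}. (real k + 1) / real k * (x k - real k / (real k + 1) * x (Suc k))\<^sup>2)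
      + (real (Suc N) + 1) / real (Suc N) * (x (Suc N) - real (Suc N) / (real (Suc N) + 1) * x (Suc (Suc N)))\<^sup>2"
    by (rule sum.cl_ivl_Suc[THEN trans]) simp
  show ?case
    by (rule arith[OF 1 Suc.IH[folded b_def, unfolded b'(1)] 2 step[unfolded b']])
qed

lemma emeasure_PiM_cylinder:
  fixes h r :: real
  assumes "0 < h" "0 < r"
  shows "emeasure (PiM {..<Suc N} (\<lambda>_. lborel)) {z \<in> space (PiM {..<Suc N} (\<lambda>_. lborel)).
      0 \<le> z 0 \<and> z 0 < h \<and> (\<Sum>k\<in>{1..N}. (z k)\<^sup>2) \<le> r\<^sup>2} = ennreal (h * unit_ball_vol (real N) * r ^ N)"
    (is "emeasure _ ?X = _")
proof -
  interpret product_sigma_finite "\<lambda>_. lborel :: real measure" by standard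
  have ins: "{..<Suc N} = insert 0 {1..N}" by auto
  have X: "?X \<in> sets (PiM {..<Suc N} (\<lambda>_. lborel))"
    by measurable
  let ?B = "{f. sqrt (\<Sum>i\<in>{1..N}. (f i)\<^sup>2) \<le> r} \<inter> space (PiM {1..N} (\<lambda>_. lborel :: real measure))"
  have B: "?B \<in> sets (PiM {1..N} (\<lambda>_. lborel))"
  proof -
    have "{f \<in> space (PiM {1..N} (\<lambda>_. lborel :: real measure)). sqrt (\<Sum>i\<in>{1..N}. (f i)\<^sup>2) \<le> r} \<in> sets (PiM {1..N} (\<lambda>_. lborel))"
      by measurable
    moreover have "?B = {f \<in> space (PiM {1..N} (\<lambda>_. lborel :: real measure)). sqrt (\<Sum>i\<in>{1..N}. (f i)\<^sup>2) \<le> r}" by auto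
    ultimately show ?thesis by simp
  qed
  have "emeasure (PiM {..<Suc N} (\<lambda>_. lborel)) ?X = (\<integral>\<^sup>+z. indicator ?X z \<partial>PiM (insert 0 {1..N}) (\<lambda>_. lborel))"
    using X unfolding ins by simp
  also have "\<dots> = (\<integral>\<^sup>+y. \<integral>\<^sup>+x. indicator ?X (x(0 := y)) \<partial>PiM {1..N} (\<lambda>_. lborel) \<partial>lborel)"
    using X unfolding ins by (intro product_nn_integral_insert_rev) auto
  also have "\<dots> = (\<integral>\<^sup>+y. indicator {0..<h} y * emeasure (PiM {1..N} (\<lambda>_. lborel)) ?B \<partial>lborel)"
  proof (rule nn_integral_cong)
    fix y :: real
    have "(\<integral>\<^sup>+x. indicator ?X (x(0 := y)) \<partial>PiM {1..N} (\<lambda>_. lborel))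
        = (\<integral>\<^sup>+x. indicator {0..<h} y * indicator ?B x \<partial>PiM {1..N} (\<lambda>_. lborel))"
    proof (rule nn_integral_cong)
      fix x :: "nat \<Rightarrow> real" assume x: "x \<in> space (PiM {1..N} (\<lambda>_. lborel :: real measure))"
      have "x(0 := y) \<in> space (PiM {..<Suc N} (\<lambda>_. lborel :: real measure))"
        using x unfolding ins by (auto simp: space_PiM PiE_def extensional_def)
      moreover have "(sqrt (\<Sum>i\<in>{1..N}. (x i)\<^sup>2) \<le> r) = ((\<Sum>i\<in>{1..N}. (x i)\<^sup>2) \<le> r\<^sup>2)"
        using assms(2) by (metis abs_of_nonneg less_imp_le real_sqrt_abs real_sqrt_le_iff)
      moreover have "(\<Sum>k\<in>{1..N}. ((x(0 := y)) k)\<^sup>2) = (\<Sum>k\<in>{1..N}. (x k)\<^sup>2)" by (rule sum.cong) auto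
      ultimately show "indicator ?X (x(0 := y)) = (indicator {0..<h} y * indicator ?B x :: ennreal)"
        using x by (auto simp: indicator_def)
    qed
    also have "\<dots> = indicator {0..<h} y * emeasure (PiM {1..N} (\<lambda>_. lborel)) ?B"
      using B by (subst nn_integral_cmult_indicator) auto
    finally show "(\<integral>\<^sup>+x. indicator ?X (x(0 := y)) \<partial>PiM {1..N} (\<lambda>_. lborel)) = \<dots>" .
  qed
  also have "\<dots> = ennreal h * emeasure (PiM {1..N} (\<lambda>_. lborel)) ?B"
    using assms by (simp add: nn_integral_multc)
  also have "emeasure (PiM {1..N} (\<lambda>_. lborel)) ?B = ennreal (unit_ball_vol (real (card {1..N})) * r ^ card {1..N})"
    using assms(2) by (intro emeasure_cball_aux) auto
  finally show ?thesis using assms by (simp add: ennreal_mult[symmetric] mult.assoc)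
qed


text \<open>\<open>x \<theta> k\<close> is the displacement of the k-th angle from the regular
  polygon based at \<open>\<theta> 0\<close>. It is set to 0 at both k = 0 and k = N + 1, since the
  polygon closes up after a full turn. Completing squares turns the region into a ball times an
  interval; the square roots of the pivots multiply to sqrt (N + 1), the denominator.\<close>

lemma emeasure_PiM_ellipsoid:
  fixes a h r :: real and N :: nat
  defines "x \<equiv> \<lambda>\<theta> k. if k = 0 \<or> k = Suc N then 0 else \<theta> k - \<theta> 0 - real k * a"
  defines "X \<equiv> {\<theta> \<in> space (PiM {..<Suc N} (\<lambda>_. lborel)).
      0 \<le> \<theta> 0 \<and> \<theta> 0 < h \<and> (\<Sum>k<Suc N. (x \<theta> (Suc k) - x \<theta> k)\<^sup>2) \<le> r\<^sup>2}"
  assumes "0 < h" "0 < r"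
  shows "X \<in> sets (PiM {..<Suc N} (\<lambda>_. lborel))"
    and "emeasure (PiM {..<Suc N} (\<lambda>_. lborel)) X = ennreal (h * unit_ball_vol (real N) * r ^ N / sqrt (real N + 1))"
proof -
  let ?M = "PiM {..<Suc N} (\<lambda>_. lborel) :: (nat \<Rightarrow> real) measure"
  define d where "d = (\<lambda>k. sqrt ((real k + 1) / real k))"
  \<comment> \<open>Obtained by writing x_k - k / (k + 1) * x_{k+1} as
    \<open>\<theta> k + c k \<theta>\<close>. The multiples of \<open>a\<close> cancel except for k
    = N, where x_{N+1} is 0 by convention.\<close>
  define c where "c = (\<lambda>k \<theta>. if k = N then - \<theta> 0 - real N * a
    else - (real k / (real k + 1)) * \<theta> (Suc k) - \<theta> 0 / (real k + 1))"
  define T where "T = (\<lambda>\<theta> i. if i \<in> {1..N} then d i * (\<theta> i + c i \<theta>) else \<theta> i)"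
  let ?Y = "{z \<in> space ?M. 0 \<le> z 0 \<and> z 0 < h \<and> (\<Sum>k\<in>{1..N}. (z k)\<^sup>2) \<le> r\<^sup>2}"
  have comp [measurable]: "(\<lambda>\<theta>. \<theta> k) \<in> borel_measurable ?M" if "k \<le> N" for k
    using measurable_component_singleton[of k "{..<Suc N}" "\<lambda>_. lborel :: real measure"] that by simp
  have Y: "?Y \<in> sets ?M" by measurable
  have c_meas: "c k \<in> borel_measurable ?M" if "k \<in> {1..N}" for k
  proof (cases "k = N")
    case True
    then show ?thesis by (simp add: c_def)
  next
    case False
    then have "Suc k \<le> N" using that by simp
    then show ?thesis using False by (auto simp: c_def intro!: comp borel_measurable_diff borel_measurable_times borel_measurable_divide)
  qed
  have sq: "(\<Sum>k<Suc N. (x \<theta> (Suc k) - x \<theta> k)\<^sup>2) = (\<Sum>k\<in>{1..N}. (T \<theta> k)\<^sup>2)" for \<theta>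
  proof -
    have "(\<Sum>k<Suc N. (x \<theta> (Suc k) - x \<theta> k)\<^sup>2)
      = (\<Sum>k\<in>{1..N}. (real k + 1) / real k * (x \<theta> k - real k / (real k + 1) * x \<theta> (Suc k))\<^sup>2)"
      using sum_squared_differences_complete_square[of "x \<theta>" N] by (simp add: x_def)
    also have "\<dots> = (\<Sum>k\<in>{1..N}. (T \<theta> k)\<^sup>2)"
    proof (rule sum.cong[OF refl])
      fix k assume k: "k \<in> {1..N}"
      have "x \<theta> k - real k / (real k + 1) * x \<theta> (Suc k) = \<theta> k + c k \<theta>"
      proof (cases "k = N")
        case True
        then show ?thesis using k by (simp add: x_def c_def)
      next
        case False
        have "(real k + 1) \<noteq> 0" by linarith
        then show ?thesis using k False by (simp add: x_def c_def divide_simps) (simp add: algebra_simps)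
      qed
      then show "(real k + 1) / real k * (x \<theta> k - real k / (real k + 1) * x \<theta> (Suc k))\<^sup>2 = (T \<theta> k)\<^sup>2"
        using k by (simp add: T_def d_def power_mult_distrib)
    qed
    finally show ?thesis .
  qed
  have dprod: "(\<Prod>k\<in>{1..n}. 1 / d k) = 1 / sqrt (real n + 1)" for n
    by (induction n) (auto simp: d_def prod.nat_ivl_Suc' real_sqrt_divide algebra_simps)
  show X: "X \<in> sets ?M"
  proof -
    have "X = {\<theta> \<in> space ?M. 0 \<le> \<theta> 0 \<and> \<theta> 0 < h \<and> (\<Sum>k\<in>{1..N}. (d k * (\<theta> k + c k \<theta>))\<^sup>2) \<le> r\<^sup>2}"
      unfolding X_def sq by (simp add: T_def)
    moreover have "(\<lambda>\<theta>. \<Sum>k\<in>{1..N}. (d k * (\<theta> k + c k \<theta>))\<^sup>2) \<in> borel_measurable ?M"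
      by (intro borel_measurable_sum borel_measurable_power borel_measurable_times borel_measurable_add comp c_meas) auto
    ultimately show ?thesis by simp
  qed
  have "emeasure ?M X = (\<integral>\<^sup>+\<theta>. indicator X \<theta> \<partial>?M)" by (rule nn_integral_indicator[OF X, symmetric])
  also have "\<dots> = (\<integral>\<^sup>+\<theta>. indicator ?Y (T \<theta>) \<partial>?M)"
  proof (rule nn_integral_cong)
    fix \<theta> :: "nat \<Rightarrow> real" assume \<theta>: "\<theta> \<in> space ?M"
    have "T \<theta> \<in> space ?M"
      using \<theta> by (simp add: space_PiM PiE_def extensional_def T_def)
    moreover have "T \<theta> 0 = \<theta> 0" by (simp add: T_def)
    ultimately show "indicator X \<theta> = (indicator ?Y (T \<theta>) :: ennreal)"
      using \<theta> unfolding X_def sq indicator_def by (simp only: mem_Collect_eq simp_thms)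
  qed
  also have "\<dots> = ennreal (\<Prod>k\<in>{1..N}. 1 / d k) * (\<integral>\<^sup>+\<theta>. indicator ?Y \<theta> \<partial>?M)"
    unfolding T_def
  proof (rule nn_integral_PiM_lborel_triangular)
    show "c k \<theta> = c k \<theta>'" if "k \<in> {1..N}" "\<And>i. i = 0 \<or> k < i \<Longrightarrow> \<theta> i = \<theta>' i" for k \<theta> \<theta>'
      using that(2)[of 0] that(2)[of "Suc k"] by (simp add: c_def)
    show "0 < d k" if "k \<in> {1..N}" for k
      using that by (simp add: d_def)
  qed (use Y c_meas in \<open>auto simp del: sum.lessThan_Suc\<close>)
  also have "(\<integral>\<^sup>+\<theta>. indicator ?Y \<theta> \<partial>?M) = ennreal (h * unit_ball_vol (real N) * r ^ N)"
    by (rule trans[OF nn_integral_indicator[OF Y] emeasure_PiM_cylinder[OF assms(3,4), of N]])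
  also have "ennreal (\<Prod>k\<in>{1..N}. 1 / d k) * ennreal (h * unit_ball_vol (real N) * r ^ N)
      = ennreal (h * unit_ball_vol (real N) * r ^ N / sqrt (real N + 1))"
    unfolding dprod using assms(3,4) by (simp add: ennreal_mult[symmetric])
  finally show "emeasure ?M X = ennreal (h * unit_ball_vol (real N) * r ^ N / sqrt (real N + 1))" .
qed

section \<open>The excess of a tangent sum\<close>

text \<open>The function 2 tan (g / 2) minus its tangent line at \<open>a\<close>. For gaps with
  mean \<open>a\<close> the linear parts cancel in the sum, so the total excess is the excess of the
  tangent sum, now with nonnegative summands.\<close>

definition excess :: "real \<Rightarrow> real \<Rightarrow> real" where
  "excess a g = 2 * tan (g / 2) - 2 * tan (a / 2) - (1 + (tan (a / 2))\<^sup>2) * (g - a)"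

text \<open>The second derivative of \<open>excess a\<close>, the same for every
  \<open>a\<close>.\<close>

definition excess'' :: "real \<Rightarrow> real" where
  "excess'' g = tan (g / 2) * (1 + (tan (g / 2))\<^sup>2)"

lemma cos_half_pos: "0 < g \<Longrightarrow> g < pi \<Longrightarrow> 0 < cos (g / 2)"
  by (intro cos_gt_zero_pi) auto

lemma inverse_cos_half_squared:
  assumes "0 < g" "g < pi"
  shows "inverse ((cos (g / 2))\<^sup>2) = 1 + (tan (g / 2))\<^sup>2"
  using cos_half_pos[OF assms] tan_sec[of "g / 2"] by (simp add: power_inverse)

lemma tan_half_mono: "0 < g \<Longrightarrow> g \<le> h \<Longrightarrow> h < pi \<Longrightarrow> tan (g / 2) \<le> tan (h / 2)"
  by (intro tan_mono_le) auto

lemma tan_half_pos: "0 < g \<Longrightarrow> g < pi \<Longrightarrow> 0 < tan (g / 2)"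
  by (intro tan_gt_zero) auto

lemma excess''_pos: "0 < g \<Longrightarrow> g < pi \<Longrightarrow> 0 < excess'' g"
  unfolding excess''_def by (intro mult_pos_pos tan_half_pos) (auto intro: add_pos_nonneg)

lemma excess''_mono: "0 < g \<Longrightarrow> g \<le> h \<Longrightarrow> h < pi \<Longrightarrow> excess'' g \<le> excess'' h"
  unfolding excess''_def
  by (intro mult_mono tan_half_mono add_mono power_mono order.refl)
     (auto intro: less_imp_le[OF tan_half_pos] simp: add_nonneg_nonneg)

lemma DERIV_excess:
  assumes "0 < g" "g < pi"
  shows "(excess a has_real_derivative ((tan (g / 2))\<^sup>2 - (tan (a / 2))\<^sup>2)) (at g)"
  unfolding excess_def using cos_half_pos[OF assms] inverse_cos_half_squared[OF assms]
  by (auto intro!: derivative_eq_intros simp: field_simps)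

text \<open>The excess and its derivative vanish at \<open>a\<close>, so only the Lagrange remainder
  is left.\<close>

lemma excess_taylor:
  assumes "0 < a" "a < pi" "0 < g" "g < pi"
  obtains \<xi> where "min a g \<le> \<xi>" "\<xi> \<le> max a g" "excess a g = excess'' \<xi> / 2 * (g - a)\<^sup>2"
proof (cases "g = a")
  case True
  then show ?thesis using that[of a] by (simp add: excess_def)
next
  case False
  define diff where "diff = (\<lambda>n::nat. if n = 0 then excess a else if n = 1 then (\<lambda>g. (tan (g / 2))\<^sup>2 - (tan (a / 2))\<^sup>2) else excess'')"
  have d: "\<forall>n t. n < 2 \<and> min a g \<le> t \<and> t \<le> max a g \<longrightarrow> (diff n has_real_derivative diff (Suc n) t) (at t)"
  proof (intro allI impI)
    fix n :: nat and t assume *: "n < 2 \<and> min a g \<le> t \<and> t \<le> max a g"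
    then have t: "0 < t" "t < pi" using assms by auto
    have "((\<lambda>g. (tan (g / 2))\<^sup>2 - (tan (a / 2))\<^sup>2) has_real_derivative excess'' t) (at t)"
      using cos_half_pos[OF t] inverse_cos_half_squared[OF t]
      by (auto intro!: derivative_eq_intros simp: excess''_def)
    then show "(diff n has_real_derivative diff (Suc n) t) (at t)"
      using * DERIV_excess[OF t, of a] by (cases n) (auto simp: diff_def)
  qed
  have "\<exists>t. (if g < a then g < t \<and> t < a else a < t \<and> t < g) \<and>
    excess a g = (\<Sum>n<2. diff n a / fact n * (g - a) ^ n) + diff 2 t / fact 2 * (g - a) ^ 2"
    using False d by (intro Taylor[of 2 diff _ "min a g" "max a g"]) (auto simp: diff_def)
  then obtain t where "if g < a then g < t \<and> t < a else a < t \<and> t < g"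
    "excess a g = (\<Sum>n<2. diff n a / fact n * (g - a) ^ n) + diff 2 t / fact 2 * (g - a) ^ 2" by blast
  then show ?thesis
    by (intro that[of t]) (auto simp: diff_def eval_nat_numeral excess_def split: if_splits)
qed

lemma excess_nonneg:
  assumes "0 < a" "a < pi" "0 < g" "g < pi"
  shows "0 \<le> excess a g"
proof -
  obtain \<xi> where "min a g \<le> \<xi>" "\<xi> \<le> max a g" "excess a g = excess'' \<xi> / 2 * (g - a)\<^sup>2"
    using excess_taylor[OF assms] .
  moreover from this have "0 < excess'' \<xi>" using assms by (intro excess''_pos) auto
  ultimately show ?thesis by (simp only:) simp
qed

text \<open>The second derivative degenerates as g tends to 0, so the Taylor bound is applied only
  for g at least a / 2, where it is bounded below by its value at a / 2. Smaller gaps are excluded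
  by the choice of the threshold: the excess decreases up to \<open>a\<close>, so below a / 2 it
  exceeds half its value at a / 2.\<close>

lemma excess_small_imp_close:
  assumes a: "0 < a" "a < pi"
  obtains c s\<^sub>0 where "0 < c" "0 < s\<^sub>0"
    "\<And>g. 0 < g \<Longrightarrow> g < pi \<Longrightarrow> excess a g \<le> s\<^sub>0 \<Longrightarrow> c * (g - a)\<^sup>2 \<le> excess a g"
proof -
  have lower: "excess'' (a / 2) / 2 * (g - a)\<^sup>2 \<le> excess a g" if "a / 2 \<le> g" "g < pi" for g
  proof -
    have g: "0 < g" "g < pi" using that a by auto
    obtain \<xi> where \<xi>: "min a g \<le> \<xi>" "\<xi> \<le> max a g" "excess a g = excess'' \<xi> / 2 * (g - a)\<^sup>2"
      using excess_taylor[OF a g] .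
    have "excess'' (a / 2) \<le> excess'' \<xi>" using \<xi> that a by (intro excess''_mono) auto
    then show ?thesis unfolding \<xi>(3) by (intro mult_right_mono) auto
  qed
  have pos: "0 < excess'' (a / 2)" using a by (intro excess''_pos) auto
  have "0 < excess'' (a / 2) / 2 * (a / 2 - a)\<^sup>2" using pos a by simp
  also have "\<dots> \<le> excess a (a / 2)" using a by (intro lower) auto
  finally have s: "0 < excess a (a / 2)" .
  show ?thesis
  proof (rule that)
    show "0 < excess'' (a / 2) / 2" "0 < excess a (a / 2) / 2" using pos s by auto
    fix g assume g: "0 < g" "g < pi" "excess a g \<le> excess a (a / 2) / 2"
    have "a / 2 \<le> g"
    proof (rule ccontr)
      assume "\<not> a / 2 \<le> g"
      then have "g < a / 2" by simp
      have "excess a (a / 2) \<le> excess a g"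
      proof (rule DERIV_nonpos_imp_nonincreasing[of g "a / 2"])
        fix x assume x: "g \<le> x" "x \<le> a / 2"
        have x': "0 < x" "x < pi" using x g a by auto
        have "tan (x / 2) \<le> tan (a / 2)" using x x' a by (intro tan_half_mono) auto
        then have "(tan (x / 2))\<^sup>2 \<le> (tan (a / 2))\<^sup>2" using tan_half_pos[OF x'] by (intro power_mono) auto
        then show "\<exists>y. (excess a has_real_derivative y) (at x) \<and> y \<le> 0"
          using DERIV_excess[OF x', of a] by (intro exI conjI) auto
      qed (use \<open>g < a / 2\<close> in auto)
      then show False using g s by linarith
    qed
    then show "excess'' (a / 2) / 2 * (g - a)\<^sup>2 \<le> excess a g" using g by (intro lower) auto
  qed
qed

text \<open>Source of the linear error terms: applied to \<open>excess''\<close> at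
  \<open>a\<close>, and to the volume as a function of sqrt s at 0.\<close>

lemma differentiable_imp_locally_lipschitz:
  fixes f :: "real \<Rightarrow> real"
  assumes "(f has_real_derivative D) (at a)"
  obtains B e where "0 < B" "0 < e" "\<And>x. \<bar>x - a\<bar> \<le> e \<Longrightarrow> \<bar>f x - f a\<bar> \<le> B * \<bar>x - a\<bar>"
proof -
  have "(f has_derivative (\<lambda>h. D * h)) (at a)" using assms by (simp add: has_field_derivative_def)
  then obtain d where d: "0 < d" "\<And>x. norm (x - a) < d \<Longrightarrow> norm (f x - f a - D * (x - a)) \<le> 1 * norm (x - a)"
    unfolding has_derivative_at_alt by (metis zero_less_one)
  show ?thesis
  proof (rule that)
    show "0 < \<bar>D\<bar> + 1" "0 < d / 2" using d by auto
    fix x assume "\<bar>x - a\<bar> \<le> d / 2"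
    then have "\<bar>f x - f a - D * (x - a)\<bar> \<le> \<bar>x - a\<bar>" using d by (auto simp: real_norm_def)
    moreover have "\<bar>D * (x - a)\<bar> = \<bar>D\<bar> * \<bar>x - a\<bar>" by (rule abs_mult)
    ultimately show "\<bar>f x - f a\<bar> \<le> (\<bar>D\<bar> + 1) * \<bar>x - a\<bar>" by (simp add: distrib_right)
  qed
qed

text \<open>Freezing the second derivative at \<open>a\<close> costs its Lipschitz constant times
  the distance of the intermediate point. The bound \<open>\<delta>\<close> is separate from the
  distance of \<open>g\<close> so that one value serves all gaps of a tuple.\<close>

lemma excess_quadratic:
  assumes a: "0 < a" "a < pi"
  obtains B e where "0 < B" "0 < e" "e < a" "a + e < pi"
    "\<And>g \<delta>. \<bar>g - a\<bar> \<le> \<delta> \<Longrightarrow> \<delta> \<le> e \<Longrightarrow> \<bar>excess a g - excess'' a / 2 * (g - a)\<^sup>2\<bar> \<le> B * \<delta> / 2 * (g - a)\<^sup>2"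
proof -
  have "(excess'' has_real_derivative ((1 + (tan (a / 2))\<^sup>2) / 2 * (1 + 3 * (tan (a / 2))\<^sup>2))) (at a)"
    unfolding excess''_def using cos_half_pos[OF a] inverse_cos_half_squared[OF a]
    by (auto intro!: derivative_eq_intros simp: algebra_simps power2_eq_square)
  then obtain B e where B: "0 < B" "0 < e" "\<And>x. \<bar>x - a\<bar> \<le> e \<Longrightarrow> \<bar>excess'' x - excess'' a\<bar> \<le> B * \<bar>x - a\<bar>"
    using differentiable_imp_locally_lipschitz by blast
  define e' where "e' = min e (min (a / 2) ((pi - a) / 2))"
  have e': "0 < e'" "e' \<le> e" "e' \<le> a / 2" "e' \<le> (pi - a) / 2" using a B(1,2) by (auto simp: e'_def min_def field_simps)
  show ?thesis
  proof (rule that[of B e'])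
    show "0 < B" "0 < e'" "e' < a" "a + e' < pi" using B e' a by auto
    fix g \<delta> assume g: "\<bar>g - a\<bar> \<le> \<delta>" "\<delta> \<le> e'"
    have g': "0 < g" "g < pi" using g e' a by auto
    obtain \<xi> where \<xi>: "min a g \<le> \<xi>" "\<xi> \<le> max a g" "excess a g = excess'' \<xi> / 2 * (g - a)\<^sup>2"
      using excess_taylor[OF a g'] .
    have "\<bar>\<xi> - a\<bar> \<le> \<delta>" using \<xi> g by auto
    then have "\<bar>excess'' \<xi> - excess'' a\<bar> \<le> B * \<bar>\<xi> - a\<bar>" using g e' by (intro B) auto
    also have "\<dots> \<le> B * \<delta>" using \<open>\<bar>\<xi> - a\<bar> \<le> \<delta>\<close> B by (intro mult_left_mono) auto
    finally have "\<bar>excess'' \<xi> - excess'' a\<bar> / 2 * (g - a)\<^sup>2 \<le> B * \<delta> / 2 * (g - a)\<^sup>2"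
      by (intro mult_right_mono divide_right_mono) auto
    moreover have "excess a g - excess'' a / 2 * (g - a)\<^sup>2 = (excess'' \<xi> - excess'' a) / 2 * (g - a)\<^sup>2"
      unfolding \<xi>(3) by (simp add: algebra_simps diff_divide_distrib)
    ultimately show "\<bar>excess a g - excess'' a / 2 * (g - a)\<^sup>2\<bar> \<le> B * \<delta> / 2 * (g - a)\<^sup>2"
      by (simp only: abs_mult abs_divide abs_power2 abs_numeral)
  qed
qed


lemma sum_excess:
  assumes "(\<Sum>k<m. g k) = real m * a"
  shows "(\<Sum>k<m. excess a (g k)) = (\<Sum>k<m. 2 * tan (g k / 2)) - 2 * real m * tan (a / 2)"
  using assms by (simp add: excess_def sum_subtractf flip: sum_distrib_left)

text \<open>Both directions first localize every gap and only then expand. In one, nonnegativity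
  bounds each excess by the total; in the other, each square is bounded by the sum of squares. The
  two inequalities on \<open>s\<^sub>0\<close> later keep the radii of the comparison ellipsoids and
  the range of the first angle positive.\<close>

lemma tangent_sum_sandwich:
  assumes a: "0 < a" "a < pi"
  obtains B C s\<^sub>0 where "0 < B" "0 < C" "0 < s\<^sub>0" "B * sqrt s\<^sub>0 \<le> excess'' a / 2" "C * sqrt s\<^sub>0 < a"
    "\<And>g m s. 0 < s \<Longrightarrow> s \<le> s\<^sub>0 \<Longrightarrow> (\<Sum>k<m. g k) = real m * a \<Longrightarrow> (\<And>k. k < m \<Longrightarrow> 0 < g k \<and> g k < pi)
      \<Longrightarrow> (\<Sum>k<m. 2 * tan (g k / 2)) \<le> 2 * real m * tan (a / 2) + s
      \<Longrightarrow> (\<forall>k<m. \<bar>g k - a\<bar> \<le> C * sqrt s) \<and> (excess'' a - B * sqrt s) / 2 * (\<Sum>k<m. (g k - a)\<^sup>2) \<le> s"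
    "\<And>g m s. 0 < s \<Longrightarrow> s \<le> s\<^sub>0 \<Longrightarrow> (\<Sum>k<m. g k) = real m * a
      \<Longrightarrow> (excess'' a + B * sqrt s) / 2 * (\<Sum>k<m. (g k - a)\<^sup>2) \<le> s
      \<Longrightarrow> (\<forall>k<m. \<bar>g k - a\<bar> \<le> C * sqrt s \<and> 0 < g k \<and> g k < pi) \<and> (\<Sum>k<m. 2 * tan (g k / 2)) \<le> 2 * real m * tan (a / 2) + s"
proof -
  let ?A = "excess'' a"
  have A: "0 < ?A" using excess''_pos[OF a] .
  obtain c s1 where c: "0 < c" "0 < s1"
    "\<And>g. 0 < g \<Longrightarrow> g < pi \<Longrightarrow> excess a g \<le> s1 \<Longrightarrow> c * (g - a)\<^sup>2 \<le> excess a g"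
    using excess_small_imp_close[OF a] by blast
  obtain B0 e where B0: "0 < B0" "0 < e" "e < a" "a + e < pi"
    "\<And>g \<delta>. \<bar>g - a\<bar> \<le> \<delta> \<Longrightarrow> \<delta> \<le> e \<Longrightarrow> \<bar>excess a g - ?A / 2 * (g - a)\<^sup>2\<bar> \<le> B0 * \<delta> / 2 * (g - a)\<^sup>2"
    using excess_quadratic[OF a] by blast
  \<comment> \<open>The first entry localizes gaps with small excess, the second gaps with small
    quadratic form.\<close>
  define C where "C = max (sqrt (1 / c)) (sqrt (2 / ?A))"
  have C: "0 < C" "1 / c \<le> C\<^sup>2" "2 / ?A \<le> C\<^sup>2"
  proof -
    have "sqrt (1 / c) \<le> C" "sqrt (2 / ?A) \<le> C" by (auto simp: C_def)
    then show "1 / c \<le> C\<^sup>2" "2 / ?A \<le> C\<^sup>2" using sqrt_le_D by blast+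
    show "0 < C" using c by (simp add: C_def less_max_iff_disj)
  qed
  define B where "B = B0 * C"
  have B: "0 < B" using B0 C by (simp add: B_def)
  \<comment> \<open>The three entries secure the closeness threshold, C * sqrt s \<le> e for the
    expansion, and B * sqrt s \<le> A / 2 for a definite quadratic form, with A standing for
    \<open>excess'' a\<close>.\<close>
  define s0 where "s0 = min s1 (min ((e / C)\<^sup>2) ((?A / (2 * B))\<^sup>2))"
  have s0: "0 < s0" "s0 \<le> s1" using c B0 C A B by (auto simp: s0_def)
  have s0e: "C * sqrt s \<le> e" if "s \<le> s0" for s
  proof -
    have "sqrt s \<le> sqrt ((e / C)\<^sup>2)" using that by (intro real_sqrt_le_mono) (auto simp: s0_def)
    then have "sqrt s \<le> e / C" using C(1) B0(2) by simp
    then show ?thesis using C(1) by (simp add: field_simps)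
  qed
  have s0B: "B * sqrt s0 \<le> ?A / 2"
  proof -
    have "sqrt s0 \<le> sqrt ((?A / (2 * B))\<^sup>2)" by (intro real_sqrt_le_mono) (auto simp: s0_def)
    then have "sqrt s0 \<le> ?A / (2 * B)" using B A by simp
    then show ?thesis using B by (simp add: field_simps)
  qed
  have close: "\<bar>x\<bar> \<le> C * sqrt s" if "x\<^sup>2 \<le> C\<^sup>2 * s" "0 < s" for x s
  proof -
    have "\<bar>x\<bar> \<le> sqrt (C\<^sup>2 * s)" using real_le_rsqrt[of "\<bar>x\<bar>" "C\<^sup>2 * s"] that(1) by simp
    then show ?thesis using C by (simp add: real_sqrt_mult)
  qed
  have quad: "\<bar>excess a g - ?A / 2 * (g - a)\<^sup>2\<bar> \<le> B * sqrt s / 2 * (g - a)\<^sup>2"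
    if "\<bar>g - a\<bar> \<le> C * sqrt s" "s \<le> s0" for g s
    using B0(5)[OF that(1) s0e[OF that(2)]] by (simp add: B_def mult.assoc)
  show ?thesis
  proof (rule that[of B C s0])
    show "0 < B" "0 < C" "0 < s0" "B * sqrt s0 \<le> ?A / 2" by fact+
    show "C * sqrt s0 < a" using s0e[of s0] B0 by simp
  next
    fix g m s
    assume s: "0 < s" "s \<le> s0" and sum: "(\<Sum>k<m. g k) = real m * a"
      and g: "\<And>k. k < m \<Longrightarrow> 0 < g k \<and> g k < pi"
      and le: "(\<Sum>k<m. 2 * tan (g k / 2)) \<le> 2 * real m * tan (a / 2) + s"
    have total: "(\<Sum>k<m. excess a (g k)) \<le> s" using sum_excess[OF sum] le by simp
    have cl: "\<bar>g k - a\<bar> \<le> C * sqrt s" if "k < m" for k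
    proof -
      have "excess a (g k) \<le> (\<Sum>k<m. excess a (g k))"
        using that g by (intro member_le_sum) (auto intro: excess_nonneg[OF a])
      then have e: "excess a (g k) \<le> s" using total by simp
      then have "c * (g k - a)\<^sup>2 \<le> excess a (g k)" using s s0 g[OF that] by (intro c(3)) auto
      then have "(g k - a)\<^sup>2 \<le> 1 / c * s" using c(1) e by (simp add: field_simps)
      also have "\<dots> \<le> C\<^sup>2 * s" using C s by (intro mult_right_mono) auto
      finally show ?thesis using s by (intro close) auto
    qed
    have "(?A - B * sqrt s) / 2 * (\<Sum>k<m. (g k - a)\<^sup>2) = (\<Sum>k<m. (?A - B * sqrt s) / 2 * (g k - a)\<^sup>2)"
      by (rule sum_distrib_left)
    also have "\<dots> \<le> (\<Sum>k<m. excess a (g k))"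
    proof (rule sum_mono)
      fix k assume "k \<in> {..<m}"
      then have "\<bar>excess a (g k) - ?A / 2 * (g k - a)\<^sup>2\<bar> \<le> B * sqrt s / 2 * (g k - a)\<^sup>2"
        using s cl by (intro quad) auto
      then show "(?A - B * sqrt s) / 2 * (g k - a)\<^sup>2 \<le> excess a (g k)"
        by (simp only: diff_divide_distrib left_diff_distrib abs_le_iff) linarith
    qed
    finally show "(\<forall>k<m. \<bar>g k - a\<bar> \<le> C * sqrt s) \<and> (?A - B * sqrt s) / 2 * (\<Sum>k<m. (g k - a)\<^sup>2) \<le> s"
      using cl total by auto
  next
    fix g m s
    assume s: "0 < s" "s \<le> s0" and sum: "(\<Sum>k<m. g k) = real m * a"
      and le: "(?A + B * sqrt s) / 2 * (\<Sum>k<m. (g k - a)\<^sup>2) \<le> s"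
    have cl: "\<bar>g k - a\<bar> \<le> C * sqrt s" if "k < m" for k
    proof -
      have "?A / 2 * (g k - a)\<^sup>2 \<le> (?A + B * sqrt s) / 2 * (\<Sum>k<m. (g k - a)\<^sup>2)"
        using that A B s by (intro mult_mono member_le_sum) auto
      then have "?A / 2 * (g k - a)\<^sup>2 \<le> s" using le by simp
      then have "(g k - a)\<^sup>2 \<le> 2 / ?A * s" using A by (simp add: field_simps)
      also have "\<dots> \<le> C\<^sup>2 * s" using C s by (intro mult_right_mono) auto
      finally show ?thesis using s by (intro close) auto
    qed
    have "(\<Sum>k<m. excess a (g k)) \<le> (\<Sum>k<m. (?A + B * sqrt s) / 2 * (g k - a)\<^sup>2)"
    proof (rule sum_mono)
      fix k assume "k \<in> {..<m}"
      then have "\<bar>excess a (g k) - ?A / 2 * (g k - a)\<^sup>2\<bar> \<le> B * sqrt s / 2 * (g k - a)\<^sup>2"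
        using s cl by (intro quad) auto
      then show "excess a (g k) \<le> (?A + B * sqrt s) / 2 * (g k - a)\<^sup>2"
        by (simp only: add_divide_distrib distrib_right abs_le_iff) linarith
    qed
    also have "\<dots> = (?A + B * sqrt s) / 2 * (\<Sum>k<m. (g k - a)\<^sup>2)"
      by (rule sum_distrib_left[symmetric])
    finally have "(\<Sum>k<m. excess a (g k)) \<le> s" using le by simp
    then have "(\<Sum>k<m. 2 * tan (g k / 2)) \<le> 2 * real m * tan (a / 2) + s"
      using sum_excess[OF sum] by simp
    moreover have "0 < g k \<and> g k < pi" if "k < m" for k
      using cl[OF that] s0e[OF s(2)] B0(3,4) by (auto simp: abs_le_iff)
    ultimately show "(\<forall>k<m. \<bar>g k - a\<bar> \<le> C * sqrt s \<and> 0 < g k \<and> g k < pi) \<and> (\<Sum>k<m. 2 * tan (g k / 2)) \<le> 2 * real m * tan (a / 2) + s"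
      using cl by auto
  qed
qed

section \<open>Near-regular configurations of angles\<close>

text \<open>The gap with index \<open>m - 1\<close> is the one across the angle \<open>0\<close>.\<close>

definition gap :: "nat \<Rightarrow> (nat \<Rightarrow> real) \<Rightarrow> nat \<Rightarrow> real" where
  "gap m \<theta> k = (if Suc k = m then \<theta> 0 + 2 * pi - \<theta> k else \<theta> (Suc k) - \<theta> k)"

text \<open>Positive gaps and the two end conditions amount to increasing angles in [0, 2 pi). Gaps
  below pi express that the points determine a polygon, whose perimeter is the tangent sum.\<close>

definition near_regular :: "nat \<Rightarrow> real \<Rightarrow> (nat \<Rightarrow> real) \<Rightarrow> bool" where
  "near_regular m s \<theta> \<longleftrightarrow> 0 \<le> \<theta> 0 \<and> \<theta> (m - 1) < 2 * pi \<and> (\<forall>k<m. 0 < gap m \<theta> k \<and> gap m \<theta> k < pi)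
    \<and> (\<Sum>k<m. 2 * tan (gap m \<theta> k / 2)) \<le> 2 * real m * tan (pi / real m) + s"

lemma sum_gap: "(\<Sum>k<Suc N. gap (Suc N) \<theta> k) = 2 * pi"
proof -
  have "(\<Sum>k<N. gap (Suc N) \<theta> k) = (\<Sum>k<N. \<theta> (Suc k) - \<theta> k)"
    by (rule sum.cong) (auto simp: gap_def)
  also have "\<dots> = \<theta> N - \<theta> 0" by (rule sum_lessThan_telescope)
  finally show ?thesis by (simp add: gap_def)
qed

lemma pred_near_regular [measurable]:
  assumes "0 < m"
  shows "Measurable.pred (PiM {..<m} (\<lambda>_. borel)) (near_regular m s)"
proof -
  have [measurable]: "(\<lambda>\<theta>. \<theta> k) \<in> borel_measurable (PiM {..<m} (\<lambda>_. borel :: real measure))" if "k < m" for k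
    using measurable_component_singleton[of k "{..<m}" "\<lambda>_. borel :: real measure"] that by simp
  have gap: "(\<lambda>\<theta>. gap m \<theta> k) \<in> borel_measurable (PiM {..<m} (\<lambda>_. borel))" if "k < m" for k
  proof (cases "Suc k = m")
    case True
    then show ?thesis using that assms unfolding gap_def by simp measurable
  next
    case False
    then have "Suc k < m" using that by simp
    then show ?thesis using that False unfolding gap_def by simp measurable
  qed
  have tan: "(\<lambda>\<theta>. 2 * tan (gap m \<theta> k / 2)) \<in> borel_measurable (PiM {..<m} (\<lambda>_. borel))" if "k < m" for k
    unfolding tan_def using gap[OF that] by measurable
  have "Measurable.pred (PiM {..<m} (\<lambda>_. borel)) (\<lambda>\<theta>. \<forall>k\<in>{..<m}. 0 < gap m \<theta> k \<and> gap m \<theta> k < pi)"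
  proof (intro pred_intros_finite)
    fix k assume "k \<in> {..<m}"
    then have [measurable]: "(\<lambda>\<theta>. gap m \<theta> k) \<in> borel_measurable (PiM {..<m} (\<lambda>_. borel))" by (intro gap) auto
    show "Measurable.pred (PiM {..<m} (\<lambda>_. borel)) (\<lambda>\<theta>. 0 < gap m \<theta> k \<and> gap m \<theta> k < pi)" by measurable
  qed auto
  moreover have "(\<lambda>\<theta>. \<Sum>k<m. 2 * tan (gap m \<theta> k / 2)) \<in> borel_measurable (PiM {..<m} (\<lambda>_. borel))"
    using tan by (intro borel_measurable_sum) auto
  moreover have "(\<lambda>\<theta>. \<theta> 0) \<in> borel_measurable (PiM {..<m} (\<lambda>_. borel :: real measure))"
    "(\<lambda>\<theta>. \<theta> (m - 1)) \<in> borel_measurable (PiM {..<m} (\<lambda>_. borel :: real measure))"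
    using assms measurable_component_singleton[of 0 "{..<m}" "\<lambda>_. borel :: real measure"]
      measurable_component_singleton[of "m - 1" "{..<m}" "\<lambda>_. borel :: real measure"] by simp_all
  ultimately have "Measurable.pred (PiM {..<m} (\<lambda>_. borel)) (\<lambda>\<theta>. 0 \<le> \<theta> 0 \<and> \<theta> (m - 1) < 2 * pi
      \<and> (\<forall>k\<in>{..<m}. 0 < gap m \<theta> k \<and> gap m \<theta> k < pi)
      \<and> (\<Sum>k<m. 2 * tan (gap m \<theta> k / 2)) \<le> 2 * real m * tan (pi / real m) + s)"
    by (intro pred_intros_logic) (auto intro!: borel_measurable_le borel_measurable_less simp: pred_def)
  moreover have "near_regular m s = (\<lambda>\<theta>. 0 \<le> \<theta> 0 \<and> \<theta> (m - 1) < 2 * pi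
      \<and> (\<forall>k\<in>{..<m}. 0 < gap m \<theta> k \<and> gap m \<theta> k < pi)
      \<and> (\<Sum>k<m. 2 * tan (gap m \<theta> k / 2)) \<le> 2 * real m * tan (pi / real m) + s)"
    by (auto simp: near_regular_def fun_eq_iff)
  ultimately show ?thesis by (simp only:)
qed

lemma pred_near_regular_lborel:
  assumes "0 < m"
  shows "{\<theta> \<in> space (PiM {..<m} (\<lambda>_. lborel)). near_regular m s \<theta>} \<in> sets (PiM {..<m} (\<lambda>_. lborel))"
proof -
  have "sets (PiM {..<m} (\<lambda>_. lborel)) = sets (PiM {..<m} (\<lambda>_. borel :: real measure))"
    by (intro sets_PiM_cong) auto
  moreover have "space (PiM {..<m} (\<lambda>_. lborel)) = space (PiM {..<m} (\<lambda>_. borel :: real measure))"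
    by (simp add: space_PiM)
  ultimately show ?thesis using pred_near_regular[OF assms, of s] by (simp add: pred_def)
qed

text \<open>The set is squeezed between two regions of the ellipsoid kind. The first angle ranges
  over an interval of length about \<open>a\<close>, because the last angle is below 2 pi exactly
  when \<open>\<theta> 0\<close> is below the wrap-around gap, and that gap is \<open>a\<close> up
  to C * sqrt s. The quadratic form contributes the semi-axes.\<close>

lemma volume_near_regular:
  fixes N :: nat
  defines "m \<equiv> Suc N" and "a \<equiv> 2 * pi / real (Suc N)"
  defines "V \<equiv> a * unit_ball_vol (real N) * sqrt (2 / excess'' a) ^ N / sqrt (real m)"
  assumes N: "2 \<le> N"
  obtains C s\<^sub>0 where "0 < C" "0 < s\<^sub>0"
    "\<And>s. 0 < s \<Longrightarrow> s \<le> s\<^sub>0 \<Longrightarrow>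
      \<bar>measure (PiM {..<m} (\<lambda>_. lborel)) {\<theta> \<in> space (PiM {..<m} (\<lambda>_. lborel)). near_regular m s \<theta>} - V * sqrt s ^ N\<bar>
        \<le> C * sqrt s ^ Suc N"
proof -
  have a: "0 < a" "a < pi" "real m * a = 2 * pi" "pi / real m = a / 2"
    using N by (auto simp: a_def m_def field_simps)
  let ?A = "excess'' a"
  have A: "0 < ?A" using excess''_pos[OF a(1,2)] .
  show ?thesis
  proof (rule tangent_sum_sandwich[OF a(1,2)])
    fix B C s0 :: real
    assume B: "0 < B" "0 < C" "0 < s0" "B * sqrt s0 \<le> excess'' a / 2" "C * sqrt s0 < a"
      and up: "\<And>g n s. 0 < s \<Longrightarrow> s \<le> s0 \<Longrightarrow> (\<Sum>k<n. g k) = real n * a \<Longrightarrow> (\<And>k. k < n \<Longrightarrow> 0 < g k \<and> g k < pi)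
        \<Longrightarrow> (\<Sum>k<n. 2 * tan (g k / 2)) \<le> 2 * real n * tan (a / 2) + s
        \<Longrightarrow> (\<forall>k<n. \<bar>g k - a\<bar> \<le> C * sqrt s) \<and> (excess'' a - B * sqrt s) / 2 * (\<Sum>k<n. (g k - a)\<^sup>2) \<le> s"
      and low: "\<And>g n s. 0 < s \<Longrightarrow> s \<le> s0 \<Longrightarrow> (\<Sum>k<n. g k) = real n * a
        \<Longrightarrow> (excess'' a + B * sqrt s) / 2 * (\<Sum>k<n. (g k - a)\<^sup>2) \<le> s
        \<Longrightarrow> (\<forall>k<n. \<bar>g k - a\<bar> \<le> C * sqrt s \<and> 0 < g k \<and> g k < pi) \<and> (\<Sum>k<n. 2 * tan (g k / 2)) \<le> 2 * real n * tan (a / 2) + s"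
    define w where "w = unit_ball_vol (real N) / sqrt (real m)"
    have w: "0 < w" by (simp add: w_def m_def)
    \<comment> \<open>With u = sqrt s, the outer and inner regions have volumes w * u ^ N * G u and
      w * u ^ N * G (- u), so differentiability of this one function at 0 controls both
      errors.\<close>
    define G where "G = (\<lambda>\<sigma>. (a + C * \<sigma>) * sqrt (2 / (?A - B * \<sigma>)) ^ N)"
    have "\<exists>D. (G has_real_derivative D) (at 0)"
      unfolding G_def by (rule exI) (use A in \<open>auto intro!: derivative_eq_intros\<close>)
    then obtain D where "(G has_real_derivative D) (at 0)" by blast
    then obtain K e where K: "0 < K" "0 < e" "\<And>x. \<bar>x\<bar> \<le> e \<Longrightarrow> \<bar>G x - G 0\<bar> \<le> K * \<bar>x\<bar>"
      using differentiable_imp_locally_lipschitz[of G D 0] by auto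
    define s1 where "s1 = min s0 (e\<^sup>2)"
    have s1: "0 < s1" using B K by (simp add: s1_def)
    let ?P = "PiM {..<m} (\<lambda>_. lborel :: real measure)"
    let ?S = "\<lambda>s. {\<theta> \<in> space ?P. near_regular m s \<theta>}"
    let ?x = "\<lambda>\<theta> k. if k = 0 \<or> k = Suc N then 0 else \<theta> k - \<theta> 0 - real k * a"
    let ?E = "\<lambda>h r. {\<theta> \<in> space ?P. 0 \<le> \<theta> 0 \<and> \<theta> 0 < h \<and> (\<Sum>k<Suc N. (?x \<theta> (Suc k) - ?x \<theta> k)\<^sup>2) \<le> r\<^sup>2}"
    have dev: "(\<Sum>k<Suc N. (?x \<theta> (Suc k) - ?x \<theta> k)\<^sup>2) = (\<Sum>k<m. (gap m \<theta> k - a)\<^sup>2)" for \<theta>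
      unfolding m_def
    proof (rule sum.cong[OF refl])
      fix k assume "k \<in> {..<Suc N}"
      then consider "k = N" | "k < N" by fastforce
      then show "(?x \<theta> (Suc k) - ?x \<theta> k)\<^sup>2 = (gap (Suc N) \<theta> k - a)\<^sup>2"
      proof cases
        case 1
        then have "?x \<theta> (Suc k) - ?x \<theta> k = gap (Suc N) \<theta> k - a"
          using N a(3) by (auto simp: gap_def m_def algebra_simps)
        then show ?thesis by (simp only:)
      next
        case 2
        then have "?x \<theta> (Suc k) - ?x \<theta> k = gap (Suc N) \<theta> k - a"
          using N by (auto simp: gap_def algebra_simps)
        then show ?thesis by (simp only:)
      qed
    qed
    have sumgap: "(\<Sum>k<m. gap m \<theta> k) = real m * a" for \<theta>
      using sum_gap[of N \<theta>] a(3) by (simp add: m_def)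
    have "m - 1 = N" by (simp add: m_def)
    have gapN: "gap m \<theta> N = \<theta> 0 + 2 * pi - \<theta> N" for \<theta> by (simp add: gap_def m_def)
    show ?thesis
    proof (rule that[of "w * K" s1])
      show "0 < w * K" "0 < s1" using w K s1 by auto
      fix s assume s: "0 < s" "s \<le> s1"
      define u where "u = sqrt s"
      have u: "0 < u" "u\<^sup>2 = s" using s by (auto simp: u_def)
      have ss: "s \<le> s0" using s by (simp add: s1_def)
      have usq: "u \<le> sqrt s0" using ss by (simp add: u_def)
      have "sqrt s \<le> sqrt (e\<^sup>2)" using s by (intro real_sqrt_le_mono) (simp add: s1_def)
      then have ue: "u \<le> e" using K by (simp add: u_def)
      have "B * u \<le> B * sqrt s0" using usq B by (intro mult_left_mono) auto
      then have AB: "0 < ?A - B * u" "0 < ?A + B * u" using B(4) A B(1) u by (linarith, intro add_pos_pos mult_pos_pos)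
      have "C * u \<le> C * sqrt s0" using usq B by (intro mult_left_mono) auto
      then have aC: "0 < a - C * u" "0 < a + C * u" using B(5) a B(2) u by (linarith, intro add_pos_pos mult_pos_pos)
      define rp where "rp = u * sqrt (2 / (?A - B * u))"
      define rm where "rm = u * sqrt (2 / (?A + B * u))"
      have r: "0 < rp" "0 < rm" "rp\<^sup>2 = 2 * s / (?A - B * u)" "rm\<^sup>2 = 2 * s / (?A + B * u)"
        using u AB by (auto simp: rp_def rm_def power_mult_distrib)
      have upper: "?S s \<subseteq> ?E (a + C * u) rp"
      proof (intro subsetI, unfold mem_Collect_eq, elim conjE, intro conjI)
        fix \<theta> assume "\<theta> \<in> space ?P" and nr: "near_regular m s \<theta>"
        then show "\<theta> \<in> space ?P" "0 \<le> \<theta> 0" by (auto simp: near_regular_def)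
        have *: "(\<forall>k<m. \<bar>gap m \<theta> k - a\<bar> \<le> C * sqrt s) \<and> (excess'' a - B * sqrt s) / 2 * (\<Sum>k<m. (gap m \<theta> k - a)\<^sup>2) \<le> s"
          using nr a(4) by (intro up s ss sumgap) (auto simp: near_regular_def)
        then have "\<bar>gap m \<theta> N - a\<bar> \<le> C * u" by (auto simp: m_def u_def)
        moreover have "\<theta> N < 2 * pi" using nr by (simp add: near_regular_def m_def)
        ultimately show "\<theta> 0 < a + C * u" unfolding gapN by linarith
        have "(\<Sum>k<m. (gap m \<theta> k - a)\<^sup>2) \<le> rp\<^sup>2"
          using * AB by (simp add: r u_def field_simps)
        then show "(\<Sum>k<Suc N. (?x \<theta> (Suc k) - ?x \<theta> k)\<^sup>2) \<le> rp\<^sup>2" by (simp only: dev)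
      qed
      have lower: "?E (a - C * u) rm \<subseteq> ?S s"
      proof (intro subsetI, unfold mem_Collect_eq dev, elim conjE, intro conjI)
        fix \<theta> assume *: "\<theta> \<in> space ?P" "0 \<le> \<theta> 0" "\<theta> 0 < a - C * u" "(\<Sum>k<m. (gap m \<theta> k - a)\<^sup>2) \<le> rm\<^sup>2"
        then show "\<theta> \<in> space ?P" by simp
        have "(excess'' a + B * sqrt s) / 2 * (\<Sum>k<m. (gap m \<theta> k - a)\<^sup>2) \<le> s"
          using *(4) AB by (simp add: r u_def field_simps)
        then have **: "(\<forall>k<m. \<bar>gap m \<theta> k - a\<bar> \<le> C * sqrt s \<and> 0 < gap m \<theta> k \<and> gap m \<theta> k < pi) \<and>
            (\<Sum>k<m. 2 * tan (gap m \<theta> k / 2)) \<le> 2 * real m * tan (a / 2) + s"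
          by (intro low s ss sumgap)
        then have "\<bar>gap m \<theta> N - a\<bar> \<le> C * u" by (auto simp: m_def u_def)
        then have "\<theta> N < 2 * pi" using *(3) unfolding gapN by linarith
        then show "near_regular m s \<theta>"
          using * ** \<open>m - 1 = N\<close> unfolding near_regular_def a(4) by auto
      qed
      have S: "?S s \<in> sets ?P" by (rule pred_near_regular_lborel) (simp add: m_def)
      have eE: "emeasure ?P (?E h r) = ennreal (w * (h * r ^ N))" if "0 < h" "0 < r" for h r
        using emeasure_PiM_ellipsoid(2)[OF that, of N a] unfolding w_def m_def by (simp only: times_divide_eq_left times_divide_eq_right of_nat_Suc mult_ac add_ac)
      have Gp: "(a + C * u) * rp ^ N = u ^ N * G u" "(a - C * u) * rm ^ N = u ^ N * G (- u)"
        by (simp_all add: rp_def rm_def G_def power_mult_distrib)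
      have up': "emeasure ?P (?S s) \<le> ennreal (w * (u ^ N * G u))"
      proof -
        have "emeasure ?P (?S s) \<le> emeasure ?P (?E (a + C * u) rp)"
        proof (rule emeasure_mono[OF upper])
          show "?E (a + C * u) rp \<in> sets ?P"
            unfolding m_def by (rule emeasure_PiM_ellipsoid(1)[OF aC(2) r(1)])
        qed
        also have "\<dots> = ennreal (w * ((a + C * u) * rp ^ N))" by (rule eE[OF aC(2) r(1)])
        finally show ?thesis by (simp only: Gp)
      qed
      have low': "ennreal (w * (u ^ N * G (- u))) \<le> emeasure ?P (?S s)"
      proof -
        have "ennreal (w * ((a - C * u) * rm ^ N)) = emeasure ?P (?E (a - C * u) rm)" by (rule eE[OF aC(1) r(2), symmetric])
        also have "\<dots> \<le> emeasure ?P (?S s)" by (rule emeasure_mono[OF lower S])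
        finally show ?thesis by (simp only: Gp)
      qed
      show "\<bar>measure ?P (?S s) - V * sqrt s ^ N\<bar> \<le> w * K * sqrt s ^ Suc N"
      proof -
        have fin: "emeasure ?P (?S s) < \<infinity>"
          using up' by (rule le_less_trans) (simp add: ennreal_less_top)
        have G: "\<bar>G u - G 0\<bar> \<le> K * u" "\<bar>G (- u) - G 0\<bar> \<le> K * u"
          using K(3)[of u] K(3)[of "- u"] u ue by auto
        have G_pos: "0 < G u" "0 < G (- u)"
          using aC AB by (auto simp: G_def)
        have eq: "emeasure ?P (?S s) = ennreal (measure ?P (?S s))"
          using fin by (simp add: emeasure_eq_ennreal_measure)
        have "measure ?P (?S s) \<le> w * (u ^ N * G u)"
          using up' G_pos w u unfolding eq by (subst (asm) ennreal_le_iff) auto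
        also have "\<dots> \<le> w * (u ^ N * (G 0 + K * u))"
          using G w u by (intro mult_left_mono) auto
        finally have 1: "measure ?P (?S s) - w * u ^ N * G 0 \<le> w * K * u ^ Suc N"
          by (simp add: algebra_simps)
        have "w * (u ^ N * (G 0 - K * u)) \<le> w * (u ^ N * G (- u))"
          using G w u by (intro mult_left_mono) auto
        also have "\<dots> \<le> measure ?P (?S s)"
          using low' unfolding eq by (subst (asm) ennreal_le_iff) auto
        finally have 2: "w * u ^ N * G 0 - measure ?P (?S s) \<le> w * K * u ^ Suc N"
          by (simp add: algebra_simps)
        have "V * sqrt s ^ N = w * u ^ N * G 0"
          by (simp add: V_def w_def G_def u_def)
        then show "\<bar>measure ?P (?S s) - V * sqrt s ^ N\<bar> \<le> w * K * sqrt s ^ Suc N"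
          using 1 2 unfolding u_def by (simp only: abs_le_iff) auto
      qed
    qed
  qed
qed

section \<open>Circumscribed polygons\<close>

lemma inner_cis: "cis \<alpha> \<bullet> cis \<beta> = cos (\<alpha> - \<beta>)"
  by (simp add: inner_complex_def cos_diff)

lemma on_circle_cis_Arg2pi: "z \<in> sphere 0 1 \<Longrightarrow> cis (Arg2pi z) = z"
  using complex_norm_eq_1_exp[of z] by (simp add: cis_conv_exp)

lemma Arg2pi_cis: "0 \<le> \<alpha> \<Longrightarrow> \<alpha> < 2 * pi \<Longrightarrow> Arg2pi (cis \<alpha>) = \<alpha>"
  by (rule Arg2pi_unique[of 1]) (auto simp: cis_conv_exp)

lemma cos_neg_between: "pi / 2 < x \<Longrightarrow> x < 3 * pi / 2 \<Longrightarrow> cos x < 0"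
  using cos_gt_zero_pi[of "x - pi"] by (simp add: cos_diff)

text \<open>A gap of at least pi leaves all points in the closed semicircle opposite its midpoint.
  Conversely, the complement of a closed semicircle is an open arc of length pi, and a walk around
  the circle with steps shorter than pi cannot jump over it.\<close>

lemma determines_polygon_iff_gaps:
  fixes \<theta> :: "nat \<Rightarrow> real"
  assumes mono: "strict_mono_on {..<m} \<theta>" and m: "0 < m" and range: "\<And>k. k < m \<Longrightarrow> 0 \<le> \<theta> k \<and> \<theta> k < 2 * pi"
  shows "determines_polygon ((\<lambda>k. cis (\<theta> k)) ` {..<m}) \<longleftrightarrow> (\<forall>k<m. gap m \<theta> k < pi)"
proof
  assume det: "determines_polygon ((\<lambda>k. cis (\<theta> k)) ` {..<m})"
  have le: "\<theta> i \<le> \<theta> j" if "i \<le> j" "j < m" for i j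
    using strict_mono_onD[OF mono, of i j] that by (cases "i = j") auto
  show "\<forall>k<m. gap m \<theta> k < pi"
  proof (intro allI impI, rule ccontr)
    fix k assume k: "k < m" and "\<not> gap m \<theta> k < pi"
    then have g: "pi \<le> gap m \<theta> k" by simp
    have "\<exists>\<phi>. \<forall>j<m. 0 \<le> cos (\<theta> j - \<phi>)"
    proof (cases "Suc k = m")
      case True
      show ?thesis
      proof (intro exI[of _ "(\<theta> 0 + \<theta> k) / 2"] allI impI cos_ge_zero)
        fix j assume "j < m"
        then have "\<theta> 0 \<le> \<theta> j" "\<theta> j \<le> \<theta> k" using True by (auto intro!: le)
        then show "- (pi / 2) \<le> \<theta> j - (\<theta> 0 + \<theta> k) / 2" "\<theta> j - (\<theta> 0 + \<theta> k) / 2 \<le> pi / 2"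
          using g True by (auto simp: gap_def field_simps)
      qed
    next
      case False
      then have k': "Suc k < m" using k by simp
      have g': "pi \<le> \<theta> (Suc k) - \<theta> k" using g False by (simp add: gap_def)
      \<comment> \<open>The antipode of the midpoint of the gap. It can exceed the angles up to
        index \<open>k\<close> by more than pi, which is why those are shifted by a full turn
        below.\<close>
      define \<phi> where "\<phi> = (\<theta> k + \<theta> (Suc k)) / 2 + pi"
      show ?thesis
      proof (intro exI[of _ \<phi>] allI impI)
        fix j assume j: "j < m"
        show "0 \<le> cos (\<theta> j - \<phi>)"
        proof (cases "j \<le> k")
          case True
          have "\<theta> j \<le> \<theta> k" using True k by (intro le) auto
          have "0 \<le> cos (\<theta> j - \<phi> + 2 * pi)"
            using g' range[OF j] range[OF k'] \<open>\<theta> j \<le> \<theta> k\<close> by (intro cos_ge_zero) (auto simp: \<phi>_def field_simps)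
          then show ?thesis by simp
        next
          case False
          have "\<theta> (Suc k) \<le> \<theta> j" using False j by (intro le) auto
          then show ?thesis
            using g' range[OF j] range[OF k] by (intro cos_ge_zero) (auto simp: \<phi>_def field_simps)
        qed
      qed
    qed
    then obtain \<phi> where "\<forall>j<m. 0 \<le> cos (\<theta> j - \<phi>)" by blast
    then have "(\<lambda>k. cis (\<theta> k)) ` {..<m} \<subseteq> closed_semicircle (cis \<phi>)"
      by (auto simp: closed_semicircle_def inner_cis)
    moreover have "cis \<phi> \<in> sphere 0 1" by simp
    ultimately show False using det unfolding determines_polygon_def by blast
  qed
next
  assume g: "\<forall>k<m. gap m \<theta> k < pi"
  have "\<not> (\<lambda>k. cis (\<theta> k)) ` {..<m} \<subseteq> closed_semicircle w" if w: "w \<in> sphere 0 1" for w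
  proof
    assume sub: "(\<lambda>k. cis (\<theta> k)) ` {..<m} \<subseteq> closed_semicircle w"
    define \<phi> where "\<phi> = Arg2pi w"
    have \<phi>: "0 \<le> \<phi>" "\<phi> < 2 * pi" "w = cis \<phi>" using Arg2pi[of w] on_circle_cis_Arg2pi[OF w] by (auto simp: \<phi>_def)
    have c: "0 \<le> cos (\<theta> k - \<phi>)" if "k < m" for k
      using sub that by (auto simp: closed_semicircle_def \<phi>(3) inner_cis image_subset_iff)
    \<comment> \<open>The angles unrolled onto the real line, one turn after another, so that
      consecutive differences are the gaps.\<close>
    define \<psi> where "\<psi> = (\<lambda>k. \<theta> (k mod m) + 2 * pi * real (k div m))"
    have step: "\<psi> (Suc k) < \<psi> k + pi" for k
    proof -
      have "\<psi> (Suc k) - \<psi> k = gap m \<theta> (k mod m)"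
        by (simp add: \<psi>_def gap_def mod_Suc div_Suc algebra_simps)
      then show ?thesis using g m by (auto simp: dest: spec[of _ "k mod m"])
    qed
    \<comment> \<open>The target is delayed by 2 pi so that index 0 certainly lies before it,
      whatever \<open>\<phi>\<close> in [0, 2 pi) is; three turns then certainly pass it.\<close>
    have "\<psi> (3 * m) > \<phi> + 2 * pi + pi / 2"
      using m range[of 0] \<phi> pi_gt_zero by (simp add: \<psi>_def)
    then have ex: "\<exists>k. \<psi> k > \<phi> + 2 * pi + pi / 2" by blast
    define k where "k = (LEAST k. \<psi> k > \<phi> + 2 * pi + pi / 2)"
    have k: "\<psi> k > \<phi> + 2 * pi + pi / 2" unfolding k_def by (rule LeastI_ex[OF ex])
    have "k \<noteq> 0"
    proof
      assume "k = 0"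
      then show False using k range[of 0] m \<phi> by (simp add: \<psi>_def)
    qed
    then obtain l where l: "k = Suc l" by (cases k) auto
    have "\<not> \<psi> l > \<phi> + 2 * pi + pi / 2" 
    proof -
      have "l < (LEAST k. \<psi> k > \<phi> + 2 * pi + pi / 2)" unfolding k_def[symmetric] using l by simp
      from not_less_Least[OF this] show ?thesis .
    qed
    then have "\<psi> k < \<phi> + 2 * pi + 3 * pi / 2" using step[of l] l by simp
    then have "cos (\<psi> k - \<phi> - 2 * pi) < 0" using k by (intro cos_neg_between) auto
    moreover have "cos (\<psi> k - \<phi> - 2 * pi) = cos (\<theta> (k mod m) - \<phi>)"
    proof -
      have "cos (\<psi> k - \<phi> - 2 * pi) = cos ((\<theta> (k mod m) - \<phi>) + 2 * pi * of_int (int (k div m) - 1))"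
        by (simp add: \<psi>_def algebra_simps)
      then show ?thesis by (simp only: cos_add cos_int_2pin sin_int_2pin mult_1_right mult_zero_right diff_zero)
    qed
    ultimately show False using c[of "k mod m"] m by simp
  qed
  then show "determines_polygon ((\<lambda>k. cis (\<theta> k)) ` {..<m})"
    unfolding determines_polygon_def by auto
qed

text \<open>Multiplying a unit vector by \<open>Complex 1 y\<close> moves distance y along the
  tangent there, so the two formulas reach the vertex forwards from one point of contact and
  backwards from the other. It is unique because the tangents form a linear system with determinant
  sin g.\<close>

lemma tangent_intersection_cis:
  assumes "0 < g" "g < pi"
  shows "tangent_intersection (cis \<alpha>) (cis (\<alpha> + g)) = cis \<alpha> * Complex 1 (tan (g / 2))"
    and "tangent_intersection (cis \<alpha>) (cis (\<alpha> + g)) = cis (\<alpha> + g) * Complex 1 (- tan (g / 2))"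
proof -
  have c: "cos (g / 2) \<noteq> 0" using cos_half_pos[OF assms] by simp
  have sg: "sin g \<noteq> 0" using assms sin_gt_zero[of g] by simp
  have p1: "Complex 1 (tan (g / 2)) = cis (g / 2) / cos (g / 2)"
    using c by (simp add: complex_eq_iff tan_def)
  have p2: "Complex 1 (- tan (g / 2)) = cis (- (g / 2)) / cos (g / 2)"
    using c by (simp add: complex_eq_iff tan_def)
  have eq: "cis \<alpha> * Complex 1 (tan (g / 2)) = cis (\<alpha> + g) * Complex 1 (- tan (g / 2))"
    unfolding p1 p2 by (simp add: cis_mult add.commute)
  have on: "\<beta> * Complex 1 y \<in> tangent_line \<beta>" if "norm \<beta> = 1" for \<beta> y
  proof -
    have "(Re \<beta>)\<^sup>2 + (Im \<beta>)\<^sup>2 = 1" using that by (simp add: cmod_def)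
    then show ?thesis
      by (simp add: tangent_line_def inner_complex_def algebra_simps)
  qed
  define v where "v = cis \<alpha> * Complex 1 (tan (g / 2))"
  have "tangent_intersection (cis \<alpha>) (cis (\<alpha> + g)) = v"
    unfolding tangent_intersection_def
  proof (rule the_equality)
    have "v \<in> tangent_line (cis \<alpha>)" unfolding v_def by (rule on) simp
    moreover have "v \<in> tangent_line (cis (\<alpha> + g))" unfolding v_def eq by (rule on) simp
    ultimately show "v \<in> tangent_line (cis \<alpha>) \<inter> tangent_line (cis (\<alpha> + g))" by blast
    then have v: "(v - cis \<alpha>) \<bullet> cis \<alpha> = 0" "(v - cis (\<alpha> + g)) \<bullet> cis (\<alpha> + g) = 0"
      by (auto simp: tangent_line_def)
    fix z assume "z \<in> tangent_line (cis \<alpha>) \<inter> tangent_line (cis (\<alpha> + g))"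
    then have z: "(z - cis \<alpha>) \<bullet> cis \<alpha> = 0" "(z - cis (\<alpha> + g)) \<bullet> cis (\<alpha> + g) = 0"
      by (auto simp: tangent_line_def)
    define x y where "x = Re (z - v)" and "y = Im (z - v)"
    have 1: "x * cos \<alpha> + y * sin \<alpha> = 0" "x * cos (\<alpha> + g) + y * sin (\<alpha> + g) = 0"
      using v z by (auto simp: x_def y_def inner_complex_def algebra_simps)
    have s: "sin g = sin (\<alpha> + g) * cos \<alpha> - cos (\<alpha> + g) * sin \<alpha>"
      using sin_diff[of "\<alpha> + g" \<alpha>] by simp
    have "x * sin g = sin (\<alpha> + g) * (x * cos \<alpha> + y * sin \<alpha>) - sin \<alpha> * (x * cos (\<alpha> + g) + y * sin (\<alpha> + g))"
      unfolding s by (simp add: algebra_simps)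
    moreover have "y * sin g = cos \<alpha> * (x * cos (\<alpha> + g) + y * sin (\<alpha> + g)) - cos (\<alpha> + g) * (x * cos \<alpha> + y * sin \<alpha>)"
      unfolding s by (simp add: algebra_simps)
    ultimately have "x = 0" "y = 0" using 1 sg by auto
    then show "z = v" by (simp add: x_def y_def complex_eq_iff)
  qed
  then show "tangent_intersection (cis \<alpha>) (cis (\<alpha> + g)) = cis \<alpha> * Complex 1 (tan (g / 2))"
    "tangent_intersection (cis \<alpha>) (cis (\<alpha> + g)) = cis (\<alpha> + g) * Complex 1 (- tan (g / 2))"
    using eq by (auto simp: v_def)
qed


lemma cyclic_list_set:
  assumes "set us \<subseteq> sphere 0 1" "sorted_wrt (<) (map Arg2pi us)"
  shows "cyclic_list (set us) = us"
proof -
  interpret folding_insort_key "(\<le>) :: real \<Rightarrow> _" "(<)" "sphere 0 1" Arg2pi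
    by standard (metis inj_onI on_circle_cis_Arg2pi)
  have "distinct (map Arg2pi us)" using assms(2) by (simp add: strict_sorted_iff)
  then show ?thesis
    unfolding cyclic_list_def linorder_class.sorted_key_list_of_set_dict using assms
    by (intro idem_if_sorted_distinct) (auto simp: strict_sorted_iff distinct_map)
qed

lemma sorted_cyclic_list:
  assumes "A \<subseteq> sphere 0 1" "finite A"
  shows "set (cyclic_list A) = A" "length (cyclic_list A) = card A" "sorted_wrt (<) (map Arg2pi (cyclic_list A))"
proof -
  interpret folding_insort_key "(\<le>) :: real \<Rightarrow> _" "(<)" "sphere 0 1" Arg2pi
    by standard (metis inj_onI on_circle_cis_Arg2pi)
  show "set (cyclic_list A) = A" "length (cyclic_list A) = card A" "sorted_wrt (<) (map Arg2pi (cyclic_list A))"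
    unfolding cyclic_list_def linorder_class.sorted_key_list_of_set_dict using assms by auto
qed

lemma near_regular_mono:
  assumes "near_regular m s \<theta>" "i < j" "j < m"
  shows "\<theta> i < \<theta> j"
  using assms(2,3)
proof (induction j)
  case (Suc j)
  have "0 < gap m \<theta> j" using assms(1) Suc.prems by (simp add: near_regular_def)
  then have "\<theta> j < \<theta> (Suc j)" using Suc.prems by (simp add: gap_def)
  then show ?case using Suc by (cases "i = j") auto
qed simp

text \<open>The side between consecutive vertices touches the circle at the point between them and
  is split there into two tangent segments. Going around, each segment length
  \<open>\<tau> k\<close> occurs twice.\<close>

lemma perimeter_polygon_vertices:
  fixes us :: "complex list"
  defines "\<theta> \<equiv> \<lambda>k. Arg2pi (us ! k)" and "m \<equiv> length us"
  assumes m: "0 < m" and us: "set us \<subseteq> sphere 0 1" "sorted_wrt (<) (map Arg2pi us)"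
    and gap: "\<And>k. k < m \<Longrightarrow> 0 < gap m \<theta> k \<and> gap m \<theta> k < pi"
  shows "perimeter (polygon_vertices (set us)) = (\<Sum>k<m. 2 * tan (gap m \<theta> k / 2))"
proof -
  define v where "v = (\<lambda>k. tangent_intersection (us ! k) (us ! (Suc k mod m)))"
  define \<tau> where "\<tau> = (\<lambda>k. tan (gap m \<theta> k / 2))"
  have pv: "polygon_vertices (set us) = map v [0..<m]"
    by (simp add: polygon_vertices_def cyclic_list_set[OF us] Let_def v_def m_def)
  have cis: "us ! k = cis (\<theta> k)" if "k < m" for k
  proof -
    have "us ! k \<in> sphere 0 1" using us(1) nth_mem[of k us] that unfolding m_def by blast
    then show ?thesis unfolding \<theta>_def by (rule on_circle_cis_Arg2pi[symmetric])
  qed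
  have next_cis: "us ! (Suc k mod m) = cis (\<theta> k + gap m \<theta> k)" if "k < m" for k
  proof (cases "Suc k = m")
    case True
    then have "us ! (Suc k mod m) = cis (\<theta> 0)" using cis[OF m] by simp
    also have "cis (\<theta> 0) = cis (\<theta> 0 + 2 * pi)" by (simp add: complex_eq_iff)
    finally show ?thesis using True by (simp add: gap_def)
  next
    case False
    then show ?thesis using cis[of "Suc k"] that by (simp add: gap_def)
  qed
  have v1: "v k = us ! k * Complex 1 (\<tau> k)" and v2: "v k = us ! (Suc k mod m) * Complex 1 (- \<tau> k)" if "k < m" for k
    using tangent_intersection_cis[of "gap m \<theta> k" "\<theta> k"] gap[OF that]
    unfolding v_def next_cis[OF that] by (simp_all add: cis[OF that] \<tau>_def)
  have \<tau>: "0 < \<tau> k" if "k < m" for k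
    unfolding \<tau>_def using gap[OF that] by (intro tan_half_pos) auto
  have d: "dist (v k) (v (Suc k mod m)) = \<tau> k + \<tau> (Suc k mod m)" if "k < m" for k
  proof -
    have k': "Suc k mod m < m" using m by simp
    have "v (Suc k mod m) - v k = us ! (Suc k mod m) * Complex 0 (\<tau> (Suc k mod m) + \<tau> k)"
      unfolding v1[OF k'] v2[OF that] by (simp add: algebra_simps complex_eq_iff)
    moreover have "norm (us ! (Suc k mod m)) = 1" by (simp add: cis[OF k'])
    moreover have "norm (Complex 0 (\<tau> (Suc k mod m) + \<tau> k)) = \<tau> (Suc k mod m) + \<tau> k"
      using \<tau>[OF that] \<tau>[OF k'] by (simp add: cmod_def)
    ultimately show ?thesis by (subst dist_commute) (simp add: dist_norm norm_mult add.commute)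
  qed
  obtain N where N: "m = Suc N" using m by (cases m) auto
  have "perimeter (polygon_vertices (set us)) = (\<Sum>k<m. \<tau> k + \<tau> (Suc k mod m))"
    unfolding perimeter_def pv using d m by (auto intro!: sum.cong)
  also have "\<dots> = (\<Sum>k<m. \<tau> k) + (\<Sum>k<m. \<tau> (Suc k mod m))" by (rule sum.distrib)
  also have "(\<Sum>k<m. \<tau> (Suc k mod m)) = (\<Sum>k<N. \<tau> (Suc k)) + \<tau> 0"
    by (simp add: N)
  also have "\<dots> = (\<Sum>k<m. \<tau> k)" unfolding N by (subst sum.lessThan_Suc_shift) simp
  finally show ?thesis by (simp add: \<tau>_def flip: sum_distrib_left)
qed

lemma polygon_iff_near_regular:
  fixes us :: "complex list"
  defines "\<theta> \<equiv> \<lambda>k. Arg2pi (us ! k)" and "m \<equiv> length us"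
  assumes m: "0 < m" and us: "set us \<subseteq> sphere 0 1" "sorted_wrt (<) (map Arg2pi us)"
  shows "determines_polygon (set us) \<and> perimeter (polygon_vertices (set us)) \<le> 2 * real m * tan (pi / real m) + s
    \<longleftrightarrow> near_regular m s \<theta>"
proof -
  have mono: "strict_mono_on {..<m} \<theta>"
    using us(2) by (auto simp: strict_mono_on_def \<theta>_def m_def sorted_wrt_map sorted_wrt_iff_nth_less)
  have range: "0 \<le> \<theta> k \<and> \<theta> k < 2 * pi" for k using Arg2pi[of "us ! k"] by (simp add: \<theta>_def)
  have pos: "0 < gap m \<theta> k" if "k < m" for k
    using strict_mono_onD[OF mono, of k "Suc k"] range[of 0] range[of k] that by (auto simp: gap_def)
  have "set us = (\<lambda>k. us ! k) ` {..<m}" by (auto simp: m_def in_set_conv_nth)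
  also have "\<dots> = (\<lambda>k. cis (\<theta> k)) ` {..<m}"
  proof (rule image_cong[OF refl])
    fix k assume "k \<in> {..<m}"
    then have "us ! k \<in> sphere 0 1" using us(1) nth_mem[of k us] unfolding m_def by blast
    then show "us ! k = cis (\<theta> k)" unfolding \<theta>_def by (rule on_circle_cis_Arg2pi[symmetric])
  qed
  finally have det: "determines_polygon (set us) \<longleftrightarrow> (\<forall>k<m. gap m \<theta> k < pi)"
    using determines_polygon_iff_gaps[OF mono m range] by simp
  show ?thesis
  proof (cases "\<forall>k<m. gap m \<theta> k < pi")
    case True
    have "perimeter (polygon_vertices (set us)) = (\<Sum>k<m. 2 * tan (gap m \<theta> k / 2))"
      unfolding \<theta>_def m_def using m us True pos by (intro perimeter_polygon_vertices) (auto simp: \<theta>_def m_def)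
    then show ?thesis using det True pos range by (simp add: near_regular_def)
  next
    case False
    then show ?thesis using det by (auto simp: near_regular_def)
  qed
qed

section \<open>From point sets to index tuples\<close>

text \<open>Tuples rather than sets of indices: at most one ordering of a set is near-regular, so no point
  set is counted twice, and the probability of each ordering is a volume without a symmetrization.\<close>

definition index_lists :: "nat \<Rightarrow> nat \<Rightarrow> nat list set" where
  "index_lists m n = {\<alpha>. distinct \<alpha> \<and> length \<alpha> = m \<and> set \<alpha> \<subseteq> {1..n}}"

text \<open>The infimum is attained. The bound \<open>c < \<infinity>\<close> covers the empty
  collection, where the infimum is infinite and both sides are false.\<close>

lemma INF_le_iff_finite:
  fixes f :: "'a \<Rightarrow> ereal"
  assumes "finite S" "c < \<infinity>"
  shows "(INF x\<in>S. f x) \<le> c \<longleftrightarrow> (\<exists>x\<in>S. f x \<le> c)"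
proof (cases "S = {}")
  case True
  then show ?thesis using assms by (auto simp: top_ereal_def)
next
  case False
  have "(INF x\<in>S. f x) = Min (f ` S)" using assms False by (intro Min_Inf[symmetric]) auto
  then show ?thesis using assms False by (simp add: Min_le_iff)
qed

text \<open>A set yields a tuple by listing its points cyclically and pulling them back to indices;
  \<open>card A = card I\<close> makes this unambiguous. Conversely, increasing angles make the
  points of a near-regular tuple distinct. The clause about the circle is needed because
  \<open>Arg2pi\<close> also assigns angles to points off the circle.\<close>

lemma min_perimeter_le_iff:
  assumes m: "0 < m"
  shows "min_perimeter m n u \<le> ereal (2 * real m * tan (pi / real m) + s) \<longleftrightarrow>
    (\<exists>\<alpha>\<in>index_lists m n. (\<forall>i\<in>set \<alpha>. u i \<in> sphere 0 1) \<and> near_regular m s (\<lambda>k. Arg2pi (u (\<alpha> ! k))))"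
    (is "?L \<longleftrightarrow> ?R")
proof -
  let ?S = "{A. \<exists>I \<subseteq> {1..n}. card I = m \<and> A = u ` I \<and> card A = m \<and> determines_polygon A}"
  let ?c = "2 * real m * tan (pi / real m) + s"
  have "finite ?S" by (rule finite_subset[of _ "(\<lambda>I. u ` I) ` Pow {1..n}"]) auto
  then have "?L \<longleftrightarrow> (\<exists>A\<in>?S. perimeter (polygon_vertices A) \<le> ?c)"
    unfolding min_perimeter_def by (subst INF_le_iff_finite) auto
  also have "\<dots> \<longleftrightarrow> ?R"
  proof
    assume "\<exists>A\<in>?S. perimeter (polygon_vertices A) \<le> ?c"
    then obtain A I where I: "I \<subseteq> {1..n}" "card I = m" "A = u ` I" "card A = m"
      and det: "determines_polygon A" and le: "perimeter (polygon_vertices A) \<le> ?c" by blast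
    have A: "A \<subseteq> sphere 0 1" "finite A" using det by (auto simp: determines_polygon_def)
    have "finite I" using I(1) finite_subset by blast
    then have inj: "inj_on u I" using I by (intro eq_card_imp_inj_on) auto
    define us where "us = cyclic_list A"
    have us: "set us = A" "length us = m" "sorted_wrt (<) (map Arg2pi us)"
      using sorted_cyclic_list[OF A] I by (auto simp: us_def)
    define \<alpha> where "\<alpha> = map (inv_into I u) us"
    have "distinct us" using us(3) by (auto simp: strict_sorted_iff distinct_map)
    then have "distinct \<alpha>" using inj us(1) I(3) unfolding \<alpha>_def by (simp add: distinct_map inj_on_inv_into)
    moreover have "set \<alpha> = I" using us(1) I(3) inj by (simp add: \<alpha>_def)
    moreover have len: "length \<alpha> = m" using us by (simp add: \<alpha>_def)
    ultimately have "\<alpha> \<in> index_lists m n" using I by (simp add: index_lists_def)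
    moreover have "\<forall>i\<in>set \<alpha>. u i \<in> sphere 0 1" using \<open>set \<alpha> = I\<close> A I(3) by blast
    moreover have "near_regular m s (\<lambda>k. Arg2pi (u (\<alpha> ! k)))"
    proof -
      have "near_regular m s (\<lambda>k. Arg2pi (us ! k))"
        using polygon_iff_near_regular[of us s] us m A det le by auto
      moreover have eq: "u (\<alpha> ! k) = us ! k" if "k < m" for k
        using that us I(3) nth_mem[of k us] by (simp add: \<alpha>_def f_inv_into_f)
      ultimately show ?thesis
      proof -
        have "gap m (\<lambda>k. Arg2pi (us ! k)) k = gap m (\<lambda>k. Arg2pi (u (\<alpha> ! k))) k" if "k < m" for k
          using that m eq[of 0] eq[of k] eq[of "Suc k"] by (auto simp: gap_def)
        then show "near_regular m s (\<lambda>k. Arg2pi (us ! k)) \<Longrightarrow> ?thesis"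
          using eq[of 0] eq[of "m - 1"] m by (simp add: near_regular_def)
      qed
    qed
    ultimately show ?R by blast
  next
    assume ?R
    then obtain \<alpha> where \<alpha>: "distinct \<alpha>" "length \<alpha> = m" "set \<alpha> \<subseteq> {1..n}"
      and sph: "\<forall>i\<in>set \<alpha>. u i \<in> sphere 0 1" and near: "near_regular m s (\<lambda>k. Arg2pi (u (\<alpha> ! k)))"
      by (auto simp: index_lists_def)
    define us where "us = map u \<alpha>"
    have us: "set us = u ` set \<alpha>" "length us = m" "set us \<subseteq> sphere 0 1" using \<alpha> sph by (auto simp: us_def)
    have sorted: "sorted_wrt (<) (map Arg2pi us)"
      using near_regular_mono[OF near] \<alpha>(2) by (simp add: sorted_wrt_iff_nth_less us_def)
    have gap: "gap m (\<lambda>k. Arg2pi (us ! k)) k = gap m (\<lambda>k. Arg2pi (u (\<alpha> ! k))) k" if "k < m" for k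
      using that m \<alpha>(2) by (auto simp: gap_def us_def)
    have "near_regular m s (\<lambda>k. Arg2pi (us ! k))"
      using near gap \<alpha>(2) m by (simp add: near_regular_def us_def)
    then have det: "determines_polygon (set us) \<and> perimeter (polygon_vertices (set us)) \<le> ?c"
      using polygon_iff_near_regular[of us s] us sorted m by auto
    have "distinct us" using sorted by (auto simp: strict_sorted_iff distinct_map)
    then have "card (set us) = m" using us(2) distinct_card by blast
    moreover have "card (set \<alpha>) = m" using \<alpha> distinct_card by blast
    ultimately show "\<exists>A\<in>?S. perimeter (polygon_vertices A) \<le> ?c"
      using det us(1) \<alpha>(3) by blast
  qed
  finally show ?thesis .
qed

lemma scaled_excess_le_iff:
  fixes x :: ereal and b c t :: real
  assumes "0 < c"
  shows "ereal c * (x - ereal b) \<le> ereal t \<longleftrightarrow> x \<le> ereal (b + t / c)"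
  using assms by (cases x) (auto simp: field_simps)

section \<open>Independent uniform angles\<close>

definition angle_measure :: "real measure" where
  "angle_measure = uniform_measure lborel {0..<2 * pi}"

lemma prob_space_angle_measure: "prob_space angle_measure"
  unfolding angle_measure_def by (rule prob_space_uniform_measure) auto

lemma space_angle_measure [simp]: "space angle_measure = UNIV"
  and sets_angle_measure [simp, measurable_cong]: "sets angle_measure = sets borel"
  by (simp_all add: angle_measure_def)

lemma emeasure_angle_measure:
  assumes "A \<in> sets borel"
  shows "emeasure angle_measure A = ennreal (1 / (2 * pi)) * emeasure lborel (A \<inter> {0..<2 * pi})"
  using assms unfolding angle_measure_def
  by (simp add: emeasure_uniform_measure Int_commute divide_ennreal_def mult.commute inverse_ennreal)
     (simp add: inverse_eq_divide)

lemma PiM_angle_measure: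
  assumes "finite I"
  shows "PiM I (\<lambda>_. angle_measure)
    = density (PiM I (\<lambda>_. lborel)) (\<lambda>x. \<Prod>i\<in>I. ennreal (1 / (2 * pi)) * indicator {0..<2 * pi} (x i))"
proof -
  interpret A: product_sigma_finite "\<lambda>_. angle_measure"
    by (intro product_sigma_finite.intro prob_space_imp_sigma_finite prob_space_angle_measure)
  interpret L: product_sigma_finite "\<lambda>_. lborel :: real measure" by standard
  show ?thesis
  proof (rule A.PiM_eqI[symmetric, OF assms])
    show "sets (density (PiM I (\<lambda>_. lborel)) (\<lambda>x. \<Prod>i\<in>I. ennreal (1 / (2 * pi)) * indicator {0..<2 * pi} (x i)))
        = sets (PiM I (\<lambda>_. angle_measure))"
      by (simp, intro sets_PiM_cong) auto
    fix A :: "'a \<Rightarrow> real set" assume "\<And>i. i \<in> I \<Longrightarrow> A i \<in> sets angle_measure"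
    then have A: "\<And>i. i \<in> I \<Longrightarrow> A i \<in> sets lborel" by simp
    then have PE: "PiE I A \<in> sets (PiM I (\<lambda>_. lborel))" using assms by (intro sets_PiM_I_finite) auto
    have "emeasure (density (PiM I (\<lambda>_. lborel)) (\<lambda>x. \<Prod>i\<in>I. ennreal (1 / (2 * pi)) * indicator {0..<2 * pi} (x i))) (PiE I A)
      = (\<integral>\<^sup>+x. (\<Prod>i\<in>I. ennreal (1 / (2 * pi)) * indicator {0..<2 * pi} (x i)) * indicator (PiE I A) x \<partial>PiM I (\<lambda>_. lborel))"
      using PE by (intro emeasure_density) auto
    also have "\<dots> = (\<integral>\<^sup>+x. (\<Prod>i\<in>I. ennreal (1 / (2 * pi)) * indicator (A i \<inter> {0..<2 * pi}) (x i)) \<partial>PiM I (\<lambda>_. lborel))"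
    proof (rule nn_integral_cong)
      fix x :: "'a \<Rightarrow> real" assume "x \<in> space (PiM I (\<lambda>_. lborel :: real measure))"
      then have "indicator (PiE I A) x = (\<Prod>i\<in>I. indicator (A i) (x i) :: ennreal)"
        
        using assms by (cases "\<forall>i\<in>I. x i \<in> A i") (auto simp: space_PiM PiE_def indicator_def prod_zero_iff)
      then show "(\<Prod>i\<in>I. ennreal (1 / (2 * pi)) * indicator {0..<2 * pi} (x i)) * indicator (PiE I A) x
          = (\<Prod>i\<in>I. ennreal (1 / (2 * pi)) * indicator (A i \<inter> {0..<2 * pi}) (x i))"
        by (simp add: prod.distrib[symmetric] indicator_inter_arith mult_ac)
    qed
    also have "\<dots> = (\<Prod>i\<in>I. \<integral>\<^sup>+x. ennreal (1 / (2 * pi)) * indicator (A i \<inter> {0..<2 * pi}) x \<partial>lborel)"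
      using assms A by (intro L.product_nn_integral_prod) auto
    also have "\<dots> = (\<Prod>i\<in>I. emeasure angle_measure (A i))"
      using A by (intro prod.cong) (auto simp: emeasure_angle_measure nn_integral_cmult)
    finally show "emeasure (density (PiM I (\<lambda>_. lborel)) (\<lambda>x. \<Prod>i\<in>I. ennreal (1 / (2 * pi)) * indicator {0..<2 * pi} (x i))) (PiE I A)
      = (\<Prod>i\<in>I. emeasure angle_measure (A i))" .
  qed
qed

lemma near_regular_range:
  assumes "near_regular m s \<theta>" "k < m"
  shows "0 \<le> \<theta> k" "\<theta> k < 2 * pi"
proof -
  have "\<theta> 0 \<le> \<theta> k" using near_regular_mono[OF assms(1), of 0 k] assms(2) by (cases "k = 0") auto
  then show "0 \<le> \<theta> k" using assms(1) by (simp add: near_regular_def)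
  have "k = m - 1 \<or> k < m - 1" using assms(2) by linarith
  then have "\<theta> k \<le> \<theta> (m - 1)"
    using near_regular_mono[OF assms(1), of k "m - 1"] assms(2) by (auto intro: less_imp_le)
  then show "\<theta> k < 2 * pi" using assms(1) by (simp add: near_regular_def)
qed

text \<open>Near-regular angles all lie in [0, 2 pi), where the product density is constant.\<close>

lemma emeasure_near_regular:
  assumes "0 < m"
  shows "emeasure (PiM {..<m} (\<lambda>_. angle_measure)) {\<theta> \<in> space (PiM {..<m} (\<lambda>_. borel)). near_regular m s \<theta>}
    = ennreal (1 / (2 * pi)) ^ m * emeasure (PiM {..<m} (\<lambda>_. lborel)) {\<theta> \<in> space (PiM {..<m} (\<lambda>_. lborel)). near_regular m s \<theta>}"
proof -
  let ?X = "{\<theta> \<in> space (PiM {..<m} (\<lambda>_. lborel)). near_regular m s \<theta>}"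
  have X: "?X \<in> sets (PiM {..<m} (\<lambda>_. lborel))" using pred_near_regular_lborel[OF assms] .
  have "space (PiM {..<m} (\<lambda>_. borel)) = space (PiM {..<m} (\<lambda>_. lborel :: real measure))" by (simp add: space_PiM)
  then have "emeasure (PiM {..<m} (\<lambda>_. angle_measure)) {\<theta> \<in> space (PiM {..<m} (\<lambda>_. borel)). near_regular m s \<theta>}
    = (\<integral>\<^sup>+x. (\<Prod>i<m. ennreal (1 / (2 * pi)) * indicator {0..<2 * pi} (x i)) * indicator ?X x \<partial>PiM {..<m} (\<lambda>_. lborel))"
    using X unfolding PiM_angle_measure[OF finite_lessThan] by (simp only:, intro emeasure_density) auto
  also have "\<dots> = (\<integral>\<^sup>+x. ennreal (1 / (2 * pi)) ^ m * indicator ?X x \<partial>PiM {..<m} (\<lambda>_. lborel))"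
  proof (rule nn_integral_cong)
    fix x :: "nat \<Rightarrow> real"
    show "(\<Prod>i<m. ennreal (1 / (2 * pi)) * indicator {0..<2 * pi} (x i)) * indicator ?X x = ennreal (1 / (2 * pi)) ^ m * indicator ?X x"
    proof (cases "x \<in> ?X")
      case True
      then have "(\<Prod>i<m. ennreal (1 / (2 * pi)) * indicator {0..<2 * pi} (x i)) = (\<Prod>i<m. ennreal (1 / (2 * pi)))"
        using near_regular_range[of m s x] by (intro prod.cong) auto
      then show ?thesis by simp
    qed simp
  qed
  also have "\<dots> = ennreal (1 / (2 * pi)) ^ m * emeasure (PiM {..<m} (\<lambda>_. lborel)) ?X"
    using X by (rule nn_integral_cmult_indicator)
  finally show ?thesis .
qed

text \<open>Only coordinates below \<open>m\<close> are read, so angle sequences may be replaced by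
  points of the product space.\<close>

lemma near_regular_restrict: "near_regular m s (restrict \<theta> {..<m}) = near_regular m s \<theta>" if "0 < m"
proof -
  have "gap m (restrict \<theta> {..<m}) k = gap m \<theta> k" if "k < m" for k
    using that \<open>0 < m\<close> by (auto simp: gap_def)
  then show ?thesis using that by (simp add: near_regular_def)
qed

locale uniform_angles = prob_space M for M :: "'a measure" +
  fixes \<Theta> :: "nat \<Rightarrow> 'a \<Rightarrow> real"
  assumes indep: "indep_vars (\<lambda>_. borel) \<Theta> {1..}"
    and unif: "\<And>i. 1 \<le> i \<Longrightarrow> distr M borel (\<Theta> i) = angle_measure"
begin

lemma rv [measurable]: "1 \<le> i \<Longrightarrow> \<Theta> i \<in> borel_measurable M"
  using indep by (simp add: indep_vars_def)

lemma law:
  assumes "finite K" "K \<noteq> {}" "K \<subseteq> {1..}"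
  shows "distr M (PiM K (\<lambda>_. borel)) (\<lambda>\<omega>. restrict (\<lambda>i. \<Theta> i \<omega>) K) = PiM K (\<lambda>_. angle_measure)"
proof -
  have "distr M (PiM K (\<lambda>_. borel)) (\<lambda>\<omega>. restrict (\<lambda>i. \<Theta> i \<omega>) K) = PiM K (\<lambda>i. distr M borel (\<Theta> i))"
    using assms indep_vars_subset[OF indep assms(3)]
    by (subst indep_vars_iff_distr_eq_PiM'[symmetric]) (auto intro!: rv)
  also have "\<dots> = PiM K (\<lambda>_. angle_measure)"
    using assms by (intro PiM_cong) (auto intro!: unif)
  finally show ?thesis .
qed

lemma restrict_measurable:
  assumes "K \<subseteq> {1..}"
  shows "(\<lambda>\<omega>. restrict (\<lambda>i. \<Theta> i \<omega>) K) \<in> measurable M (PiM K (\<lambda>_. borel))"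
  using assms by (intro measurable_restrict rv) auto

definition near :: "nat \<Rightarrow> real \<Rightarrow> nat list \<Rightarrow> 'a set" where
  "near m s \<alpha> = {\<omega> \<in> space M. near_regular m s (\<lambda>k. \<Theta> (\<alpha> ! k) \<omega>)}"

lemma pred_near_regular_list:
  assumes "0 < m" "length \<alpha> = m" "set \<alpha> \<subseteq> K"
  shows "Measurable.pred (PiM K (\<lambda>_. borel)) (\<lambda>x. near_regular m s (\<lambda>k. x (\<alpha> ! k)))"
proof -
  have "(\<lambda>x. \<lambda>k\<in>{..<m}. x (\<alpha> ! k)) \<in> measurable (PiM K (\<lambda>_. borel)) (PiM {..<m} (\<lambda>_. borel :: real measure))"
    using assms by (intro measurable_restrict measurable_component_singleton) auto
  from measurable_compose[OF this pred_near_regular[OF assms(1), of s]]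
  show ?thesis by (simp only: near_regular_restrict[OF assms(1)])
qed

lemma near_vimage:
  assumes "0 < m" "length \<alpha> = m" "set \<alpha> \<subseteq> K"
  shows "near_regular m s (\<lambda>k. \<Theta> (\<alpha> ! k) \<omega>) \<longleftrightarrow> near_regular m s (\<lambda>k. restrict (\<lambda>i. \<Theta> i \<omega>) K (\<alpha> ! k))"
proof -
  have "restrict (\<lambda>k. \<Theta> (\<alpha> ! k) \<omega>) {..<m} = restrict (\<lambda>k. restrict (\<lambda>i. \<Theta> i \<omega>) K (\<alpha> ! k)) {..<m}"
    using assms by (intro restrict_ext) (metis lessThan_iff nth_mem restrict_apply subsetD)
  then show ?thesis using near_regular_restrict[OF assms(1)] by metis
qed

lemma near_events:
  assumes "0 < m" "\<alpha> \<in> index_lists m n"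
  shows "near m s \<alpha> \<in> events"
proof -
  have \<alpha>: "length \<alpha> = m" "set \<alpha> \<subseteq> {1..}" using assms by (auto simp: index_lists_def)
  have "Measurable.pred M (\<lambda>\<omega>. near_regular m s (\<lambda>k. restrict (\<lambda>i. \<Theta> i \<omega>) {1..} (\<alpha> ! k)))"
    by (rule measurable_compose[OF restrict_measurable pred_near_regular_list[OF assms(1) \<alpha>]]) simp
  then show ?thesis
    using near_vimage[OF assms(1) \<alpha>] by (simp add: near_def pred_def)
qed

text \<open>The indices in \<open>\<alpha>\<close> are distinct, so k \<mapsto> \<alpha> ! k carries
  the product law on \<open>set \<alpha>\<close> to the one on {..<m}. Hence all tuples have the
  same probability.\<close>

lemma prob_near:
  assumes "0 < m" "\<alpha> \<in> index_lists m n"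
  shows "prob (near m s \<alpha>) = (1 / (2 * pi)) ^ m *
    measure (PiM {..<m} (\<lambda>_. lborel)) {\<theta> \<in> space (PiM {..<m} (\<lambda>_. lborel)). near_regular m s \<theta>}"
proof -
  have \<alpha>: "length \<alpha> = m" "set \<alpha> \<subseteq> {1..}" "distinct \<alpha>" "set \<alpha> \<noteq> {}" using assms by (auto simp: index_lists_def)
  let ?K = "set \<alpha>" and ?Y = "{\<theta> \<in> space (PiM {..<m} (\<lambda>_. borel)). near_regular m s \<theta>}"
  have Y: "?Y \<in> sets (PiM {..<m} (\<lambda>_. borel))" using pred_near_regular[OF assms(1)] by (simp add: pred_def)
  have sets_eq: "sets (PiM {..<m} (\<lambda>_. angle_measure)) = sets (PiM {..<m} (\<lambda>_. borel))"
    and sets_eqK: "sets (PiM ?K (\<lambda>_. angle_measure)) = sets (PiM ?K (\<lambda>_. borel))" by (intro sets_PiM_cong; simp)+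
  let ?r = "\<lambda>x. \<lambda>k\<in>{..<m}. x (\<alpha> ! k)"
  have r: "?r \<in> measurable (PiM ?K (\<lambda>_. borel)) (PiM {..<m} (\<lambda>_. borel :: real measure))"
    using \<alpha> by (intro measurable_restrict measurable_component_singleton) auto
  have "near m s \<alpha> = (\<lambda>\<omega>. restrict (\<lambda>i. \<Theta> i \<omega>) ?K) -` (?r -` ?Y \<inter> space (PiM ?K (\<lambda>_. borel))) \<inter> space M"
    using near_vimage[OF assms(1) \<alpha>(1) order.refl] near_regular_restrict[OF assms(1)] \<alpha>
    by (auto simp: near_def space_PiM)
  then have "emeasure M (near m s \<alpha>) = emeasure (distr M (PiM ?K (\<lambda>_. borel)) (\<lambda>\<omega>. restrict (\<lambda>i. \<Theta> i \<omega>) ?K)) (?r -` ?Y \<inter> space (PiM ?K (\<lambda>_. borel)))"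
    using measurable_sets[OF r Y] restrict_measurable[OF \<alpha>(2)] by (simp add: emeasure_distr)
  also have "\<dots> = emeasure (PiM ?K (\<lambda>_. angle_measure)) (?r -` ?Y \<inter> space (PiM ?K (\<lambda>_. angle_measure)))"
    using law[of ?K] \<alpha> by (simp add: space_PiM)
  also have "\<dots> = emeasure (distr (PiM ?K (\<lambda>_. angle_measure)) (PiM {..<m} (\<lambda>_. angle_measure)) ?r) ?Y"
    using r Y by (subst emeasure_distr) (auto simp: sets_eq measurable_cong_sets[OF sets_eqK sets_eq])
  also have "distr (PiM ?K (\<lambda>_. angle_measure)) (PiM {..<m} (\<lambda>_. angle_measure)) ?r = PiM {..<m} (\<lambda>_. angle_measure)"
    using distr_PiM_reindex[of ?K "\<lambda>_. angle_measure" "\<lambda>k. \<alpha> ! k" "{..<m}"] \<alpha> prob_space_angle_measure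
    by (auto simp: inj_on_nth)
  finally have "emeasure M (near m s \<alpha>) = ennreal (1 / (2 * pi)) ^ m * emeasure (PiM {..<m} (\<lambda>_. lborel)) {\<theta> \<in> space (PiM {..<m} (\<lambda>_. lborel)). near_regular m s \<theta>}"
    unfolding emeasure_near_regular[OF assms(1)] .
  then show ?thesis
    by (simp add: measure_def enn2real_mult ennreal_power)
qed

end

section \<open>Joint behaviour of overlapping and of disjoint tuples\<close>

text \<open>The deviations of at most \<open>m\<close> gaps are added up from
  \<open>\<theta> 0\<close>, and two positions are compared through it; this gives the factor 2m and
  allows either order of \<open>i\<close> and \<open>j\<close>.\<close>

lemma near_regular_close:
  fixes m :: nat
  assumes m: "3 \<le> m"
  obtains C s\<^sub>0 where "0 < C" "0 < s\<^sub>0"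
    "\<And>s \<theta> i j. 0 < s \<Longrightarrow> s \<le> s\<^sub>0 \<Longrightarrow> near_regular m s \<theta> \<Longrightarrow> i < m \<Longrightarrow> j < m \<Longrightarrow>
      \<bar>\<theta> j - \<theta> i - (real j - real i) * (2 * pi / real m)\<bar> \<le> C * sqrt s"
proof -
  define a where "a = 2 * pi / real m"
  have a: "0 < a" "a < pi" "real m * a = 2 * pi" "pi / real m = a / 2"
    using m by (auto simp: a_def field_simps)
  obtain N where N: "m = Suc N" using m by (cases m) auto
  show ?thesis
  proof (rule tangent_sum_sandwich[OF a(1,2)])
    fix B C s0 :: real
    assume C: "0 < C" "0 < s0"
      and up: "\<And>g n s. 0 < s \<Longrightarrow> s \<le> s0 \<Longrightarrow> (\<Sum>k<n. g k) = real n * a \<Longrightarrow> (\<And>k. k < n \<Longrightarrow> 0 < g k \<and> g k < pi)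
        \<Longrightarrow> (\<Sum>k<n. 2 * tan (g k / 2)) \<le> 2 * real n * tan (a / 2) + s
        \<Longrightarrow> (\<forall>k<n. \<bar>g k - a\<bar> \<le> C * sqrt s) \<and> (excess'' a - B * sqrt s) / 2 * (\<Sum>k<n. (g k - a)\<^sup>2) \<le> s"
    show ?thesis
    proof (rule that[of "2 * real m * C" s0])
      show "0 < 2 * real m * C" "0 < s0" using C m by auto
      fix s \<theta> i j
      assume s: "0 < s" "s \<le> s0" and nr: "near_regular m s \<theta>" and ij: "i < m" "j < m"
      have sum: "(\<Sum>k<m. gap m \<theta> k) = real m * a" using sum_gap[of N \<theta>] a(3) N by simp
      have g: "\<bar>gap m \<theta> k - a\<bar> \<le> C * sqrt s" if "k < m" for k
        using up[OF s sum] nr that a(4) by (auto simp: near_regular_def)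
      have dev: "\<bar>\<theta> k - \<theta> 0 - real k * a\<bar> \<le> real k * (C * sqrt s)" if "k < m" for k
        using that
      proof (induction k)
        case (Suc k)
        then have "\<bar>\<theta> (Suc k) - \<theta> k - a\<bar> \<le> C * sqrt s" using g[of k] by (auto simp: gap_def)
        moreover have "\<bar>\<theta> k - \<theta> 0 - real k * a\<bar> \<le> real k * (C * sqrt s)" using Suc by auto
        ultimately show ?case by (simp add: distrib_right)
      qed simp
      have le: "real k * (C * sqrt s) \<le> real m * (C * sqrt s)" if "k < m" for k
        using that C s by (intro mult_right_mono) auto
      have "\<bar>\<theta> j - \<theta> i - (real j * a - real i * a)\<bar> \<le> real m * (C * sqrt s) + real m * (C * sqrt s)"
        using dev[OF ij(1)] dev[OF ij(2)] le[OF ij(1)] le[OF ij(2)] by linarith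
      then show "\<bar>\<theta> j - \<theta> i - (real j - real i) * (2 * pi / real m)\<bar> \<le> 2 * real m * C * sqrt s"
        unfolding a_def[symmetric] by (simp add: algebra_simps)
    qed
  qed
qed

lemma finite_index_lists [simp]: "finite (index_lists m n)"
  by (rule finite_subset[OF _ finite_lists_length_eq[of "{1..n}" m]]) (auto simp: index_lists_def)

text \<open>The product form makes the power of a random count measurable factor by factor.\<close>

lemma power_card_filter:
  fixes y :: real
  assumes "finite S"
  shows "y ^ card {\<beta> \<in> S. Q \<beta>} = (\<Prod>\<beta>\<in>S. if Q \<beta> then y else 1)"
  using assms by (simp flip: prod.inter_filter)

context uniform_angles
begin

text \<open>Near-regularity sorts a tuple by angle, and a set has only one sorted listing. This
  disposes of pairs of distinct tuples with the same index set.\<close>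

lemma near_unique:
  assumes "\<alpha> \<in> index_lists m n" "\<beta> \<in> index_lists m n" "set \<alpha> = set \<beta>" "\<omega> \<in> near m s \<alpha>" "\<omega> \<in> near m s \<beta>"
  shows "\<alpha> = \<beta>"
proof -
  have *: "sorted_wrt (<) (map (\<lambda>i. \<Theta> i \<omega>) \<gamma>)" if "\<gamma> \<in> index_lists m n" "\<omega> \<in> near m s \<gamma>" for \<gamma>
    using near_regular_mono[of m s "\<lambda>k. \<Theta> (\<gamma> ! k) \<omega>"] that
    by (auto simp: sorted_wrt_iff_nth_less near_def index_lists_def)
  from *[OF assms(1,4)] *[OF assms(2,5)]
  show ?thesis
    using assms(3) by (intro map_sorted_distinct_set_unique[of "\<lambda>i. \<Theta> i \<omega>"]) (auto simp: strict_sorted_iff distinct_map)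
qed

text \<open>Condition on the angle of the centre \<open>i0\<close>: the remaining
  \<open>card K - 1\<close> angles are independent, and each falls into a set of length at most
  \<open>c\<close> with probability at most c / (2 pi).\<close>

lemma prob_star_le:
  assumes K: "finite K" "K \<subseteq> {1..}" "i0 \<in> K"
    and N: "Measurable.pred (borel \<Otimes>\<^sub>M borel) (\<lambda>(x, y). y \<in> N x)"
    and c: "0 \<le> c" "\<And>x. emeasure lborel (N x) \<le> ennreal c"
  shows "{\<omega> \<in> space M. \<forall>i\<in>K - {i0}. \<Theta> i \<omega> \<in> N (\<Theta> i0 \<omega>)} \<in> events" (is "?E \<in> _")
    and "prob {\<omega> \<in> space M. \<forall>i\<in>K - {i0}. \<Theta> i \<omega> \<in> N (\<Theta> i0 \<omega>)} \<le> (c / (2 * pi)) ^ (card K - 1)"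
proof -
  interpret A: product_sigma_finite "\<lambda>_. angle_measure"
    by (intro product_sigma_finite.intro prob_space_imp_sigma_finite prob_space_angle_measure)
  define J where "J = K - {i0}"
  have J: "finite J" "i0 \<notin> J" "K = insert i0 J" "card J = card K - 1" using K by (auto simp: J_def)
  let ?B = "{f \<in> space (PiM K (\<lambda>_. borel)). \<forall>i\<in>J. f i \<in> N (f i0)}"
  have B: "?B \<in> sets (PiM K (\<lambda>_. borel))"
  proof -
    have "Measurable.pred (PiM K (\<lambda>_. borel)) (\<lambda>f. \<forall>i\<in>J. f i \<in> N (f i0))"
    proof (intro pred_intros_finite J(1))
      fix i assume "i \<in> J"
      then have "(\<lambda>f. (f i0, f i)) \<in> measurable (PiM K (\<lambda>_. borel :: real measure)) (borel \<Otimes>\<^sub>M borel)"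
        using J(3) by (intro measurable_Pair measurable_component_singleton) auto
      from measurable_compose[OF this N] show "Measurable.pred (PiM K (\<lambda>_. borel)) (\<lambda>f. f i \<in> N (f i0))" by simp
    qed
    then show ?thesis by (simp add: pred_def)
  qed
  have sets_eq: "sets (PiM K (\<lambda>_. angle_measure)) = sets (PiM K (\<lambda>_. borel))" by (intro sets_PiM_cong; simp)
  have E: "?E = (\<lambda>\<omega>. restrict (\<lambda>i. \<Theta> i \<omega>) K) -` ?B \<inter> space M"
    using J(3) by (auto simp: space_PiM J_def)
  show "?E \<in> events"
    unfolding E using measurable_sets[OF restrict_measurable[OF K(2)] B] .
  have N_sets: "N y \<in> sets borel" for y
  proof -
    have "Measurable.pred borel (\<lambda>z. z \<in> N y)"
      using measurable_compose[OF measurable_Pair1'[of y borel borel] N] by simp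
    then show ?thesis by (simp add: pred_def)
  qed
  have Ny: "emeasure angle_measure (N y) \<le> ennreal (c / (2 * pi))" for y
  proof -
    have "emeasure angle_measure (N y) = ennreal (1 / (2 * pi)) * emeasure lborel (N y \<inter> {0..<2 * pi})"
      by (rule emeasure_angle_measure[OF N_sets])
    also have "\<dots> \<le> ennreal (1 / (2 * pi)) * ennreal c"
      using N_sets by (intro mult_left_mono order.trans[OF emeasure_mono c(2)]) auto
    also have "\<dots> = ennreal (c / (2 * pi))" using c(1) by (simp add: ennreal_mult[symmetric])
    finally show ?thesis .
  qed
  have "emeasure M ?E = emeasure (distr M (PiM K (\<lambda>_. borel)) (\<lambda>\<omega>. restrict (\<lambda>i. \<Theta> i \<omega>) K)) ?B"
    unfolding E by (rule emeasure_distr[symmetric, OF restrict_measurable[OF K(2)] B])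
  also have "\<dots> = emeasure (PiM K (\<lambda>_. angle_measure)) ?B"
    using K by (subst law) auto
  also have "\<dots> = (\<integral>\<^sup>+f. indicator ?B f \<partial>PiM (insert i0 J) (\<lambda>_. angle_measure))"
    using B unfolding J(3)[symmetric] by (intro nn_integral_indicator[symmetric]) (simp add: sets_eq)
  also have "\<dots> = (\<integral>\<^sup>+y. \<integral>\<^sup>+x. indicator ?B (x(i0 := y)) \<partial>PiM J (\<lambda>_. angle_measure) \<partial>angle_measure)"
  proof (rule A.product_nn_integral_insert_rev[OF J(1,2)])
    show "indicator ?B \<in> borel_measurable (PiM (insert i0 J) (\<lambda>_. angle_measure))"
      using B unfolding J(3)[symmetric] by (intro borel_measurable_indicator) (simp add: sets_eq)
  qed
  also have "\<dots> \<le> (\<integral>\<^sup>+y. ennreal (c / (2 * pi)) ^ card J \<partial>angle_measure)"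
  proof (rule nn_integral_mono)
    fix y :: real
    have PE: "PiE J (\<lambda>_. N y) \<in> sets (PiM J (\<lambda>_. angle_measure))"
      using J N_sets by (intro sets_PiM_I_finite) auto
    have "(\<integral>\<^sup>+x. indicator ?B (x(i0 := y)) \<partial>PiM J (\<lambda>_. angle_measure))
        = (\<integral>\<^sup>+x. indicator (PiE J (\<lambda>_. N y)) x \<partial>PiM J (\<lambda>_. angle_measure))"
    proof (rule nn_integral_cong)
      fix x assume "x \<in> space (PiM J (\<lambda>_. angle_measure))"
      then have ext: "x \<in> extensional J" by (simp add: space_PiM PiE_def)
      then have "x(i0 := y) \<in> space (PiM K (\<lambda>_. borel :: real measure))"
        using J(3) by (auto simp: space_PiM PiE_def extensional_def)
      moreover have "(\<forall>i\<in>J. (x(i0 := y)) i \<in> N ((x(i0 := y)) i0)) \<longleftrightarrow> (\<forall>i\<in>J. x i \<in> N y)"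
        using J(2) by auto
      moreover have "x \<in> PiE J (\<lambda>_. N y) \<longleftrightarrow> (\<forall>i\<in>J. x i \<in> N y)"
        using ext by (auto simp: PiE_def)
      ultimately show "indicator ?B (x(i0 := y)) = (indicator (PiE J (\<lambda>_. N y)) x :: ennreal)"
        by (simp only: indicator_def mem_Collect_eq simp_thms)
    qed
    also have "\<dots> = emeasure (PiM J (\<lambda>_. angle_measure)) (PiE J (\<lambda>_. N y))" using PE by simp
    also have "\<dots> = (\<Prod>i\<in>J. emeasure angle_measure (N y))"
      using J N_sets by (intro A.emeasure_PiM) auto
    also have "\<dots> \<le> ennreal (c / (2 * pi)) ^ card J"
      using Ny by (simp add: power_mono)
    finally show "(\<integral>\<^sup>+x. indicator ?B (x(i0 := y)) \<partial>PiM J (\<lambda>_. angle_measure)) \<le> ennreal (c / (2 * pi)) ^ card J" .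
  qed
  also have "\<dots> = ennreal ((c / (2 * pi)) ^ card J)"
    using prob_space.emeasure_space_1[OF prob_space_angle_measure] c by (simp add: ennreal_power)
  finally show "prob ?E \<le> (c / (2 * pi)) ^ (card K - 1)"
    using c J(4) by (simp add: emeasure_eq_measure)
qed

lemma prob_near_inter_le:
  assumes m: "3 \<le> m"
  obtains D s\<^sub>0 where "0 < D" "0 < s\<^sub>0"
    "\<And>s \<alpha> \<beta> n. 0 < s \<Longrightarrow> s \<le> s\<^sub>0 \<Longrightarrow> \<alpha> \<in> index_lists m n \<Longrightarrow> \<beta> \<in> index_lists m n \<Longrightarrow> set \<alpha> \<inter> set \<beta> \<noteq> {} \<Longrightarrow>
      prob (near m s \<alpha> \<inter> near m s \<beta>) \<le> (D * sqrt s) ^ (card (set \<alpha> \<union> set \<beta>) - 1)"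
proof (rule near_regular_close[OF m])
  fix C s0 :: real
  assume C: "0 < C" "0 < s0" and close: "\<And>s \<theta> i j. 0 < s \<Longrightarrow> s \<le> s0 \<Longrightarrow> near_regular m s \<theta> \<Longrightarrow> i < m \<Longrightarrow> j < m \<Longrightarrow>
      \<bar>\<theta> j - \<theta> i - (real j - real i) * (2 * pi / real m)\<bar> \<le> C * sqrt s"
  define a where "a = 2 * pi / real m"
  \<comment> \<open>There are 2m + 1 multiples of \<open>a\<close> to consider, each surrounded by
    an interval of length 2 * C * sqrt s; division by 2 pi turns length into probability.\<close>
  define D where "D = (2 * real m + 1) * (2 * C) / (2 * pi)"
  show ?thesis
  proof (rule that[of D s0])
    show "0 < D" "0 < s0" using C by (auto simp: D_def)
    fix s \<alpha> \<beta> n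
    assume s: "0 < s" "s \<le> s0" and \<alpha>: "\<alpha> \<in> index_lists m n" and \<beta>: "\<beta> \<in> index_lists m n" and "set \<alpha> \<inter> set \<beta> \<noteq> {}"
    then obtain i0 where i0: "i0 \<in> set \<alpha>" "i0 \<in> set \<beta>" by blast
    define \<delta> where "\<delta> = C * sqrt s"
    have \<delta>: "0 < \<delta>" using C s by (simp add: \<delta>_def)
    \<comment> \<open>\<open>d\<close> is the difference of two positions in a tuple. It may have
      either sign, and the range serves both tuples although \<open>i0\<close> may occupy different
      positions in them.\<close>
    define N where "N = (\<lambda>x::real. {y. \<exists>d\<in>{- int m..int m}. \<bar>y - x - of_int d * a\<bar> \<le> \<delta>})"
    let ?K = "set \<alpha> \<union> set \<beta>"
    let ?E = "{\<omega> \<in> space M. \<forall>i\<in>?K - {i0}. \<Theta> i \<omega> \<in> N (\<Theta> i0 \<omega>)}"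
    have in_N: "\<Theta> i \<omega> \<in> N (\<Theta> i0 \<omega>)" if *: "\<omega> \<in> near m s \<gamma>" "\<gamma> \<in> index_lists m n" "i \<in> set \<gamma>" "i0 \<in> set \<gamma>" for i \<gamma> \<omega>
    proof -
      have len: "length \<gamma> = m" using *(2) by (simp add: index_lists_def)
      obtain p where p: "p < m" "\<gamma> ! p = i" using *(3) len by (auto simp: in_set_conv_nth)
      obtain q where q: "q < m" "\<gamma> ! q = i0" using *(4) len by (auto simp: in_set_conv_nth)
      have "\<bar>\<Theta> i \<omega> - \<Theta> i0 \<omega> - (real p - real q) * a\<bar> \<le> \<delta>"
        using close[OF s _ q(1) p(1), of "\<lambda>k. \<Theta> (\<gamma> ! k) \<omega>"] *(1) p q by (simp add: near_def a_def \<delta>_def)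
      then show ?thesis
        using p q unfolding N_def by (intro CollectI bexI[of _ "int p - int q"]) auto
    qed
    have sub: "near m s \<alpha> \<inter> near m s \<beta> \<subseteq> ?E"
      using in_N \<alpha> \<beta> i0 by (auto simp: near_def)
    have K: "finite ?K" "?K \<subseteq> {1..}" "i0 \<in> ?K" using \<alpha> \<beta> i0 by (auto simp: index_lists_def)
    have pred: "Measurable.pred (borel \<Otimes>\<^sub>M borel) (\<lambda>(x, y). y \<in> N x)"
      unfolding N_def by measurable
    have N_eq: "N x = (\<Union>d\<in>{- int m..int m}. {x + of_int d * a - \<delta>..x + of_int d * a + \<delta>})" for x
    proof -
      have "\<bar>y - x - of_int d * a\<bar> \<le> \<delta> \<longleftrightarrow> y \<in> {x + of_int d * a - \<delta>..x + of_int d * a + \<delta>}" for y d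
        by (auto simp: abs_le_iff)
      then show ?thesis unfolding N_def by (simp only: UN_iff set_eq_iff mem_Collect_eq) simp
    qed
    have N_le: "emeasure lborel (N x) \<le> ennreal ((2 * real m + 1) * (2 * \<delta>))" for x
    proof -
      have "emeasure lborel (N x) \<le> (\<Sum>d\<in>{- int m..int m}. emeasure lborel {x + of_int d * a - \<delta>..x + of_int d * a + \<delta>})"
        unfolding N_eq by (intro emeasure_subadditive_finite) auto
      also have "\<dots> = (\<Sum>d\<in>{- int m..int m}. ennreal (2 * \<delta>))"
        using \<delta> by (intro sum.cong) auto
      also have "\<dots> = ennreal ((2 * real m + 1) * (2 * \<delta>))"
        using \<delta> by (simp add: ennreal_mult ennreal_of_nat_eq_real_of_nat nat_add_distrib add.commute)
      finally show ?thesis .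
    qed
    have c: "0 \<le> (2 * real m + 1) * (2 * \<delta>)" using \<delta> by simp
    note star = prob_star_le[OF K pred c N_le]
    have "prob (near m s \<alpha> \<inter> near m s \<beta>) \<le> prob ?E"
      by (rule finite_measure_mono[OF sub star(1)])
    also have "\<dots> \<le> ((2 * real m + 1) * (2 * \<delta>) / (2 * pi)) ^ (card ?K - 1)"
      by (rule star(2))
    also have "(2 * real m + 1) * (2 * \<delta>) / (2 * pi) = D * sqrt s"
      by (simp add: D_def \<delta>_def)
    finally show "prob (near m s \<alpha> \<inter> near m s \<beta>) \<le> (D * sqrt s) ^ (card ?K - 1)" .
  qed
qed

text \<open>The event reads only the angles indexed by \<open>set \<alpha>\<close>, the count only
  those in the complementary block, and disjoint blocks of independent variables are
  independent.\<close>

lemma near_independent: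
  assumes m: "0 < m" and \<alpha>: "\<alpha> \<in> index_lists m n" and y: "0 \<le> y" "y \<le> 1"
  defines "S \<equiv> {\<beta> \<in> index_lists m n. set \<alpha> \<inter> set \<beta> = {}}"
  shows "expectation (\<lambda>\<omega>. indicator (near m s \<alpha>) \<omega> * y ^ card {\<beta> \<in> S. \<omega> \<in> near m s \<beta>})
    = prob (near m s \<alpha>) * expectation (\<lambda>\<omega>. y ^ card {\<beta> \<in> S. \<omega> \<in> near m s \<beta>})"
proof -
  define J where "J = {1..n} - set \<alpha>"
  have len: "length \<alpha> = m" using \<alpha> by (simp add: index_lists_def)
  have S: "length \<beta> = m" "set \<beta> \<subseteq> J" if "\<beta> \<in> S" for \<beta>
    using that by (auto simp: S_def J_def index_lists_def)
  have finS: "finite S" by (simp add: S_def)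
  have "indep_var (PiM (set \<alpha>) (\<lambda>_. borel)) (\<lambda>\<omega>. restrict (\<lambda>i. \<Theta> i \<omega>) (set \<alpha>))
      (PiM J (\<lambda>_. borel)) (\<lambda>\<omega>. restrict (\<lambda>i. \<Theta> i \<omega>) J)"
    using \<alpha> by (intro indep_var_restrict[OF indep]) (auto simp: J_def index_lists_def)
  define Y1 where "Y1 = (\<lambda>x. if near_regular m s (\<lambda>k. x (\<alpha> ! k)) then 1 else 0 :: real)"
  define Y2 where "Y2 = (\<lambda>x. \<Prod>\<beta>\<in>S. if near_regular m s (\<lambda>k. x (\<beta> ! k)) then y else 1)"
  define X1 where "X1 = (\<lambda>\<omega>. Y1 (restrict (\<lambda>i. \<Theta> i \<omega>) (set \<alpha>)))"
  define X2 where "X2 = (\<lambda>\<omega>. Y2 (restrict (\<lambda>i. \<Theta> i \<omega>) J))"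
  have Y1: "Y1 \<in> borel_measurable (PiM (set \<alpha>) (\<lambda>_. borel))"
    unfolding Y1_def using pred_near_regular_list[OF m len order.refl] by measurable
  have Y2: "Y2 \<in> borel_measurable (PiM J (\<lambda>_. borel))"
    unfolding Y2_def
  proof (rule borel_measurable_prod)
    fix \<beta> assume "\<beta> \<in> S"
    note [measurable] = pred_near_regular_list[OF m S(1)[OF this] S(2)[OF this], of s]
    show "(\<lambda>x. if near_regular m s (\<lambda>k. x (\<beta> ! k)) then y else 1) \<in> borel_measurable (PiM J (\<lambda>_. borel))"
      by measurable
  qed
  have ind: "indep_var borel X1 borel X2"
    using indep_var_compose[OF \<open>indep_var _ _ _ _\<close> Y1 Y2] by (simp add: X1_def X2_def comp_def)
  have X1: "X1 \<omega> = indicator (near m s \<alpha>) \<omega>" if "\<omega> \<in> space M" for \<omega>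
    using near_vimage[OF m len order.refl, of s \<omega>] that by (simp add: X1_def Y1_def near_def indicator_def)
  have X2: "X2 \<omega> = y ^ card {\<beta> \<in> S. \<omega> \<in> near m s \<beta>}" if "\<omega> \<in> space M" for \<omega>
    unfolding X2_def Y2_def power_card_filter[OF finS]
    using near_vimage[OF m S(1,2), of _ s \<omega>] that by (intro prod.cong) (auto simp: near_def)
  have rv: "random_variable borel X1" "random_variable borel X2"
    using ind by (auto simp: indep_var_def indep_vars_def split: bool.splits)
  have int: "integrable M X1" "integrable M X2"
  proof -
    show "integrable M X1"
      by (rule integrable_const_bound[where B = 1]) (use X1 rv in \<open>auto simp: indicator_def intro!: AE_I2\<close>)
    show "integrable M X2"
      by (rule integrable_const_bound[where B = 1]) (use X2 rv y in \<open>auto simp: power_le_one intro!: AE_I2\<close>)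
  qed
  have "expectation (\<lambda>\<omega>. indicator (near m s \<alpha>) \<omega> * y ^ card {\<beta> \<in> S. \<omega> \<in> near m s \<beta>}) = expectation (\<lambda>\<omega>. X1 \<omega> * X2 \<omega>)"
    using X1 X2 by (intro Bochner_Integration.integral_cong) auto
  also have "\<dots> = expectation X1 * expectation X2"
    by (rule indep_var_lebesgue_integral[OF ind int])
  also have "expectation X1 = expectation (indicator (near m s \<alpha>))"
    using X1 by (intro Bochner_Integration.integral_cong) auto
  also have "\<dots> = prob (near m s \<alpha>)"
    using near_events[OF m \<alpha>] by simp
  also have "expectation X2 = expectation (\<lambda>\<omega>. y ^ card {\<beta> \<in> S. \<omega> \<in> near m s \<beta>})"
    using X2 by (intro Bochner_Integration.integral_cong) auto
  finally show ?thesis .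
qed

end

section \<open>Counting pairs of tuples\<close>

text \<open>Choose the union first, in at most n ^ k ways, then two lists of length \<open>m\<close>
  with entries in it.\<close>

lemma card_pairs_union_le:
  "card {(\<alpha>, \<beta>). \<alpha> \<in> index_lists m n \<and> \<beta> \<in> index_lists m n \<and> card (set \<alpha> \<union> set \<beta>) = k} \<le> n ^ k * k ^ (2 * m)"
    (is "card ?P \<le> _")
proof -
  let ?\<T> = "{T. T \<subseteq> {1..n} \<and> card T = k}" and ?L = "\<lambda>T. {xs. set xs \<subseteq> T \<and> length xs = m}"
  have fin: "finite ?\<T>" by (rule finite_subset[of _ "Pow {1..n}"]) auto
  have finL: "finite (?L T)" if "T \<in> ?\<T>" for T
    using that by (intro finite_lists_length_eq) (auto intro: finite_subset)
  have "?P \<subseteq> (\<Union>T\<in>?\<T>. ?L T \<times> ?L T)"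
  proof clarify
    fix \<alpha> \<beta> assume "\<alpha> \<in> index_lists m n" "\<beta> \<in> index_lists m n" "k = card (set \<alpha> \<union> set \<beta>)"
    then show "(\<alpha>, \<beta>) \<in> (\<Union>T\<in>{T. T \<subseteq> {1..n} \<and> card T = card (set \<alpha> \<union> set \<beta>)}. ?L T \<times> ?L T)"
      by (intro UN_I[of "set \<alpha> \<union> set \<beta>"]) (auto simp: index_lists_def)
  qed
  then have "card ?P \<le> card (\<Union>T\<in>?\<T>. ?L T \<times> ?L T)"
    by (intro card_mono finite_UN_I finite_cartesian_product fin finL)
  also have "\<dots> \<le> (\<Sum>T\<in>?\<T>. card (?L T \<times> ?L T))" by (rule card_UN_le[OF fin])
  also have "\<dots> = (\<Sum>T\<in>?\<T>. k ^ (2 * m))"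
  proof (rule sum.cong[OF refl])
    fix T assume T: "T \<in> ?\<T>"
    then have "finite T" by (auto intro: finite_subset)
    then show "card (?L T \<times> ?L T) = k ^ (2 * m)"
      using T by (simp add: card_cartesian_product card_lists_length_eq mult_2 power_add)
  qed
  also have "\<dots> = (n choose k) * k ^ (2 * m)"
    using n_subsets[of "{1..n}" k] by simp
  also have "\<dots> \<le> n ^ k * k ^ (2 * m)"
    by (cases "k \<le> n") (auto intro!: mult_right_mono binomial_le_pow simp: binomial_eq_0)
  finally show ?thesis .
qed

text \<open>Pairs are grouped by the size of their union, which is at most 2m - 1 because at least
  one index is shared. The factor (2m) ^ (2m) bounds the arrangements for all group sizes at
  once.\<close>

lemma sum_intersecting_le:
  fixes f :: "nat list \<Rightarrow> nat list \<Rightarrow> real" and c :: "nat \<Rightarrow> real"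
  assumes m: "0 < m" and c: "\<And>k. 0 \<le> c k"
    and f: "\<And>\<alpha> \<beta>. \<alpha> \<in> index_lists m n \<Longrightarrow> \<beta> \<in> index_lists m n \<Longrightarrow> set \<alpha> \<inter> set \<beta> \<noteq> {} \<Longrightarrow> f \<alpha> \<beta> \<le> c (card (set \<alpha> \<union> set \<beta>))"
  shows "(\<Sum>\<alpha>\<in>index_lists m n. \<Sum>\<beta>\<in>index_lists m n \<inter> {\<beta>. set \<alpha> \<inter> set \<beta> \<noteq> {}}. f \<alpha> \<beta>)
    \<le> (\<Sum>k\<in>{m..2 * m - 1}. real n ^ k * real (2 * m) ^ (2 * m) * c k)"
proof -
  let ?A = "index_lists m n"
  let ?B = "\<lambda>\<alpha>. ?A \<inter> {\<beta>. set \<alpha> \<inter> set \<beta> \<noteq> {}}"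
  let ?Q = "Sigma ?A ?B" and ?u = "\<lambda>(\<alpha>, \<beta>). card (set \<alpha> \<union> set \<beta> :: nat set)"
  have card_set: "card (set \<alpha>) = m" "finite (set \<alpha>)" if "\<alpha> \<in> ?A" for \<alpha>
    using that distinct_card by (auto simp: index_lists_def)
  have range: "?u ` ?Q \<subseteq> {m..2 * m - 1}"
  proof (clarsimp, intro conjI)
    fix \<alpha> \<beta> assume \<alpha>: "\<alpha> \<in> ?A" and \<beta>: "\<beta> \<in> ?A" and int: "set \<alpha> \<inter> set \<beta> \<noteq> {}"
    show "m \<le> card (set \<alpha> \<union> set \<beta>)"
      using card_mono[of "set \<alpha> \<union> set \<beta>" "set \<alpha>"] card_set[OF \<alpha>] by auto
    have "0 < card (set \<alpha> \<inter> set \<beta>)" using int by (simp add: card_gt_0_iff)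
    then show "card (set \<alpha> \<union> set \<beta>) \<le> 2 * m - Suc 0"
      using card_Un_Int[of "set \<alpha>" "set \<beta>"] card_set[OF \<alpha>] card_set[OF \<beta>] by linarith
  qed
  have "(\<Sum>\<alpha>\<in>?A. \<Sum>\<beta>\<in>?B \<alpha>. f \<alpha> \<beta>) = (\<Sum>p\<in>?Q. case p of (\<alpha>, \<beta>) \<Rightarrow> f \<alpha> \<beta>)"
    by (subst sum.Sigma) auto
  also have "\<dots> = (\<Sum>k\<in>{m..2 * m - 1}. \<Sum>p\<in>{p \<in> ?Q. ?u p = k}. case p of (\<alpha>, \<beta>) \<Rightarrow> f \<alpha> \<beta>)"
    using range by (intro sum.group[symmetric]) auto
  also have "\<dots> \<le> (\<Sum>k\<in>{m..2 * m - 1}. real n ^ k * real (2 * m) ^ (2 * m) * c k)"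
  proof (rule sum_mono)
    fix k assume k: "k \<in> {m..2 * m - 1}"
    have sub: "{p \<in> ?Q. ?u p = k} \<subseteq> {(\<alpha>, \<beta>). \<alpha> \<in> ?A \<and> \<beta> \<in> ?A \<and> card (set \<alpha> \<union> set \<beta>) = k}" by auto
    have fin: "finite {(\<alpha>, \<beta>). \<alpha> \<in> ?A \<and> \<beta> \<in> ?A \<and> card (set \<alpha> \<union> set \<beta>) = k}"
      by (rule finite_subset[of _ "?A \<times> ?A"]) auto
    have "(\<Sum>p\<in>{p \<in> ?Q. ?u p = k}. case p of (\<alpha>, \<beta>) \<Rightarrow> f \<alpha> \<beta>) \<le> (\<Sum>p\<in>{p \<in> ?Q. ?u p = k}. c k)"
      using f by (intro sum_mono) auto
    also have "\<dots> = real (card {p \<in> ?Q. ?u p = k}) * c k" by simp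
    also have "\<dots> \<le> (real n ^ k * real (2 * m) ^ (2 * m)) * c k"
    proof (intro mult_right_mono c)
      have "card {p \<in> ?Q. ?u p = k} \<le> n ^ k * k ^ (2 * m)"
        using card_mono[OF fin sub] card_pairs_union_le[of m n k] by linarith
      also have "\<dots> \<le> n ^ k * (2 * m) ^ (2 * m)"
        using k by (intro mult_left_mono power_mono) auto
      finally have "real (card {p \<in> ?Q. ?u p = k}) \<le> real (n ^ k * (2 * m) ^ (2 * m))" by (rule of_nat_mono)
      then show "real (card {p \<in> ?Q. ?u p = k}) \<le> real n ^ k * real (2 * m) ^ (2 * m)" by simp
    qed
    finally show "(\<Sum>p\<in>{p \<in> ?Q. ?u p = k}. case p of (\<alpha>, \<beta>) \<Rightarrow> f \<alpha> \<beta>) \<le> real n ^ k * real (2 * m) ^ (2 * m) * c k" .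
  qed
  finally show ?thesis .
qed

text \<open>The falling factorial lies between (n - m) ^ m and n ^ m, and Bernoulli's inequality
  bounds the relative difference by m^2 / n.\<close>

lemma card_index_lists_bounds:
  assumes "m \<le> n" "0 < n"
  shows "real (card (index_lists m n)) \<le> real n ^ m"
    and "real n ^ m - real m ^ 2 * real n ^ m / real n \<le> real (card (index_lists m n))"
proof -
  have eq: "index_lists m n = {xs. length xs = m \<and> distinct xs \<and> set xs \<subseteq> {1..n}}"
    unfolding index_lists_def by (rule Collect_cong) blast
  have card: "card (index_lists m n) = \<Prod>{n - m + 1..n}"
    unfolding eq using card_lists_distinct_length_eq[of "{1..n}" m] assms(1) by simp
  have "\<Prod>{n - m + 1..n} \<le> (\<Prod>i\<in>{n - m + 1..n}. n)"
    by (rule prod_mono) auto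
  also have "\<dots> = n ^ m" using assms by simp
  finally have "card (index_lists m n) \<le> n ^ m" unfolding card .
  then show "real (card (index_lists m n)) \<le> real n ^ m"
    using of_nat_mono[of "card (index_lists m n)" "n ^ m", where 'a = real] by simp
  have "(n - m) ^ m = (\<Prod>i\<in>{n - m + 1..n}. n - m)" using assms by simp
  also have "\<dots> \<le> \<Prod>{n - m + 1..n}"
    by (rule prod_mono) auto
  finally have "real ((n - m) ^ m) \<le> real (card (index_lists m n))" unfolding card by (rule of_nat_mono)
  moreover have "real n ^ m - real m ^ 2 * real n ^ m / real n \<le> real ((n - m) ^ m)"
  proof -
    have "1 + real m * (- (real m / real n)) \<le> (1 + - (real m / real n)) ^ m"
      using assms by (intro Bernoulli_inequality) (auto simp: field_simps)
    then have "real n ^ m * (1 + real m * (- (real m / real n))) \<le> real n ^ m * (1 + - (real m / real n)) ^ m"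
      by (intro mult_left_mono) auto
    also have "\<dots> = (real n * (1 + - (real m / real n))) ^ m" by (simp only: power_mult_distrib)
    also have "real n * (1 + - (real m / real n)) = real (n - m)"
      using assms by (simp add: algebra_simps of_nat_diff)
    finally show ?thesis by (simp add: algebra_simps power2_eq_square)
  qed
  ultimately show "real n ^ m - real m ^ 2 * real n ^ m / real n \<le> real (card (index_lists m n))" by linarith
qed

text \<open>Identifies the limit of the expected count. The power 3/2 of \<open>m\<close> in
  \<open>K3\<close> arises from 1 / m in \<open>a\<close> and 1 / sqrt m from the pivots; the Gamma
  factor comes from the volume of the unit ball in dimension m - 1.\<close>

lemma volume_constant:
  fixes N :: nat and t :: real
  defines "m \<equiv> Suc N" and "a \<equiv> 2 * pi / real (Suc N)"
  assumes N: "2 \<le> N" and t: "0 < t"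
  shows "(1 / (2 * pi)) ^ m * (a * unit_ball_vol (real N) * sqrt (2 / excess'' a) ^ N / sqrt (real m)) * sqrt t ^ N
    = t powr ((real m - 1) / 2) / K3 m"
proof -
  have a: "0 < a" "a < pi" "pi / real m = a / 2"
    using N by (auto simp: a_def m_def field_simps)
  define A' where "A' = excess'' a"
  have A: "0 < A'" using excess''_pos[OF a(1,2)] by (simp add: A'_def)
  have sqrt_pow: "sqrt z ^ N = z powr (real N / 2)" if "0 < z" for z
    using that by (simp add: powr_half_sqrt[symmetric] powr_powr powr_realpow[symmetric])
  have K: "K3 m = real m powr (3 / 2) * (2 * pi * A') powr (real N / 2) * Gamma (real N / 2 + 1)"
    unfolding K3_def a(3) A'_def excess''_def by (simp add: m_def field_simps)
  have G: "0 < Gamma (real N / 2 + 1)" by (intro Gamma_real_pos) auto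
  have m32: "real m powr (3 / 2) = real m * sqrt (real m)"
    using powr_add[of "real m" 1 "1 / 2"] by (simp add: m_def powr_half_sqrt)
  \<comment> \<open>Of the \<open>m\<close> factors 1 / (2 pi), one cancels against
    \<open>a\<close>. The other \<open>N\<close> become b powr (N / 2), which merges with the
    remaining powers of exponent N / 2 into a power of 1 / (2 pi A').\<close>
  define b where "b = (1 / (2 * pi)) powr 2"
  have b: "0 < b" by (simp add: b_def)
  have pow: "(1 / (2 * pi)) ^ m = (1 / (2 * pi)) * b powr (real N / 2)"
  proof -
    have "2 * (real N / 2) = real N" by simp
    then have "b powr (real N / 2) = (1 / (2 * pi)) powr real N"
      by (simp only: b_def powr_powr)
    also have "\<dots> = (1 / (2 * pi)) ^ N" by (rule powr_realpow) simp
    finally show ?thesis unfolding m_def power_Suc by (simp only:)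
  qed
  have "b powr (real N / 2) * pi powr (real N / 2) * (2 / A') powr (real N / 2)
      = (b * pi * (2 / A')) powr (real N / 2)"
    using A b by (simp add: powr_mult del: times_divide_eq_right)
  also have "b * pi * (2 / A') = 1 / (2 * pi * A')"
    using A by (simp add: b_def powr_numeral power2_eq_square field_simps)
  also have "(1 / (2 * pi * A')) powr (real N / 2) = 1 / (2 * pi * A') powr (real N / 2)"
    using A by (simp add: powr_divide)
  finally have P: "b powr (real N / 2) * pi powr (real N / 2) * (2 / A') powr (real N / 2)
    = 1 / (2 * pi * A') powr (real N / 2)" .
  have "(1 / (2 * pi)) ^ m * (a * unit_ball_vol (real N) * sqrt (2 / A') ^ N / sqrt (real m)) * sqrt t ^ N
    = (b powr (real N / 2) * pi powr (real N / 2) * (2 / A') powr (real N / 2))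
      * (t powr (real N / 2) / (real m * sqrt (real m) * Gamma (real N / 2 + 1)))"
    using A t unfolding pow sqrt_pow[OF t] sqrt_pow[OF divide_pos_pos[OF zero_less_numeral A]] unit_ball_vol_def a_def
    by (simp add: m_def mult_ac)
  also have "\<dots> = t powr (real N / 2) / K3 m"
    unfolding P K m32 by simp
  finally show ?thesis by (simp add: m_def A'_def)
qed

section \<open>The rate of convergence\<close>

lemma abs_exp_minus_diff_le:
  fixes x y :: real
  assumes "0 \<le> x" "0 \<le> y"
  shows "\<bar>exp (- x) - exp (- y)\<bar> \<le> \<bar>x - y\<bar>"
proof -
  have *: "\<bar>exp (- a) - exp (- b)\<bar> \<le> b - a" if "0 \<le> a" "a \<le> b" for a b :: real
  proof -
    have "exp (- a) - exp (- b) = exp (- a) * (1 - exp (- (b - a)))"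
      by (simp add: algebra_simps flip: exp_add)
    also have "\<dots> \<le> 1 * (b - a)"
    proof (intro mult_mono)
      show "1 - exp (- (b - a)) \<le> b - a" using exp_ge_add_one_self[of "- (b - a)"] by linarith
    qed (use that in auto)
    finally show ?thesis using that by simp
  qed
  show ?thesis using *[of x y] *[of y x] assms by (cases "x \<le> y") auto
qed

lemma (in uniform_angles) near_event_poisson:
  assumes m: "0 < m"
  shows "\<bar>prob (\<Union>\<alpha>\<in>index_lists m n. near m s \<alpha>) - (1 - exp (- (\<Sum>\<alpha>\<in>index_lists m n. prob (near m s \<alpha>))))\<bar>
    \<le> (\<Sum>\<alpha>\<in>index_lists m n. \<Sum>\<beta>\<in>index_lists m n \<inter> {\<beta>. set \<alpha> \<inter> set \<beta> \<noteq> {}}. prob (near m s \<alpha>) * prob (near m s \<beta>))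
      + (\<Sum>\<alpha>\<in>index_lists m n. \<Sum>\<beta>\<in>index_lists m n \<inter> {\<beta>. set \<alpha> \<inter> set \<beta> \<noteq> {}}.
          if \<alpha> = \<beta> then 0 else prob (near m s \<alpha> \<inter> near m s \<beta>))"
proof -
  let ?A = "index_lists m n" and ?E = "near m s"
  let ?B = "\<lambda>\<alpha>. {\<beta>. set \<alpha> \<inter> set \<beta> \<noteq> {}} :: nat list set"
  have ev: "?E \<alpha> \<in> events" if "\<alpha> \<in> ?A" for \<alpha> using near_events[OF m that] .
  have main: "\<bar>prob (space M - (\<Union>\<alpha>\<in>?A. ?E \<alpha>)) - exp (- (\<Sum>\<alpha>\<in>?A. prob (?E \<alpha>)))\<bar>
    \<le> (\<Sum>\<alpha>\<in>?A. \<Sum>\<beta>\<in>?A \<inter> ?B \<alpha>. prob (?E \<alpha>) * prob (?E \<beta>))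
      + (\<Sum>\<alpha>\<in>?A. \<Sum>\<beta>\<in>?A \<inter> ?B \<alpha> - {\<alpha>}. prob (?E \<alpha> \<inter> ?E \<beta>))"
  proof (rule local_dependence_poisson)
    show "finite ?A" by simp
    show "?E \<alpha> \<in> events" if "\<alpha> \<in> ?A" for \<alpha> using ev[OF that] .
    show "\<alpha> \<in> ?B \<alpha>" if "\<alpha> \<in> ?A" for \<alpha> using that m by (auto simp: index_lists_def)
    fix \<alpha> and y :: real assume \<alpha>: "\<alpha> \<in> ?A" and y: "0 \<le> y" "y \<le> 1"
    have "?A - ?B \<alpha> = {\<beta> \<in> ?A. set \<alpha> \<inter> set \<beta> = {}}" by auto
    then show "expectation (\<lambda>\<omega>. indicator (?E \<alpha>) \<omega> * y ^ card {\<beta> \<in> ?A - ?B \<alpha>. \<omega> \<in> ?E \<beta>})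
        = prob (?E \<alpha>) * expectation (\<lambda>\<omega>. y ^ card {\<beta> \<in> ?A - ?B \<alpha>. \<omega> \<in> ?E \<beta>})"
      using near_independent[OF m \<alpha> y, of s] by (simp only:)
  qed
  \<comment> \<open>Zeros on the diagonal let both error sums run over the same intersecting pairs,
    the form that \<open>sum_intersecting_le\<close> bounds.\<close>
  have "(\<Sum>\<beta>\<in>?A \<inter> ?B \<alpha> - {\<alpha>}. prob (?E \<alpha> \<inter> ?E \<beta>))
      = (\<Sum>\<beta>\<in>?A \<inter> ?B \<alpha>. if \<alpha> = \<beta> then 0 else prob (?E \<alpha> \<inter> ?E \<beta>))" for \<alpha>
    by (rule sum.mono_neutral_cong_left) auto
  note main = main[unfolded this]
  have "prob (space M - (\<Union>\<alpha>\<in>?A. ?E \<alpha>)) = 1 - prob (\<Union>\<alpha>\<in>?A. ?E \<alpha>)"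
    using ev by (intro prob_compl) auto
  then show ?thesis using main by linarith
qed

lemma (in uniform_angles) near_event_rate:
  fixes t :: real
  assumes m: "3 \<le> m" and t: "0 < t"
  shows "\<exists>C n0. \<forall>n\<ge>n0. \<bar>prob (\<Union>\<alpha>\<in>index_lists m n. near m (t / real n powr (2 * real m / (real m - 1))) \<alpha>)
      - (1 - exp (- (t powr ((real m - 1) / 2) / K3 m)))\<bar> \<le> C * real n powr (- 1 / (real m - 1))"
proof -
  obtain N where N: "m = Suc N" "2 \<le> N" using m by (cases m) auto
  define \<mu> where "\<mu> = t powr ((real m - 1) / 2) / K3 m"
  define V where "V = 2 * pi / real m * unit_ball_vol (real N) * sqrt (2 / excess'' (2 * pi / real m)) ^ N / sqrt (real m)"
  have \<mu>: "\<mu> = (1 / (2 * pi)) ^ m * V * sqrt t ^ N"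
    using volume_constant[OF N(2) t] unfolding \<mu>_def V_def N(1) by simp
  have \<mu>0: "0 \<le> \<mu>"
  proof -
    have "0 < 2 * pi / real m" "2 * pi / real m < pi" using m by (auto simp: field_simps)
    from excess''_pos[OF this] show ?thesis unfolding \<mu> V_def using t by (intro mult_nonneg_nonneg divide_nonneg_nonneg) auto
  qed
  let ?vol = "\<lambda>s. measure (PiM {..<m} (\<lambda>_. lborel)) {\<theta> \<in> space (PiM {..<m} (\<lambda>_. lborel)). near_regular m s \<theta>}"
  have "\<exists>C s\<^sub>0. 0 < C \<and> 0 < s\<^sub>0 \<and> (\<forall>s. 0 < s \<longrightarrow> s \<le> s\<^sub>0 \<longrightarrow> \<bar>?vol s - V * sqrt s ^ N\<bar> \<le> C * sqrt s ^ m)"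
  proof (rule volume_near_regular[OF N(2)], goal_cases)
    case (1 C s\<^sub>0)
    then show ?case unfolding V_def N(1) by blast
  qed
  then obtain C1 s1 where C1: "0 < C1" "0 < s1"
    and vol: "\<And>s. 0 < s \<Longrightarrow> s \<le> s1 \<Longrightarrow> \<bar>?vol s - V * sqrt s ^ N\<bar> \<le> C1 * sqrt s ^ m" by blast
  have "\<exists>D s\<^sub>0. 0 < D \<and> 0 < s\<^sub>0 \<and> (\<forall>s \<alpha> \<beta> n. 0 < s \<longrightarrow> s \<le> s\<^sub>0 \<longrightarrow> \<alpha> \<in> index_lists m n \<longrightarrow> \<beta> \<in> index_lists m n
      \<longrightarrow> set \<alpha> \<inter> set \<beta> \<noteq> {} \<longrightarrow> prob (near m s \<alpha> \<inter> near m s \<beta>) \<le> (D * sqrt s) ^ (card (set \<alpha> \<union> set \<beta>) - 1))"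
  proof (rule prob_near_inter_le[OF m], goal_cases)
    case (1 D s\<^sub>0)
    show ?case by (intro exI[of _ D] exI[of _ s\<^sub>0] conjI allI impI 1)
  qed
  then obtain D s2 where D: "0 < D" "0 < s2"
    and pair: "\<And>s \<alpha> \<beta> n. 0 < s \<Longrightarrow> s \<le> s2 \<Longrightarrow> \<alpha> \<in> index_lists m n \<Longrightarrow> \<beta> \<in> index_lists m n \<Longrightarrow> set \<alpha> \<inter> set \<beta> \<noteq> {} \<Longrightarrow>
      prob (near m s \<alpha> \<inter> near m s \<beta>) \<le> (D * sqrt s) ^ (card (set \<alpha> \<union> set \<beta>) - 1)" by blast
  define C2 where "C2 = (1 / (2 * pi)) ^ m * C1 * sqrt t ^ m"
  have C2: "0 \<le> C2" using C1 t by (simp add: C2_def)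
  define F where "F = real (2 * m) ^ (2 * m)"
  have F: "0 \<le> F" by (simp add: F_def)
  \<comment> \<open>The maximum with 1 makes this dominate every power of D * sqrt t that occurs,
    whether the base is below or above 1.\<close>
  define G where "G = max 1 (D * sqrt t) ^ (2 * m)"
  \<comment> \<open>The summands account for products of probabilities (\<open>b1\<close>), joint
    probabilities (\<open>b2\<close>), and the distance of the expected count from its limit
    (\<open>b3\<close>).\<close>
  define C where "C = real m * (F * (\<mu> + C2)\<^sup>2) + real m * (F * G) + (C2 + \<mu> * real m ^ 2)"
  \<comment> \<open>Below, \<open>s\<close> turns out to be at most t / n, so from this index on
    both local estimates apply.\<close>
  obtain n0 :: nat where n0: "t / min s1 s2 \<le> real n0" using real_arch_simple by blast
  show ?thesis
  proof (intro exI[of _ C] exI[of _ "max m n0"] allI impI)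
    fix n assume n: "max m n0 \<le> n"
    then have n1: "0 < n" "m \<le> n" using m by auto
    \<comment> \<open>The unit in which all errors are measured: 1 / n = x ^ N and s = t * x ^ (2m),
      so the comparisons become comparisons of natural exponents with x \<le> 1.\<close>
    define x where "x = real n powr (- 1 / (real m - 1))"
    have Nm: "real m - 1 = real N" "real N \<noteq> 0" using N by auto
    have x0: "0 < x" using n1 by (simp add: x_def)
    have xN: "x ^ N = 1 / real n"
    proof -
      have "x ^ N = real n powr (- 1 / real N * real N)"
        using n1 by (simp only: x_def Nm(1) powr_powr[symmetric] powr_realpow[OF x0[unfolded x_def Nm(1)]])
      also have "- 1 / real N * real N = - 1" using Nm(2) by simp
      finally show ?thesis using n1 by (simp add: powr_minus_divide)
    qed
    have x1: "x \<le> 1"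
    proof (rule ccontr)
      assume "\<not> x \<le> 1"
      then have "1 < x ^ N" using N by (intro one_less_power) auto
      then show False using xN n1 by simp
    qed
    have nx: "real n * x ^ N = 1" using xN n1 by simp
    have inv_n: "1 / real n \<le> x"
      using power_decreasing[of 1 N x] x0 x1 N unfolding xN by simp
    define s where "s = t / real n powr (2 * real m / (real m - 1))"
    have s_x: "s = t * (x ^ m)\<^sup>2"
    proof -
      have "(x ^ m)\<^sup>2 = x powr (real (2 * m))"
        using powr_realpow[OF x0, of "2 * m"] by (simp add: power_mult mult.commute)
      also have "\<dots> = real n powr (- (2 * real m / (real m - 1)))"
        unfolding x_def powr_powr by simp
      finally show ?thesis unfolding s_def by (simp add: powr_minus_divide)
    qed
    have s0: "0 < s" using t n1 by (simp add: s_def)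
    have u: "sqrt s = sqrt t * x ^ m" using x0 unfolding s_x by (simp add: real_sqrt_mult)
    have s_le: "s \<le> s1" "s \<le> s2"
    proof -
      have "(x ^ m)\<^sup>2 = x ^ (2 * m)" by (simp add: power_mult mult.commute)
      also have "\<dots> \<le> x ^ N" using x0 x1 N by (intro power_decreasing) auto
      finally have "s \<le> t * (1 / real n)" unfolding s_x xN using t by (intro mult_left_mono) auto
      also have "\<dots> \<le> min s1 s2"
      proof -
        have "real n0 \<le> real n" using n by simp
        then have "t / min s1 s2 \<le> real n" using n0 by linarith
        moreover have "0 < min s1 s2" using C1(2) D(2) by simp
        ultimately have "t \<le> real n * min s1 s2" by (simp only: pos_divide_le_eq)
        then have "t / real n \<le> min s1 s2" using n1 by (simp only: pos_divide_le_eq of_nat_0_less_iff mult.commute)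
        then show ?thesis by (simp only: times_divide_eq_right mult_1_right)
      qed
      finally show "s \<le> s1" "s \<le> s2" by auto
    qed
    define q where "q = (1 / (2 * pi)) ^ m * ?vol s"
    have q: "prob (near m s \<alpha>) = q" if "\<alpha> \<in> index_lists m n" for \<alpha>
      using prob_near[OF _ that, of s] m unfolding q_def by simp
    have q_0: "0 \<le> q" by (simp add: q_def)
    have xmN: "(x ^ m) ^ N = 1 / real n ^ m"
    proof -
      have "(x ^ m) ^ N = (x ^ N) ^ m" by (simp only: power_mult[symmetric] mult.commute)
      then show ?thesis by (simp only: xN power_one_over)
    qed
    have q_near: "\<bar>q - \<mu> / real n ^ m\<bar> \<le> C2 * x / real n ^ m"
    proof -
      have "\<mu> / real n ^ m = (1 / (2 * pi)) ^ m * (V * sqrt s ^ N)"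
        unfolding \<mu> u power_mult_distrib xmN by simp
      then have "\<bar>q - \<mu> / real n ^ m\<bar> = (1 / (2 * pi)) ^ m * \<bar>?vol s - V * sqrt s ^ N\<bar>"
        unfolding q_def by (simp add: abs_mult flip: right_diff_distrib)
      also have "\<dots> \<le> (1 / (2 * pi)) ^ m * (C1 * sqrt s ^ m)"
        by (intro mult_left_mono vol s0 s_le) auto
      also have "\<dots> = C2 * (x ^ m) ^ m" unfolding u C2_def power_mult_distrib by simp
      also have "(x ^ m) ^ m = x ^ m * (1 / real n ^ m)" using xmN by (simp add: N(1))
      also have "C2 * (x ^ m * (1 / real n ^ m)) \<le> C2 * (x * (1 / real n ^ m))"
        using C2 power_decreasing[of 1 m x] x0 x1 m by (intro mult_left_mono mult_right_mono) auto
      finally show ?thesis by simp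
    qed
    have q_le: "q \<le> (\<mu> + C2) / real n ^ m"
    proof -
      have "C2 * x \<le> C2" using C2 x1 by (intro mult_left_le) auto
      then have "C2 * x / real n ^ m \<le> C2 / real n ^ m" by (intro divide_right_mono) auto
      then show ?thesis using q_near by (simp add: add_divide_distrib abs_le_iff)
    qed
    let ?A = "index_lists m n"
    let ?B = "\<lambda>\<alpha>. ?A \<inter> {\<beta>. set \<alpha> \<inter> set \<beta> \<noteq> {}}"
    have card_ks: "real (card {m..2 * m - 1}) = real m" using m by simp
    have b1: "(\<Sum>\<alpha>\<in>?A. \<Sum>\<beta>\<in>?B \<alpha>. prob (near m s \<alpha>) * prob (near m s \<beta>)) \<le> real m * (F * (\<mu> + C2)\<^sup>2) * x"
    proof -
      have "(\<Sum>\<alpha>\<in>?A. \<Sum>\<beta>\<in>?B \<alpha>. prob (near m s \<alpha>) * prob (near m s \<beta>))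
        \<le> (\<Sum>k\<in>{m..2 * m - 1}. real n ^ k * real (2 * m) ^ (2 * m) * q\<^sup>2)"
        using m q by (intro sum_intersecting_le) (auto simp: power2_eq_square)
      also have "\<dots> \<le> (\<Sum>k\<in>{m..2 * m - 1}. F * (\<mu> + C2)\<^sup>2 * x)"
      proof (rule sum_mono)
        fix k assume k: "k \<in> {m..2 * m - 1}"
        have "real n ^ k * q\<^sup>2 \<le> real n ^ (2 * m - 1) * ((\<mu> + C2) / real n ^ m)\<^sup>2"
          using k n1 q_0 q_le by (intro mult_mono power_mono power_increasing) auto
        also have "\<dots> = (\<mu> + C2)\<^sup>2 * (1 / real n)"
        proof -
          have "real n ^ (2 * m) = real n * real n ^ (2 * m - 1)"
            using m by (simp flip: power_Suc)
          then show ?thesis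
            using n1 by (simp add: power_divide field_simps flip: power_mult)
        qed
        also have "\<dots> \<le> (\<mu> + C2)\<^sup>2 * x" using inv_n by (intro mult_left_mono) auto
        finally have "F * (real n ^ k * q\<^sup>2) \<le> F * ((\<mu> + C2)\<^sup>2 * x)" using F by (intro mult_left_mono)
        then show "real n ^ k * real (2 * m) ^ (2 * m) * q\<^sup>2 \<le> F * (\<mu> + C2)\<^sup>2 * x"
          unfolding F_def[symmetric] by (simp add: mult_ac)
      qed
      also have "\<dots> = real m * (F * (\<mu> + C2)\<^sup>2) * x" unfolding sum_constant card_ks by (simp add: mult_ac)
      finally show ?thesis .
    qed
    have b2: "(\<Sum>\<alpha>\<in>?A. \<Sum>\<beta>\<in>?B \<alpha>. if \<alpha> = \<beta> then 0 else prob (near m s \<alpha> \<inter> near m s \<beta>)) \<le> real m * (F * G) * x"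
    proof -
      \<comment> \<open>The value 0 for k \<le> m is legitimate: distinct tuples with a union of
        size \<open>m\<close> have the same index set, so their events are disjoint, and equal
        tuples contribute 0 by definition.\<close>
      let ?c = "\<lambda>k. if k \<le> m then 0 else (D * sqrt s) ^ (k - 1)"
      have "(\<Sum>\<alpha>\<in>?A. \<Sum>\<beta>\<in>?B \<alpha>. if \<alpha> = \<beta> then 0 else prob (near m s \<alpha> \<inter> near m s \<beta>))
        \<le> (\<Sum>k\<in>{m..2 * m - 1}. real n ^ k * real (2 * m) ^ (2 * m) * ?c k)"
      proof (rule sum_intersecting_le)
        show "0 < m" using m by simp
        show "0 \<le> ?c k" for k using D s0 by simp
        fix \<alpha> \<beta> assume \<alpha>: "\<alpha> \<in> ?A" and \<beta>: "\<beta> \<in> ?A" and int: "set \<alpha> \<inter> set \<beta> \<noteq> {}"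
        show "(if \<alpha> = \<beta> then 0 else prob (near m s \<alpha> \<inter> near m s \<beta>)) \<le> ?c (card (set \<alpha> \<union> set \<beta>))"
        proof (cases "\<alpha> \<noteq> \<beta> \<and> card (set \<alpha> \<union> set \<beta>) \<le> m")
          case True
          have c: "card (set \<alpha>) = m" "card (set \<beta>) = m"
            using \<alpha> \<beta> distinct_card[of \<alpha>] distinct_card[of \<beta>] by (auto simp: index_lists_def)
          have "set \<alpha> = set \<alpha> \<union> set \<beta>" "set \<beta> = set \<alpha> \<union> set \<beta>"
            using True c by (intro card_seteq; simp)+
          then have "set \<alpha> = set \<beta>" by simp
          then have "near m s \<alpha> \<inter> near m s \<beta> = {}"
            using near_unique[OF \<alpha> \<beta>] True by blast
          then show ?thesis using True by simp
        next
          case False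
          then show ?thesis using pair[OF s0 s_le(2) \<alpha> \<beta> int] D s0 by auto
        qed
      qed
      also have "\<dots> \<le> (\<Sum>k\<in>{m..2 * m - 1}. F * G * x)"
      proof (rule sum_mono)
        fix k assume k: "k \<in> {m..2 * m - 1}"
        have G0: "0 \<le> G" by (simp add: G_def)
        show "real n ^ k * real (2 * m) ^ (2 * m) * ?c k \<le> F * G * x"
        proof (cases "k \<le> m")
          case True
          then show ?thesis using F G0 x0 by simp
        next
          case False
          then obtain j where j: "k = Suc (m + j)" using less_imp_Suc_add[of m k] by auto
          have "(D * sqrt s) ^ (k - 1) = (D * sqrt t) ^ (m + j) * (x ^ m) ^ (m + j)"
            unfolding u by (simp add: j power_mult_distrib mult.assoc[symmetric])
          \<comment> \<open>Since m = N + 1 and k = m + j + 1, one has m (m + j) = N k + (j + 1).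
            The factor x ^ (N k) cancels n ^ k; the surviving power is at most x, with equality for
            j = 0.\<close>
          moreover have "(x ^ m) ^ (m + j) = (x ^ N) ^ k * x ^ Suc j"
            unfolding power_mult[symmetric] power_add[symmetric] by (simp add: j N(1) algebra_simps)
          ultimately have "real n ^ k * (D * sqrt s) ^ (k - 1) = (D * sqrt t) ^ (m + j) * ((real n * x ^ N) ^ k * x ^ Suc j)"
            by (simp add: power_mult_distrib)
          also have "\<dots> = (D * sqrt t) ^ (m + j) * x ^ Suc j" unfolding nx by simp
          also have "\<dots> \<le> G * x"
          proof (intro mult_mono)
            have "(D * sqrt t) ^ (m + j) \<le> max 1 (D * sqrt t) ^ (m + j)"
              using D t by (intro power_mono) auto
            also have "\<dots> \<le> G" unfolding G_def using k j by (intro power_increasing) auto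
            finally show "(D * sqrt t) ^ (m + j) \<le> G" .
            show "x ^ Suc j \<le> x" using power_decreasing[of 1 "Suc j" x] x0 x1 by simp
          qed (use G0 x0 in auto)
          finally have "F * (real n ^ k * (D * sqrt s) ^ (k - 1)) \<le> F * (G * x)" using F by (intro mult_left_mono)
          then show ?thesis using False unfolding F_def[symmetric] by (simp add: mult_ac)
        qed
      qed
      also have "\<dots> = real m * (F * G) * x" unfolding sum_constant card_ks by (simp add: mult_ac)
      finally show ?thesis .
    qed
    define \<Lambda> where "\<Lambda> = (\<Sum>\<alpha>\<in>?A. prob (near m s \<alpha>))"
    have \<Lambda>: "\<Lambda> = real (card ?A) * q" unfolding \<Lambda>_def using q by simp
    have b3: "\<bar>\<Lambda> - \<mu>\<bar> \<le> (C2 + \<mu> * real m ^ 2) * x"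
    proof -
      have nm: "0 < real n ^ m" using n1 by simp
      have "\<bar>real (card ?A) * (q - \<mu> / real n ^ m)\<bar> = real (card ?A) * \<bar>q - \<mu> / real n ^ m\<bar>" by (simp add: abs_mult)
      also have "\<dots> \<le> real n ^ m * (C2 * x / real n ^ m)"
        using card_index_lists_bounds(1)[OF n1(2,1)] q_near by (intro mult_mono) auto
      finally have 1: "\<bar>real (card ?A) * (q - \<mu> / real n ^ m)\<bar> \<le> C2 * x" using nm n1(1) by simp
      have "\<bar>real (card ?A) - real n ^ m\<bar> \<le> real m ^ 2 * real n ^ m / real n"
        using card_index_lists_bounds[OF n1(2,1)] by linarith
      then have "\<mu> / real n ^ m * \<bar>real (card ?A) - real n ^ m\<bar> \<le> \<mu> / real n ^ m * (real m ^ 2 * real n ^ m / real n)"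
        using \<mu>0 by (intro mult_left_mono) auto
      also have "\<dots> = \<mu> * real m ^ 2 * (1 / real n)" using nm by simp
      also have "\<dots> \<le> \<mu> * real m ^ 2 * x" using inv_n \<mu>0 by (intro mult_left_mono) auto
      finally have 2: "\<mu> / real n ^ m * \<bar>real (card ?A) - real n ^ m\<bar> \<le> \<mu> * real m ^ 2 * x" .
      \<comment> \<open>Separates the error of a single probability from that of replacing the
        number of tuples by n ^ m.\<close>
      have "\<Lambda> - \<mu> = real (card ?A) * (q - \<mu> / real n ^ m) + \<mu> / real n ^ m * (real (card ?A) - real n ^ m)"
        unfolding \<Lambda> using n1(1) by (simp add: field_simps)
      then have "\<bar>\<Lambda> - \<mu>\<bar> \<le> \<bar>real (card ?A) * (q - \<mu> / real n ^ m)\<bar> + \<mu> / real n ^ m * \<bar>real (card ?A) - real n ^ m\<bar>"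
        using abs_triangle_ineq[of "real (card ?A) * (q - \<mu> / real n ^ m)" "\<mu> / real n ^ m * (real (card ?A) - real n ^ m)"]
          \<mu>0 by (simp add: abs_mult)
      then show ?thesis using 1 2 by (simp add: distrib_right)
    qed
    have \<Lambda>0: "0 \<le> \<Lambda>" unfolding \<Lambda> using q_0 by simp
    have "\<bar>prob (\<Union>\<alpha>\<in>?A. near m s \<alpha>) - (1 - exp (- \<Lambda>))\<bar> \<le> real m * (F * (\<mu> + C2)\<^sup>2) * x + real m * (F * G) * x"
      using near_event_poisson[of m s n] b1 b2 m unfolding \<Lambda>_def by linarith
    moreover have "\<bar>exp (- \<Lambda>) - exp (- \<mu>)\<bar> \<le> (C2 + \<mu> * real m ^ 2) * x"
      using abs_exp_minus_diff_le[OF \<Lambda>0 \<mu>0] b3 by linarith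
    ultimately have "\<bar>prob (\<Union>\<alpha>\<in>?A. near m s \<alpha>) - (1 - exp (- \<mu>))\<bar> \<le>
        real m * (F * (\<mu> + C2)\<^sup>2) * x + real m * (F * G) * x + (C2 + \<mu> * real m ^ 2) * x"
      by linarith
    also have "\<dots> = C * x" by (simp only: C_def distrib_right)
    finally show "\<bar>prob (\<Union>\<alpha>\<in>?A. near m (t / real n powr (2 * real m / (real m - 1))) \<alpha>)
      - (1 - exp (- (t powr ((real m - 1) / 2) / K3 m)))\<bar> \<le> C * real n powr (- 1 / (real m - 1))"
      unfolding s_def \<mu>_def x_def .
  qed
qed

section \<open>From points on the circle to their angles\<close>

lemma borel_measurable_Arg2pi [measurable]: "Arg2pi \<in> borel_measurable borel"
  by (rule borel_measurableI_greater) (use open_Arg2pi2pi_gt in \<open>simp add: borel_open\<close>)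

lemma distr_Arg2pi_uniform_circle: "distr uniform_circle borel Arg2pi = angle_measure"
proof -
  have [measurable]: "cis \<in> borel_measurable borel"
    by (intro borel_measurable_continuous_onI continuous_on_cis continuous_on_id)
  have "distr uniform_circle borel Arg2pi = distr angle_measure borel (\<lambda>x. Arg2pi (cis x))"
    unfolding uniform_circle_def angle_measure_def by (subst distr_distr) (auto simp: comp_def)
  also have "\<dots> = distr angle_measure borel (\<lambda>x. x)"
  proof (rule distr_cong_AE)
    have "AE x in angle_measure. x \<in> {0..<2 * pi}"
      unfolding angle_measure_def by (rule AE_uniform_measureI) auto
    then show "AE x in angle_measure. Arg2pi (cis x) = x"
      by eventually_elim (auto intro: Arg2pi_cis)
  qed auto
  also have "\<dots> = angle_measure" by (rule distr_id2) simp
  finally show ?thesis .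
qed

theorem theorem3:
  fixes M :: "'a measure" and U :: "nat \<Rightarrow> 'a \<Rightarrow> complex" and m :: nat and t :: real
  assumes m: "m \<ge> 3"
    and M: "prob_space M"
    and indep: "prob_space.indep_vars M (\<lambda>_. borel) U {1..}"
    and unif: "\<And>i. i \<ge> 1 \<Longrightarrow> distr M borel (U i) = uniform_circle"
    and t: "t > 0"
  defines "p \<equiv> \<lambda>n. measure M {\<omega> \<in> space M.
      ereal (real n powr (2 * real m / (real m - 1)))
        * (min_perimeter m n (\<lambda>i. U i \<omega>) - ereal (2 * real m * tan (pi / real m))) \<le> ereal t}"
    and "L \<equiv> 1 - exp (- (t powr ((real m - 1) / 2) / K3 m))"
  shows "p \<longlonglongrightarrow> L
    \<and> (\<lambda>n. \<bar>p n - L\<bar>) \<in> O(\<lambda>n. real n powr (- 1 / (real m - 1)))"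
proof -
  interpret prob_space M by (rule M)
  have U [measurable]: "U i \<in> borel_measurable M" if "1 \<le> i" for i
    using indep that by (simp add: indep_vars_def)
  define \<Theta> where "\<Theta> = (\<lambda>i \<omega>. Arg2pi (U i \<omega>))"
  interpret uniform_angles M \<Theta>
  proof
    show "indep_vars (\<lambda>_. borel) \<Theta> {1..}"
      unfolding \<Theta>_def by (rule indep_vars_compose2[OF indep]) auto
    fix i :: nat assume i: "1 \<le> i"
    have "distr M borel (\<Theta> i) = distr (distr M borel (U i)) borel Arg2pi"
      unfolding \<Theta>_def using U[OF i] by (subst distr_distr) (auto simp: comp_def)
    then show "distr M borel (\<Theta> i) = angle_measure"
      by (simp only: unif[OF i] distr_Arg2pi_uniform_circle)
  qed
  let ?s = "\<lambda>n. t / real n powr (2 * real m / (real m - 1))"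
  have near_iff: "\<omega> \<in> near m s \<alpha> \<longleftrightarrow> \<omega> \<in> space M \<and> near_regular m s (\<lambda>k. Arg2pi (U (\<alpha> ! k) \<omega>))" for s \<alpha> \<omega>
    unfolding near_def by (simp add: \<Theta>_def)
  have on_circle: "AE \<omega> in M. U i \<omega> \<in> sphere 0 1" if "1 \<le> i" for i
  proof -
    have cis [measurable]: "cis \<in> borel_measurable borel"
      by (intro borel_measurable_continuous_onI continuous_on_cis continuous_on_id)
    have "AE z in uniform_circle. z \<in> sphere 0 1"
      unfolding uniform_circle_def by (subst AE_distr_iff) (auto simp: norm_cis)
    then have "AE z in distr M borel (U i). z \<in> sphere 0 1" by (simp only: assms(4)[OF that])
    then show ?thesis by (rule AE_distrD[OF U[OF that]])
  qed
  \<comment> \<open>For n = 0 the scaling factor is 0 and cannot be divided out; the limit and the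
    rate ignore this index. The points lie on the circle only almost surely, so the two events agree
    only up to a null set.\<close>
  have p: "p n = prob (\<Union>\<alpha>\<in>index_lists m n. near m (?s n) \<alpha>)" if n: "0 < n" for n
  proof -
    let ?E = "{\<omega> \<in> space M. \<exists>\<alpha>\<in>index_lists m n. (\<forall>i\<in>set \<alpha>. U i \<omega> \<in> sphere 0 1) \<and> \<omega> \<in> near m (?s n) \<alpha>}"
    have m0: "0 < m" using m by simp
    have "0 < real n powr (2 * real m / (real m - 1))" using n by simp
    then have "p n = prob ?E"
      unfolding p_def scaled_excess_le_iff[OF \<open>0 < real n powr _\<close>] min_perimeter_le_iff[OF m0]
      by (intro arg_cong[of _ _ prob]) (auto simp: near_iff)
    also have "\<dots> = prob (\<Union>\<alpha>\<in>index_lists m n. near m (?s n) \<alpha>)"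
    proof (rule finite_measure_eq_AE)
      have "AE \<omega> in M. \<forall>i\<in>{1..n}. U i \<omega> \<in> sphere 0 1"
        by (intro AE_finite_allI on_circle) auto
      then show "AE \<omega> in M. \<omega> \<in> ?E \<longleftrightarrow> \<omega> \<in> (\<Union>\<alpha>\<in>index_lists m n. near m (?s n) \<alpha>)"
      proof eventually_elim
        case (elim \<omega>)
        then have "\<forall>i\<in>set \<alpha>. U i \<omega> \<in> sphere 0 1" if "\<alpha> \<in> index_lists m n" for \<alpha>
          using that unfolding index_lists_def by blast
        then show ?case by (auto simp: near_def)
      qed
      show un: "(\<Union>\<alpha>\<in>index_lists m n. near m (?s n) \<alpha>) \<in> events"
        using near_events[OF m0] by (intro sets.finite_UN) auto
      have "?E = (\<Union>\<alpha>\<in>index_lists m n. {\<omega> \<in> space M. \<forall>i\<in>set \<alpha>. U i \<omega> \<in> sphere 0 1} \<inter> near m (?s n) \<alpha>)"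
        by (auto simp: near_def)
      also have "\<dots> \<in> events"
      proof (intro sets.finite_UN sets.Int near_events[OF m0])
        fix \<alpha> assume \<alpha>: "\<alpha> \<in> index_lists m n"
        have "Measurable.pred M (\<lambda>\<omega>. \<forall>i\<in>set \<alpha>. U i \<omega> \<in> sphere 0 1)"
        proof (intro pred_intros_finite)
          fix i assume "i \<in> set \<alpha>"
          then have "1 \<le> i" using \<alpha> by (auto simp: index_lists_def)
          then have [measurable]: "U i \<in> borel_measurable M" by (rule U)
          have "sphere 0 1 \<in> sets (borel :: complex measure)" by (intro borel_closed closed_sphere)
          then show "Measurable.pred M (\<lambda>\<omega>. U i \<omega> \<in> sphere 0 1)" by measurable
        qed auto
        then show "{\<omega> \<in> space M. \<forall>i\<in>set \<alpha>. U i \<omega> \<in> sphere 0 1} \<in> events" by (simp add: pred_def)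
      qed auto
      finally show "?E \<in> events" .
    qed
    finally show ?thesis .
  qed
  obtain C n0 where rate: "\<forall>n\<ge>n0. \<bar>prob (\<Union>\<alpha>\<in>index_lists m n. near m (?s n) \<alpha>) - L\<bar> \<le> C * real n powr (- 1 / (real m - 1))"
    using near_event_rate[OF m t] unfolding L_def by blast
  have bound: "\<forall>\<^sub>F n in sequentially. \<bar>p n - L\<bar> \<le> C * real n powr (- 1 / (real m - 1))"
    using rate p by (intro eventually_sequentiallyI[of "max 1 n0"]) auto
  have "(\<lambda>n. C * real n powr (- 1 / (real m - 1))) \<longlonglongrightarrow> C * 0"
    using m by (intro tendsto_mult tendsto_const tendsto_neg_powr filterlim_real_sequentially) auto
  then have "(\<lambda>n. p n - L) \<longlonglongrightarrow> 0"
    using bound by (intro Lim_null_comparison[of "\<lambda>n. p n - L"]) (auto simp: real_norm_def)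
  then have "p \<longlonglongrightarrow> L" by (simp add: LIM_zero_iff)
  moreover have "(\<lambda>n. \<bar>p n - L\<bar>) \<in> O(\<lambda>n. real n powr (- 1 / (real m - 1)))"
    using bound by (intro bigoI[of _ C]) (auto elim!: eventually_mono)
  ultimately show ?thesis by blast
qed

end
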